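(* In the setting described in the context (with $d\ge1$ and $p\ge1$ fixed finite integers), assume conditions C1–C4. Then as $n\to\infty$: (i) $\|\hat K-K\|_{\mathcal{S}}=O_p(n^{-1/2})$; (ii) for $j=1,\ldots,d$, $|\hat\theta_j-\theta_j|=O_p(n^{-1/2})$ and $\left(\int_{\mathcal{I}}\{\hat\psi_j(u)-\psi_j(u)\}^2du\right)^{1/2}=O_p(n^{-1/2})$; (iii) for $j\ge d+1$, $\hat\theta_j=O_p(n^{-1})$; (iv) let $\{\psi_j: j\ge d+1\}$ be any complete orthonormal basis of $\mathcal{M}^\perp$ and put $f_j(\cdot)=\sum_{i=d+1}^\infty\langle\psi_i,\hat\psi_j\rangle\psi_i(\cdot)$. Then for any $j\ge d+1$, $$\Big(\int_{\mathcal{I}}\Big\{\sum_{i=1}^d\langle\psi_i,\hat\psi_j\rangle\psi_i(u)\Big\}^2du\Big)^{1/2}=\Big(\int_{\mathcal{I}}\{\hat\psi_j(u)-f_j(u)\}^2du\Big)^{1/2}=O_p(n^{-1/2}).$$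
   Context: $\mathcal{I}$ is a compact interval, $L_2(\mathcal{I})$ has inner product $\langle f,g\rangle=\int_{\mathcal{I}}fg$; kernels $L(u,v)$ act as integral operators $(Lg)(u)=\int L(u,v)g(v)dv$, and $\|\cdot\|_{\mathcal{S}}$ is the Hilbert–Schmidt norm. Model: $Y_t(u)=X_t(u)+\varepsilon_t(u)$, $u\in\mathcal{I}$, where $E\varepsilon_t(u)=0$, $\operatorname{cov}(\varepsilon_t(u),\varepsilon_s(v))=0$ for all $u,v$ when $t\neq s$; $\int_{\mathcal{I}}E\{X_t(u)^2+\varepsilon_t(u)^2\}du<\infty$; $\mu(u)=EX_t(u)$ and $M_k(u,v)=\operatorname{cov}(X_t(u),X_{t+k}(v))$ do not depend on $t$. With $M_0(u,v)=\sum_j\lambda_j\varphi_j(u)\varphi_j(v)$ ($\lambda_1\ge\lambda_2\ge\dots\ge0$, $\varphi_j$ orthonormal), $X_t$ is $d$-dimensional: $\lambda_d\neq0=\lambda_{d+1}$, and $\mathcal{M}=\operatorname{span}\{\varphi_1,\ldots,\varphi_d\}$, $\mathcal{M}^\perp$ its orthogonal complement. Define $N_k(u,v)=\int_{\mathcal{I}}M_k(u,z)M_k(v,z)dz$ and $K=\sum_{k=1}^pN_k$. From observations $Y_1,\ldots,Y_n$ put $\bar Y=n^{-1}\sum_{j=1}^nY_j$, $\hat M_k(u,v)=\frac1{n-p}\sum_{j=1}^{n-p}\{Y_j(u)-\bar Y(u)\}\{Y_{j+k}(v)-\bar Y(v)\}$, and $\hat K(u,v)=\sum_{k=1}^p\int_{\mathcal{I}}\hat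 M_k(u,z)\hat M_k(v,z)dz$. $(\theta_j,\psi_j)$ and $(\hat\theta_j,\hat\psi_j)$ denote the (eigenvalue, orthonormal eigenfunction) pairs of $K$ and $\hat K$, eigenvalues in descending order; eigenfunctions are determined only up to sign and the appropriate signs are used. Conditions: C1: $\{Y_t(\cdot)\}$ is strictly stationary and $\psi$-mixing with $\psi(l)=\sup_{A\in\mathcal{F}_{-\infty}^0,B\in\mathcal{F}_l^\infty,P(A)P(B)>0}|1-P(B\mid A)/P(B)|$, where $\mathcal{F}_i^j=\sigma\{Y_i(\cdot),\ldots,Y_j(\cdot)\}$, and $\sum_{l=1}^\infty l\,\psi^{1/2}(l)<\infty$. C2: $E\{\int_{\mathcal{I}}Y_t(u)^2du\}^2<\infty$. C3: $\theta_1>\cdots>\theta_d>0=\theta_{d+1}=\theta_{d+2}=\cdots$. C4: $\operatorname{cov}\{X_s(u),\varepsilon_t(v)\}=0$ for all $s,t$ and $u,v\in\mathcal{I}$. *)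

theory Defs
  imports "HOL-Probability.Probability"
begin

definition L2ip :: "real \<Rightarrow> real \<Rightarrow> (real \<Rightarrow> real) \<Rightarrow> (real \<Rightarrow> real) \<Rightarrow> real" where
  "L2ip a b f g = (LINT u:{a..b}|lborel. f u * g u)"

definition L2norm :: "real \<Rightarrow> real \<Rightarrow> (real \<Rightarrow> real) \<Rightarrow> real" where
  "L2norm a b f = sqrt (LINT u:{a..b}|lborel. (f u)^2)"

definition inL2 :: "real \<Rightarrow> real \<Rightarrow> (real \<Rightarrow> real) \<Rightarrow> bool" where
  "inL2 a b f \<longleftrightarrow> set_borel_measurable lborel {a..b} f \<and> set_integrable lborel {a..b} (\<lambda>u. (f u)^2)"

definition ae_eq_on :: "real \<Rightarrow> real \<Rightarrow> (real \<Rightarrow> real) \<Rightarrow> (real \<Rightarrow> real) \<Rightarrow> bool" where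
  "ae_eq_on a b f g \<longleftrightarrow> (AE u in lborel. u \<in> {a..b} \<longrightarrow> f u = g u)"

definition kapply :: "real \<Rightarrow> real \<Rightarrow> (real \<Rightarrow> real \<Rightarrow> real) \<Rightarrow> (real \<Rightarrow> real) \<Rightarrow> real \<Rightarrow> real" where
  "kapply a b L g = (\<lambda>u. LINT v:{a..b}|lborel. L u v * g v)"

text \<open>Hilbert-Schmidt norm of the operator with kernel L = L2 norm of the kernel on I x I\<close>
definition HSnorm :: "real \<Rightarrow> real \<Rightarrow> (real \<Rightarrow> real \<Rightarrow> real) \<Rightarrow> real" where
  "HSnorm a b L = sqrt (LINT x:({a..b} \<times> {a..b})|lborel. (L (fst x) (snd x))^2)"

definition orthonormal_on :: "real \<Rightarrow> real \<Rightarrow> nat set \<Rightarrow> (nat \<Rightarrow> real \<Rightarrow> real) \<Rightarrow> bool" where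
  "orthonormal_on a b J e \<longleftrightarrow> (\<forall>i\<in>J. inL2 a b (e i)) \<and>
     (\<forall>i\<in>J. \<forall>j\<in>J. L2ip a b (e i) (e j) = (if i = j then 1 else 0))"

definition Nk :: "real \<Rightarrow> real \<Rightarrow> (nat \<Rightarrow> real \<Rightarrow> real \<Rightarrow> real) \<Rightarrow> nat \<Rightarrow> real \<Rightarrow> real \<Rightarrow> real" where
  "Nk a b Mk k u v = (LINT z:{a..b}|lborel. Mk k u z * Mk k v z)"

definition Kop :: "real \<Rightarrow> real \<Rightarrow> nat \<Rightarrow> (nat \<Rightarrow> real \<Rightarrow> real \<Rightarrow> real) \<Rightarrow> real \<Rightarrow> real \<Rightarrow> real" where
  "Kop a b p Mk u v = (\<Sum>k=1..p. Nk a b Mk k u v)"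

definition Ybar :: "(int \<Rightarrow> 'w \<Rightarrow> real \<Rightarrow> real) \<Rightarrow> nat \<Rightarrow> 'w \<Rightarrow> real \<Rightarrow> real" where
  "Ybar Y n \<omega> u = (\<Sum>j=1..n. Y (int j) \<omega> u) / real n"

definition Mhat :: "(int \<Rightarrow> 'w \<Rightarrow> real \<Rightarrow> real) \<Rightarrow> nat \<Rightarrow> nat \<Rightarrow> nat \<Rightarrow> 'w \<Rightarrow> real \<Rightarrow> real \<Rightarrow> real" where
  "Mhat Y p n k \<omega> u v =
     (\<Sum>j=1..n-p. (Y (int j) \<omega> u - Ybar Y n \<omega> u) * (Y (int (j + k)) \<omega> v - Ybar Y n \<omega> v))
       / (real n - real p)"

definition Khat :: "real \<Rightarrow> real \<Rightarrow> (int \<Rightarrow> 'w \<Rightarrow> real \<Rightarrow> real) \<Rightarrow> nat \<Rightarrow> nat \<Rightarrow> 'w \<Rightarrow> real \<Rightarrow> real \<Rightarrow> real" where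
  "Khat a b Y p n \<omega> u v = (\<Sum>k=1..p. LINT z:{a..b}|lborel. Mhat Y p n k \<omega> u z * Mhat Y p n k \<omega> v z)"

definition Fgen :: "'w measure \<Rightarrow> real \<Rightarrow> real \<Rightarrow> (int \<Rightarrow> 'w \<Rightarrow> real \<Rightarrow> real) \<Rightarrow> int set \<Rightarrow> 'w set set" where
  "Fgen M a b Y S = sigma_sets (space M)
     {(\<lambda>\<omega>. Y t \<omega> u) -` B \<inter> space M | t u B. t \<in> S \<and> u \<in> {a..b} \<and> B \<in> sets borel}"

definition psi_coef :: "'w measure \<Rightarrow> real \<Rightarrow> real \<Rightarrow> (int \<Rightarrow> 'w \<Rightarrow> real \<Rightarrow> real) \<Rightarrow> nat \<Rightarrow> ereal" where
  "psi_coef M a b Y l = Sup {ereal \<bar>1 - (measure M (A \<inter> B) / measure M A) / measure M B\<bar> | A B.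
      A \<in> Fgen M a b Y {..0} \<and> B \<in> Fgen M a b Y {int l..} \<and> measure M A * measure M B > 0}"

definition psi_mixing_C1 :: "'w measure \<Rightarrow> real \<Rightarrow> real \<Rightarrow> (int \<Rightarrow> 'w \<Rightarrow> real \<Rightarrow> real) \<Rightarrow> bool" where
  "psi_mixing_C1 M a b Y \<longleftrightarrow> (\<forall>l\<ge>1. psi_coef M a b Y l \<noteq> \<infinity>) \<and>
     summable (\<lambda>l. real l * sqrt (real_of_ereal (psi_coef M a b Y l)))"

definition strictly_stationary :: "'w measure \<Rightarrow> real \<Rightarrow> real \<Rightarrow> (int \<Rightarrow> 'w \<Rightarrow> real \<Rightarrow> real) \<Rightarrow> bool" where
  "strictly_stationary M a b Y \<longleftrightarrow> (\<forall>h::int. \<forall>J. finite J \<and> J \<subseteq> UNIV \<times> {a..b} \<longrightarrow>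
     distr M (Pi\<^sub>M J (\<lambda>_. borel)) (\<lambda>\<omega>. \<lambda>tu\<in>J. Y (fst tu) \<omega> (snd tu)) =
     distr M (Pi\<^sub>M J (\<lambda>_. borel)) (\<lambda>\<omega>. \<lambda>tu\<in>J. Y (fst tu + h) \<omega> (snd tu)))"

text \<open>Z_n = O_p(r_n): for every eps > 0 there are C, N such that for n >= N the event
  |Z_n| > C r_n has (outer) probability < eps.\<close>
definition bigOp :: "'w measure \<Rightarrow> (nat \<Rightarrow> 'w \<Rightarrow> real) \<Rightarrow> (nat \<Rightarrow> real) \<Rightarrow> bool" where
  "bigOp M Z r \<longleftrightarrow> (\<forall>\<epsilon>>0. \<exists>C N. \<forall>n\<ge>N. \<exists>A\<in>sets M.
      {\<omega> \<in> space M. \<bar>Z n \<omega>\<bar> > C * r n} \<subseteq> A \<and> measure M A < \<epsilon>)"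

end

theory Submission
  imports Defs
begin

text \<open>
  Write \<open>K = \<Sum> M\<^sub>k M\<^sub>k\<^sup>T\<close> and likewise for the estimator. Everything follows from the single estimate
  that each estimated lagged autocovariance kernel is within \<open>O\<^sub>p(n\<^sup>-\<^sup>1\<^sup>/\<^sup>2)\<close> of \<open>M\<^sub>k\<close> in
  Hilbert-Schmidt norm. For this, \<open>\<psi>\<close>-mixing bounds the covariance of two integrable variables by the
  mixing coefficient times the product of their first absolute moments; it is applied pointwise in
  \<open>(u, v)\<close>, where stationarity of the finite-dimensional distributions is available, and then
  integrated over the square, so that the sum of lagged products has squared norm of order \<open>n\<close> in
  \<open>L\<^sup>2\<close> of the product of the sample space and the square. Markov's inequality finishes it.

  The spectral part is deterministic: Courant-Fischer gives the eigenvalues, and pairing the two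
  eigenvalue equations gives the coefficients of one eigenfunction along another. The faster rate for
  the eigenvalues beyond \<open>d\<close> comes from the fact that both operators are sums of squares: a function
  orthogonal to the first \<open>d\<close> eigenfunctions is annihilated by every \<open>M\<^sub>k\<^sup>T\<close>, hence the quadratic
  form of the estimator on it is bounded by the squares of the errors. For the last identity, a
  function orthogonal to the factor space has zero variance against \<open>X\<close>, so it lies in the kernel of
  \<open>K\<close>, and counting dimensions shows that both eigensystems span the same space.
\<close>

section \<open>Square-integrable functions\<close>

text \<open>Functions are not identified modulo null sets, so \<open>nrm\<close> is only a seminorm
  and equalities hold almost everywhere or as \<open>nrm N f = 0\<close>. The \<psi>-mixing bound is
  relative to P(A) P(B), which is why it controls covariances by first absolute moments; for a
  lagged product of \<open>Z\<close> at (u, v) these cost only second moments, and the resulting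
  bound is integrable over the square. The fourth moment in C2 makes lagged products square
  integrable and handles the finitely many lags at which two time windows overlap or touch. Since no
  measurability is assumed of \<open>thetahat\<close> and \<open>psihat\<close>, the spectral
  estimates are pathwise inequalities on one almost sure event, with majorants built from
  \<open>qbound\<close>; \<open>bigOp\<close> speaks of outer probability, so orders pass on by
  domination. The factor space is given by eigenfunctions \<open>phi\<close> of \<open>Mk 0\<close>,
  but \<open>psi\<close> are eigenfunctions of K: their spans must be compared before an arbitrary
  basis of the complement of \<open>phi\<close> can be used with \<open>psi\<close>. The free sign
  of an eigenfunction is absorbed by a minimum over both signs.\<close>

definition sqint :: "'a measure \<Rightarrow> ('a \<Rightarrow> real) \<Rightarrow> bool" where
  "sqint N f \<longleftrightarrow> f \<in> borel_measurable N \<and> integrable N (\<lambda>x. (f x)\<^sup>2)"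

definition ip :: "'a measure \<Rightarrow> ('a \<Rightarrow> real) \<Rightarrow> ('a \<Rightarrow> real) \<Rightarrow> real" where
  "ip N f g = (\<integral>x. f x * g x \<partial>N)"

definition nrm :: "'a measure \<Rightarrow> ('a \<Rightarrow> real) \<Rightarrow> real" where
  "nrm N f = sqrt (ip N f f)"

lemma sqint_measurable: "sqint N f \<Longrightarrow> f \<in> borel_measurable N"
  by (simp add: sqint_def)

lemma sqint_mult_integrable:
  assumes "sqint N f" "sqint N g"
  shows "integrable N (\<lambda>x. f x * g x)"
proof (rule Bochner_Integration.integrable_bound)
  show "integrable N (\<lambda>x. (f x)\<^sup>2 + (g x)\<^sup>2)"
    using assms by (auto simp: sqint_def)
  show "(\<lambda>x. f x * g x) \<in> borel_measurable N"
    using assms by (auto simp: sqint_def)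
  have "\<bar>f x * g x\<bar> \<le> (f x)\<^sup>2 + (g x)\<^sup>2" for x
  proof -
    have "2 * (\<bar>f x\<bar> * \<bar>g x\<bar>) \<le> (f x)\<^sup>2 + (g x)\<^sup>2"
      using sum_squares_bound[of "\<bar>f x\<bar>" "\<bar>g x\<bar>"] by (simp add: mult.assoc)
    moreover have "0 \<le> \<bar>f x\<bar> * \<bar>g x\<bar>" by simp
    ultimately show ?thesis unfolding abs_mult by linarith
  qed
  then show "AE x in N. norm (f x * g x) \<le> norm ((f x)\<^sup>2 + (g x)\<^sup>2)"
    by (simp only: real_norm_def) (auto intro: order_trans[OF _ abs_ge_self])
qed

lemma sqint_cmult: "sqint N f \<Longrightarrow> sqint N (\<lambda>x. c * f x)"
  by (auto simp: sqint_def power_mult_distrib)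

lemma sqint_add:
  assumes "sqint N f" "sqint N g" shows "sqint N (\<lambda>x. f x + g x)"
proof -
  have "integrable N (\<lambda>x. (f x)\<^sup>2 + (g x)\<^sup>2 + 2 * (f x * g x))"
    using assms sqint_mult_integrable[OF assms] by (auto simp: sqint_def)
  moreover have "(\<lambda>x. (f x + g x)\<^sup>2) = (\<lambda>x. (f x)\<^sup>2 + (g x)\<^sup>2 + 2 * (f x * g x))"
    by (auto simp: power2_sum)
  ultimately show ?thesis
    using assms by (auto simp: sqint_def)
qed

lemma sqint_diff: "sqint N f \<Longrightarrow> sqint N g \<Longrightarrow> sqint N (\<lambda>x. f x - g x)"
  using sqint_add[OF _ sqint_cmult[of N g "-1"], of f] by simp

lemma sqint_zero: "sqint N (\<lambda>x. 0)"
  by (simp add: sqint_def)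

lemma sqint_sum: "(\<And>i. i \<in> I \<Longrightarrow> sqint N (f i)) \<Longrightarrow> sqint N (\<lambda>x. \<Sum>i\<in>I. f i x)"
  by (induction I rule: infinite_finite_induct) (auto intro: sqint_add sqint_zero)

lemma sqint_cong:
  assumes "\<And>x. x \<in> space N \<Longrightarrow> f x = g x" shows "sqint N f \<longleftrightarrow> sqint N g"
  using assms
  by (auto simp: sqint_def cong: measurable_cong intro: Bochner_Integration.integrable_cong[THEN iffD1, rotated -1])

lemma ip_cong:
  "(\<And>x. x \<in> space N \<Longrightarrow> f x = f' x) \<Longrightarrow> (\<And>x. x \<in> space N \<Longrightarrow> g x = g' x) \<Longrightarrow> ip N f g = ip N f' g'"
  unfolding ip_def by (intro Bochner_Integration.integral_cong) auto

lemma ip_cong_AE: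
  assumes "AE x in N. f x = f' x" "sqint N f" "sqint N f'" "sqint N g"
  shows "ip N f g = ip N f' g"
  unfolding ip_def
  by (rule integral_cong_AE) (use assms in \<open>auto simp: sqint_def\<close>)

lemma ip_commute: "ip N f g = ip N g f"
  by (simp add: ip_def mult.commute)

lemma ip_add_left:
  "sqint N f \<Longrightarrow> sqint N g \<Longrightarrow> sqint N h \<Longrightarrow> ip N (\<lambda>x. f x + g x) h = ip N f h + ip N g h"
  unfolding ip_def by (simp add: distrib_right sqint_mult_integrable)

lemma ip_cmult_left: "ip N (\<lambda>x. c * f x) g = c * ip N f g"
  unfolding ip_def by (simp add: mult.assoc)

lemma ip_cmult_right: "ip N g (\<lambda>x. c * f x) = c * ip N g f"
  using ip_cmult_left[of N c f g] by (simp add: ip_commute[of N g])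

lemma ip_add_right:
  "sqint N f \<Longrightarrow> sqint N g \<Longrightarrow> sqint N h \<Longrightarrow> ip N h (\<lambda>x. f x + g x) = ip N h f + ip N h g"
  using ip_add_left[of N f g h] by (simp add: ip_commute[of N h])

lemma ip_diff_left:
  "sqint N f \<Longrightarrow> sqint N g \<Longrightarrow> sqint N h \<Longrightarrow> ip N (\<lambda>x. f x - g x) h = ip N f h - ip N g h"
  unfolding ip_def by (simp add: left_diff_distrib sqint_mult_integrable)

lemma ip_diff_right:
  "sqint N f \<Longrightarrow> sqint N g \<Longrightarrow> sqint N h \<Longrightarrow> ip N h (\<lambda>x. f x - g x) = ip N h f - ip N h g"
  using ip_diff_left[of N f g h] by (simp add: ip_commute[of N h])

lemma ip_zero_left: "ip N (\<lambda>x. 0) g = 0"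
  by (simp add: ip_def)

lemma ip_sum_left:
  assumes "\<And>i. i \<in> I \<Longrightarrow> sqint N (f i)" "sqint N g"
  shows "ip N (\<lambda>x. \<Sum>i\<in>I. f i x) g = (\<Sum>i\<in>I. ip N (f i) g)"
  using assms
  by (induction I rule: infinite_finite_induct)
     (auto simp: ip_zero_left ip_add_left sqint_sum)

lemma ip_sum_right:
  assumes "\<And>i. i \<in> I \<Longrightarrow> sqint N (f i)" "sqint N g"
  shows "ip N g (\<lambda>x. \<Sum>i\<in>I. f i x) = (\<Sum>i\<in>I. ip N g (f i))"
  using ip_sum_left[of I N f g] assms by (simp add: ip_commute[of N g])

lemma ip_self_nonneg: "0 \<le> ip N f f"
  unfolding ip_def by (rule integral_nonneg_AE) auto

lemma nrm_nonneg: "0 \<le> nrm N f"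
  by (simp add: nrm_def ip_self_nonneg)

lemma nrm_sq: "(nrm N f)\<^sup>2 = ip N f f"
  by (simp add: nrm_def ip_self_nonneg)

lemma nrm_sq_integral: "(nrm N f)\<^sup>2 = (\<integral>x. (f x)\<^sup>2 \<partial>N)"
  unfolding nrm_sq ip_def by (simp add: power2_eq_square)

lemma nrm_cmult: "nrm N (\<lambda>x. c * f x) = \<bar>c\<bar> * nrm N f"
  unfolding nrm_def by (simp add: ip_cmult_left ip_cmult_right real_sqrt_mult flip: mult.assoc)

lemma nrm_sq_add:
  assumes "sqint N f" "sqint N g"
  shows "(nrm N (\<lambda>x. f x + g x))\<^sup>2 = (nrm N f)\<^sup>2 + 2 * ip N f g + (nrm N g)\<^sup>2"
  using assms by (simp add: nrm_sq ip_add_left ip_add_right sqint_add ip_commute[of N g f])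

lemma nrm_sq_diff:
  assumes "sqint N f" "sqint N g"
  shows "(nrm N (\<lambda>x. f x - g x))\<^sup>2 = (nrm N f)\<^sup>2 - 2 * ip N f g + (nrm N g)\<^sup>2"
  using assms by (simp add: nrm_sq ip_diff_left ip_diff_right sqint_diff ip_commute[of N g f])

lemma ip_Cauchy_Schwarz:
  assumes f: "sqint N f" and g: "sqint N g"
  shows "\<bar>ip N f g\<bar> \<le> nrm N f * nrm N g"
proof -
  define A B C where "A = ip N f f" and "B = ip N f g" and "C = ip N g g"
  have q: "0 \<le> s\<^sup>2 * A + 2 * (s * t * B) + t\<^sup>2 * C" for s t
  proof -
    have "0 \<le> (nrm N (\<lambda>x. s * f x + t * g x))\<^sup>2" by simp
    also have "\<dots> = s\<^sup>2 * A + 2 * (s * t * B) + t\<^sup>2 * C"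
      using f g by (subst nrm_sq_add) (auto simp: sqint_cmult nrm_cmult ip_cmult_left ip_cmult_right
          A_def B_def C_def nrm_sq power_mult_distrib)
    finally show ?thesis .
  qed
  have AC: "0 \<le> A" "0 \<le> C" by (simp_all add: A_def C_def ip_self_nonneg)
  have "B\<^sup>2 \<le> A * C"
  proof (cases "C = 0")
    case True
    have "B = 0"
    proof (rule ccontr)
      assume "B \<noteq> 0"
      \<comment> \<open>With C = 0 and s = 1 the form is affine in t, and t = -(A+1)/(2B) gives it
        the value -1.\<close>
      have "0 \<le> A + 2 * (((-(A+1)) / (2 * B)) * B)"
        using q[of 1 "-(A+1) / (2*B)"] True by simp
      then show False using \<open>B \<noteq> 0\<close> by (simp add: field_simps)
    qed
    then show ?thesis using True by simp
  next
    case False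
    \<comment> \<open>The weights s = C, t = -B form the component of f orthogonal to g, scaled by C
      to avoid a division.\<close>
    have "0 \<le> C * (A * C - B\<^sup>2)"
      using q[of C "-B"] by (simp add: power2_eq_square algebra_simps)
    then show ?thesis using False AC by (simp add: zero_le_mult_iff)
  qed
  then have "sqrt (B\<^sup>2) \<le> sqrt (A * C)" by (rule real_sqrt_le_mono)
  then show ?thesis by (simp add: nrm_def A_def B_def C_def real_sqrt_mult)
qed

lemma nrm_triangle:
  assumes "sqint N f" "sqint N g"
  shows "nrm N (\<lambda>x. f x + g x) \<le> nrm N f + nrm N g"
proof (rule power2_le_imp_le)
  show "(nrm N (\<lambda>x. f x + g x))\<^sup>2 \<le> (nrm N f + nrm N g)\<^sup>2"
    using ip_Cauchy_Schwarz[OF assms] by (simp add: nrm_sq_add assms power2_sum)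
qed (simp add: nrm_nonneg)

lemma nrm_diff_le:
  assumes "sqint N f" "sqint N g"
  shows "nrm N (\<lambda>x. f x - g x) \<le> nrm N f + nrm N g"
  using nrm_triangle[OF assms(1) sqint_cmult[OF assms(2), of "-1"]] nrm_cmult[of N "-1" g] by simp

lemma nrm_triangle_diff:
  assumes "sqint N f" "sqint N g"
  shows "\<bar>nrm N f - nrm N g\<bar> \<le> nrm N (\<lambda>x. f x - g x)"
proof -
  have "nrm N f \<le> nrm N (\<lambda>x. f x - g x) + nrm N g"
    using nrm_triangle[OF sqint_diff[OF assms] assms(2)] by simp
  moreover have "nrm N g \<le> nrm N (\<lambda>x. g x - f x) + nrm N f"
    using nrm_triangle[OF sqint_diff[OF assms(2,1)] assms(1)] by simp
  moreover have "nrm N (\<lambda>x. g x - f x) = nrm N (\<lambda>x. f x - g x)"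
    using nrm_cmult[of N "-1" "\<lambda>x. f x - g x"] by simp
  ultimately show ?thesis by linarith
qed

lemma nrm_sum_le:
  assumes "\<And>i. i \<in> I \<Longrightarrow> sqint N (f i)"
  shows "nrm N (\<lambda>x. \<Sum>i\<in>I. f i x) \<le> (\<Sum>i\<in>I. nrm N (f i))"
  using assms
proof (induction I rule: infinite_finite_induct)
  case (insert i I)
  have "nrm N (\<lambda>x. f i x + (\<Sum>i\<in>I. f i x)) \<le> nrm N (f i) + nrm N (\<lambda>x. \<Sum>i\<in>I. f i x)"
    by (rule nrm_triangle) (use insert.prems in \<open>auto intro!: sqint_sum\<close>)
  also have "\<dots> \<le> nrm N (f i) + (\<Sum>i\<in>I. nrm N (f i))"
    using insert by simp
  finally show ?case using insert by simp
qed (auto simp: nrm_def ip_zero_left)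

lemma ip_eq_0_if_nrm_eq_0:
  "sqint N f \<Longrightarrow> sqint N g \<Longrightarrow> nrm N f = 0 \<Longrightarrow> ip N f g = 0"
  using ip_Cauchy_Schwarz[of N f g] by simp

lemma nrm_eq_0_AE:
  assumes [measurable]: "f \<in> borel_measurable N" and "AE x in N. f x = 0"
  shows "nrm N f = 0"
proof -
  have "AE x in N. f x * f x = 0"
    using assms(2) by eventually_elim simp
  then have "(\<integral>x. f x * f x \<partial>N) = (\<integral>x. 0 \<partial>N)"
    by (intro integral_cong_AE) simp_all
  then show ?thesis by (simp add: nrm_def ip_def)
qed

section \<open>Finite orthonormal systems\<close>

lemma nrm_sum_orthonormal:
  assumes "finite I" "\<And>i. i \<in> I \<Longrightarrow> sqint N (e i)"
    and "\<And>i j. i \<in> I \<Longrightarrow> j \<in> I \<Longrightarrow> ip N (e i) (e j) = (if i = j then 1 else 0)"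
  shows "(nrm N (\<lambda>x. \<Sum>i\<in>I. c i * e i x))\<^sup>2 = (\<Sum>i\<in>I. (c i)\<^sup>2)"
proof -
  have "(nrm N (\<lambda>x. \<Sum>i\<in>I. c i * e i x))\<^sup>2 = (\<Sum>i\<in>I. \<Sum>j\<in>I. c i * (c j * ip N (e i) (e j)))"
    using assms by (simp add: nrm_sq ip_sum_left ip_sum_right sqint_cmult sqint_sum ip_cmult_left
        ip_cmult_right sum_distrib_left)
  also have "\<dots> = (\<Sum>i\<in>I. \<Sum>j\<in>I. if i = j then (c i)\<^sup>2 else 0)"
    using assms by (intro sum.cong refl) (auto simp: power2_eq_square)
  finally show ?thesis using assms by (simp add: sum.delta)
qed

lemma ip_sum_orthonormal:
  assumes "finite I" "\<And>i. i \<in> I \<Longrightarrow> sqint N (e i)"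
    and "\<And>i j. i \<in> I \<Longrightarrow> j \<in> I \<Longrightarrow> ip N (e i) (e j) = (if i = j then 1 else 0)" and "k \<in> I"
  shows "ip N (\<lambda>x. \<Sum>i\<in>I. c i * e i x) (e k) = c k"
proof -
  have "ip N (\<lambda>x. \<Sum>i\<in>I. c i * e i x) (e k) = (\<Sum>i\<in>I. c i * ip N (e i) (e k))"
    using assms by (simp add: ip_sum_left sqint_cmult ip_cmult_left)
  also have "\<dots> = (\<Sum>i\<in>I. if i = k then c i else 0)"
    using assms(3,4) by (intro sum.cong) auto
  finally show ?thesis using assms by simp
qed

lemma nrm_sq_residual:
  assumes I: "finite I" "\<And>i. i \<in> I \<Longrightarrow> sqint N (e i)"
    and on: "\<And>i j. i \<in> I \<Longrightarrow> j \<in> I \<Longrightarrow> ip N (e i) (e j) = (if i = j then 1 else 0)"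
    and g: "sqint N g"
  shows "(nrm N (\<lambda>x. g x - (\<Sum>i\<in>I. ip N g (e i) * e i x)))\<^sup>2 = (nrm N g)\<^sup>2 - (\<Sum>i\<in>I. (ip N g (e i))\<^sup>2)"
proof -
  have s: "sqint N (\<lambda>x. \<Sum>i\<in>I. ip N g (e i) * e i x)"
    by (intro sqint_sum sqint_cmult I)
  have "ip N g (\<lambda>x. \<Sum>i\<in>I. ip N g (e i) * e i x) = (\<Sum>i\<in>I. (ip N g (e i))\<^sup>2)"
    using I g by (simp add: ip_sum_right sqint_cmult ip_cmult_right power2_eq_square)
  then show ?thesis
    using nrm_sum_orthonormal[OF I on] by (simp add: nrm_sq_diff g s)
qed

lemma Bessel:
  assumes I: "finite I" "\<And>i. i \<in> I \<Longrightarrow> sqint N (e i)"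
    and on: "\<And>i j. i \<in> I \<Longrightarrow> j \<in> I \<Longrightarrow> ip N (e i) (e j) = (if i = j then 1 else 0)"
    and g: "sqint N g"
  shows "(\<Sum>i\<in>I. (ip N g (e i))\<^sup>2) \<le> (nrm N g)\<^sup>2"
  using nrm_sq_residual[OF assms] zero_le_power2[of "nrm N (\<lambda>x. g x - (\<Sum>i\<in>I. ip N g (e i) * e i x))"]
  by linarith

lemma ip_residual:
  assumes I: "finite I" "\<And>i. i \<in> I \<Longrightarrow> sqint N (e i)"
    and on: "\<And>i j. i \<in> I \<Longrightarrow> j \<in> I \<Longrightarrow> ip N (e i) (e j) = (if i = j then 1 else 0)"
    and g: "sqint N g" and "k \<in> I"
  shows "ip N (\<lambda>x. g x - (\<Sum>i\<in>I. ip N g (e i) * e i x)) (e k) = 0"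
  using assms ip_sum_orthonormal[OF I on \<open>k \<in> I\<close>, of "\<lambda>i. ip N g (e i)"]
  by (simp add: ip_diff_left sqint_sum sqint_cmult)

text \<open>The hypothesis \<open>span\<close> is equality in Bessel's inequality, so every \<alpha>
  lies in the span of the \<beta> up to a null set. Projecting x onto that span leaves its
  \<alpha>-coefficients unchanged, and Bessel applied to the projection gives the bound.\<close>

lemma sum_coefficients_le_of_span:
  assumes I: "finite I" "\<And>i. i \<in> I \<Longrightarrow> sqint N (\<alpha> i)"
    and on\<alpha>: "\<And>i j. i \<in> I \<Longrightarrow> j \<in> I \<Longrightarrow> ip N (\<alpha> i) (\<alpha> j) = (if i = j then 1 else 0)"
    and J: "finite J" "\<And>i. i \<in> J \<Longrightarrow> sqint N (\<beta> i)"
    and on\<beta>: "\<And>i j. i \<in> J \<Longrightarrow> j \<in> J \<Longrightarrow> ip N (\<beta> i) (\<beta> j) = (if i = j then 1 else 0)"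
    and span: "\<And>k. k \<in> I \<Longrightarrow> (\<Sum>i\<in>J. (ip N (\<alpha> k) (\<beta> i))\<^sup>2) = 1"
    and x: "sqint N x"
  shows "(\<Sum>k\<in>I. (ip N x (\<alpha> k))\<^sup>2) \<le> (\<Sum>i\<in>J. (ip N x (\<beta> i))\<^sup>2)"
proof -
  define y where "y v = (\<Sum>i\<in>J. ip N x (\<beta> i) * \<beta> i v)" for v
  define r where "r v = x v - y v" for v
  have y: "sqint N y" unfolding y_def[abs_def] by (intro sqint_sum sqint_cmult J)
  have r: "sqint N r" unfolding r_def[abs_def] by (intro sqint_diff x y)
  have rb: "ip N r (\<beta> i) = 0" if "i \<in> J" for i
    unfolding r_def[abs_def] y_def by (rule ip_residual[OF J on\<beta> x that])
  have "ip N x (\<alpha> k) = ip N y (\<alpha> k)" if k: "k \<in> I" for k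
  proof -
    define s where "s v = (\<Sum>i\<in>J. ip N (\<alpha> k) (\<beta> i) * \<beta> i v)" for v
    have s: "sqint N s" unfolding s_def[abs_def] by (intro sqint_sum sqint_cmult J)
    have "(nrm N (\<lambda>v. \<alpha> k v - s v))\<^sup>2 = (nrm N (\<alpha> k))\<^sup>2 - (\<Sum>i\<in>J. (ip N (\<alpha> k) (\<beta> i))\<^sup>2)"
      unfolding s_def by (rule nrm_sq_residual[OF J on\<beta> I(2)[OF k]])
    then have "nrm N (\<lambda>v. \<alpha> k v - s v) = 0" using span[OF k] on\<alpha>[OF k k] by (simp add: nrm_sq[of N "\<alpha> k"])
    then have "ip N (\<lambda>v. \<alpha> k v - s v) r = 0" by (rule ip_eq_0_if_nrm_eq_0[OF sqint_diff[OF I(2)[OF k] s] r])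
    then have "ip N r (\<alpha> k) = ip N r s"
      using ip_diff_right[OF I(2)[OF k] s r] by (simp add: ip_commute)
    also have "\<dots> = (\<Sum>i\<in>J. ip N (\<alpha> k) (\<beta> i) * ip N r (\<beta> i))"
      unfolding s_def[abs_def] using J r by (simp add: ip_sum_right sqint_cmult ip_cmult_right)
    also have "\<dots> = 0" using rb by simp
    finally have "ip N r (\<alpha> k) = 0" .
    then show ?thesis unfolding r_def[abs_def] by (simp add: ip_diff_left[OF x y I(2)[OF k]])
  qed
  then have "(\<Sum>k\<in>I. (ip N x (\<alpha> k))\<^sup>2) = (\<Sum>k\<in>I. (ip N y (\<alpha> k))\<^sup>2)" by simp
  also have "\<dots> \<le> (nrm N y)\<^sup>2" by (rule Bessel[OF I on\<alpha> y])
  also have "\<dots> = (\<Sum>i\<in>J. (ip N x (\<beta> i))\<^sup>2)"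
    unfolding y_def[abs_def] by (rule nrm_sum_orthonormal[OF J on\<beta>])
  finally show ?thesis .
qed

section \<open>Sections, completeness and orthonormal series\<close>

lemma sqint_section_AE:
  assumes "sigma_finite_measure N1" "sigma_finite_measure N2" "sqint (N1 \<Otimes>\<^sub>M N2) F"
  shows "AE x in N1. sqint N2 (\<lambda>y. F (x, y))"
proof -
  interpret pair_sigma_finite N1 N2 using assms by (simp add: pair_sigma_finite_def)
  have m[measurable]: "F \<in> borel_measurable (N1 \<Otimes>\<^sub>M N2)" using assms by (simp add: sqint_def)
  have "AE x in N1. integrable N2 (\<lambda>y. (F (x, y))\<^sup>2)"
    using assms AE_integrable_fst'[of "\<lambda>z. (F z)\<^sup>2"] by (simp add: sqint_def)
  with AE_space show ?thesis
    by eventually_elim (auto simp: sqint_def)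
qed

text \<open>On a finite measure an L2-Cauchy sequence is L1-Cauchy, which yields an almost
  everywhere convergent subsequence. Fatou's lemma then bounds the L2 distance of the whole sequence
  to the pointwise limit.\<close>

lemma L2_complete:
  assumes "finite_measure N" and f: "\<And>n. sqint N (f n)"
    and cauchy: "\<And>e. e > 0 \<Longrightarrow> \<exists>m. \<forall>i\<ge>m. \<forall>j\<ge>m. nrm N (\<lambda>x. f i x - f j x) < e"
  obtains h where "sqint N h" "(\<lambda>n. nrm N (\<lambda>x. f n x - h x)) \<longlonglongrightarrow> 0"
proof -
  interpret finite_measure N by fact
  have one: "sqint N (\<lambda>x. 1)" by (simp add: sqint_def)
  have int1: "integrable N g" if "sqint N g" for g
    using sqint_mult_integrable[OF that one] by simp
  have [measurable]: "f n \<in> borel_measurable N" for n using f by (simp add: sqint_def)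
  have abs_sq: "sqint N (\<lambda>x. \<bar>g x\<bar>)" if "sqint N g" for g
    using that by (auto simp: sqint_def)
  have nabs: "nrm N (\<lambda>x. \<bar>g x\<bar>) = nrm N g" for g
    by (simp add: nrm_def ip_def)
  \<comment> \<open>The added 1 makes the factor positive, so that a tolerance can be divided by
    it.\<close>
  have L1: "(\<integral>x. \<bar>g x\<bar> \<partial>N) \<le> nrm N g * (nrm N (\<lambda>x. 1) + 1)" if "sqint N g" for g
  proof -
    have "(\<integral>x. \<bar>g x\<bar> \<partial>N) = ip N (\<lambda>x. \<bar>g x\<bar>) (\<lambda>x. 1)" by (simp add: ip_def)
    also have "\<dots> \<le> nrm N g * nrm N (\<lambda>x. 1)"
      using ip_Cauchy_Schwarz[OF abs_sq[OF that] one] nabs[of g] by simp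
    also have "\<dots> \<le> nrm N g * (nrm N (\<lambda>x. 1) + 1)"
      by (intro mult_left_mono) (auto simp: nrm_nonneg)
    finally show ?thesis .
  qed
  have pos: "nrm N (\<lambda>x. 1) + 1 > 0" using nrm_nonneg[of N "\<lambda>x. 1"] by linarith
  obtain r where r: "strict_mono r" "AE x in N. Cauchy (\<lambda>i. f (r i) x)"
  proof (rule cauchy_L1_AE_cauchy_subseq)
    show "integrable N (f n)" for n by (rule int1[OF f])
    fix e :: real assume "e > 0"
    then obtain m where m: "\<And>i j. i \<ge> m \<Longrightarrow> j \<ge> m \<Longrightarrow> nrm N (\<lambda>x. f i x - f j x) < e / (nrm N (\<lambda>x. 1) + 1)"
      using cauchy[of "e / (nrm N (\<lambda>x. 1) + 1)"] pos by auto
    show "\<exists>m. \<forall>i\<ge>m. \<forall>j\<ge>m. (LINT x|N. norm (f i x - f j x)) < e"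
    proof (intro exI[of _ m] allI impI)
      fix i j assume "i \<ge> m" "j \<ge> m"
      then have "nrm N (\<lambda>x. f i x - f j x) * (nrm N (\<lambda>x. 1) + 1) < e"
        using m[of i j] pos by (simp add: pos_less_divide_eq)
      then show "(LINT x|N. norm (f i x - f j x)) < e"
        using L1[OF sqint_diff[OF f f], of i j] by simp
    qed
  qed blast
  \<comment> \<open>Where the subsequence diverges \<open>lim\<close> is an unspecified value;
    \<open>h\<close> is measurable all the same.\<close>
  define h where "h x = lim (\<lambda>i. f (r i) x)" for x
  have hm[measurable]: "h \<in> borel_measurable N"
    unfolding h_def by (rule borel_measurable_lim_metric) simp
  have conv: "AE x in N. (\<lambda>i. f (r i) x) \<longlonglongrightarrow> h x"
    using r(2) by eventually_elim (simp add: h_def Cauchy_convergent_iff convergent_LIMSEQ_iff)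
  \<comment> \<open>Integrability is proved together with the norm bound, since the Bochner integral
    of a non-integrable square is 0 and the bound alone would say nothing.\<close>
  have fatou: "integrable N (\<lambda>x. (f n x - h x)\<^sup>2) \<and> nrm N (\<lambda>x. f n x - h x) \<le> e"
    if e: "e > 0" and n: "\<And>i. i \<ge> m \<Longrightarrow> nrm N (\<lambda>x. f n x - f i x) < e" for n m e
  proof -
    have "(\<integral>\<^sup>+x. ennreal ((f n x - h x)\<^sup>2) \<partial>N) = (\<integral>\<^sup>+x. liminf (\<lambda>i. ennreal ((f n x - f (r i) x)\<^sup>2)) \<partial>N)"
    proof (rule nn_integral_cong_AE, use conv in eventually_elim)
      case (elim x)
      have "(\<lambda>i. ennreal ((f n x - f (r i) x)\<^sup>2)) \<longlonglongrightarrow> ennreal ((f n x - h x)\<^sup>2)"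
        by (intro tendsto_intros elim)
      from lim_imp_Liminf[OF _ this] show ?case by simp
    qed
    also have "\<dots> \<le> liminf (\<lambda>i. \<integral>\<^sup>+x. ennreal ((f n x - f (r i) x)\<^sup>2) \<partial>N)"
      by (rule nn_integral_liminf) simp
    also have "\<dots> \<le> ennreal (e\<^sup>2)"
    proof (rule Liminf_le)
      show "eventually (\<lambda>i. (\<integral>\<^sup>+x. ennreal ((f n x - f (r i) x)\<^sup>2) \<partial>N) \<le> ennreal (e\<^sup>2)) sequentially"
        using eventually_ge_at_top[of m]
      proof eventually_elim
        case (elim i)
        have "(\<integral>\<^sup>+x. ennreal ((f n x - f (r i) x)\<^sup>2) \<partial>N) = ennreal ((nrm N (\<lambda>x. f n x - f (r i) x))\<^sup>2)"
          unfolding nrm_sq_integral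
          by (rule nn_integral_eq_integral) (use sqint_diff[OF f f] in \<open>auto simp: sqint_def\<close>)
        also have "\<dots> \<le> ennreal (e\<^sup>2)"
        proof (intro ennreal_leI power_mono)
          have "i \<le> r i" using r(1) by (rule seq_suble)
          then have "r i \<ge> m" using elim by linarith
          then show "nrm N (\<lambda>x. f n x - f (r i) x) \<le> e" using n[of "r i"] by simp
        qed (rule nrm_nonneg)
        finally show ?case .
      qed
    qed simp
    finally have le: "(\<integral>\<^sup>+x. ennreal ((f n x - h x)\<^sup>2) \<partial>N) \<le> ennreal (e\<^sup>2)" .
    have int: "integrable N (\<lambda>x. (f n x - h x)\<^sup>2)"
    proof (rule integrableI_bounded)
      show "(\<integral>\<^sup>+x. ennreal (norm ((f n x - h x)\<^sup>2)) \<partial>N) < \<infinity>"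
        using le_less_trans[OF le, of \<infinity>] by simp
    qed simp
    have "ennreal (e\<^sup>2) \<ge> ennreal ((nrm N (\<lambda>x. f n x - h x))\<^sup>2)"
    proof -
      have "(\<integral>\<^sup>+x. ennreal ((f n x - h x)\<^sup>2) \<partial>N) = ennreal (\<integral>x. (f n x - h x)\<^sup>2 \<partial>N)"
        by (rule nn_integral_eq_integral[OF int]) (rule AE_I2, rule zero_le_power2)
      with le show ?thesis unfolding nrm_sq_integral by metis
    qed
    then have "(nrm N (\<lambda>x. f n x - h x))\<^sup>2 \<le> e\<^sup>2"
      by (rule ennreal_le_iff[THEN iffD1, OF zero_le_power2])
    then have "nrm N (\<lambda>x. f n x - h x) \<le> e"
      by (rule power2_le_imp_le) (use e in simp)
    with int show ?thesis by simp
  qed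
  have h: "sqint N h"
  proof -
    obtain m where m: "\<And>i j. i \<ge> m \<Longrightarrow> j \<ge> m \<Longrightarrow> nrm N (\<lambda>x. f i x - f j x) < 1"
      using cauchy[of 1] by auto
    have "integrable N (\<lambda>x. (f m x - h x)\<^sup>2)"
      using fatou[of 1 m m] m by auto
    then have "sqint N (\<lambda>x. f m x - h x)" by (simp add: sqint_def)
    from sqint_diff[OF f[of m] this] show ?thesis by simp
  qed
  moreover have "(\<lambda>n. nrm N (\<lambda>x. f n x - h x)) \<longlonglongrightarrow> 0"
  proof (rule LIMSEQ_I)
    fix e :: real assume "e > 0"
    then obtain m where m: "\<And>i j. i \<ge> m \<Longrightarrow> j \<ge> m \<Longrightarrow> nrm N (\<lambda>x. f i x - f j x) < e / 2"
      using cauchy[of "e/2"] by auto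
    show "\<exists>no. \<forall>n\<ge>no. norm (nrm N (\<lambda>x. f n x - h x) - 0) < e"
    proof (intro exI[of _ m] allI impI)
      fix n assume "m \<le> n"
      then have "nrm N (\<lambda>x. f n x - h x) \<le> e / 2"
        using fatou[of "e/2" m n] m \<open>e > 0\<close> by auto
      then show "norm (nrm N (\<lambda>x. f n x - h x) - 0) < e"
        using \<open>e > 0\<close> nrm_nonneg[of N "\<lambda>x. f n x - h x"] by simp
    qed
  qed
  ultimately show ?thesis by (rule that)
qed

lemma tendsto_ip:
  assumes "\<And>n. sqint N (f n)" "sqint N h" "sqint N g" "(\<lambda>n. nrm N (\<lambda>x. f n x - h x)) \<longlonglongrightarrow> 0"
  shows "(\<lambda>n. ip N (f n) g) \<longlonglongrightarrow> ip N h g"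
proof (rule LIM_zero_cancel, rule Lim_null_comparison)
  show "eventually (\<lambda>n. norm (ip N (f n) g - ip N h g) \<le> nrm N (\<lambda>x. f n x - h x) * nrm N g) sequentially"
    using assms ip_Cauchy_Schwarz[OF sqint_diff[OF assms(1) assms(2)] assms(3)]
    by (simp add: ip_diff_left)
  show "(\<lambda>n. nrm N (\<lambda>x. f n x - h x) * nrm N g) \<longlonglongrightarrow> 0"
    using tendsto_mult_left_zero[OF assms(4)] by simp
qed

lemma tendsto_nrm:
  assumes "\<And>n. sqint N (f n)" "sqint N h" "(\<lambda>n. nrm N (\<lambda>x. f n x - h x)) \<longlonglongrightarrow> 0"
  shows "(\<lambda>n. nrm N (f n)) \<longlonglongrightarrow> nrm N h"
proof (rule LIM_zero_cancel, rule Lim_null_comparison[OF _ assms(3)])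
  show "eventually (\<lambda>n. norm (nrm N (f n) - nrm N h) \<le> nrm N (\<lambda>x. f n x - h x)) sequentially"
    using nrm_triangle_diff[OF assms(1,2)] by simp
qed

text \<open>Riesz-Fischer: Bessel makes the squared coefficients summable, hence the partial sums
  Cauchy. The starting index is free because the series is used from 1 for a complete eigenbasis and
  from \<open>d + 1\<close> for a basis of the complement.\<close>

lemma orthonormal_projection:
  fixes e :: "nat \<Rightarrow> 'a \<Rightarrow> real"
  assumes "finite_measure N" and e: "\<And>i. i \<ge> m \<Longrightarrow> sqint N (e i)"
    and on: "\<And>i j. i \<ge> m \<Longrightarrow> j \<ge> m \<Longrightarrow> ip N (e i) (e j) = (if i = j then 1 else 0)"
    and g: "sqint N g"
  obtains h where "sqint N h" "(\<lambda>n. nrm N (\<lambda>x. (\<Sum>i=m..n. ip N g (e i) * e i x) - h x)) \<longlonglongrightarrow> 0"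
    "\<And>i. i \<ge> m \<Longrightarrow> ip N h (e i) = ip N g (e i)"
proof -
  define c where "c i = (if i \<ge> m then ip N g (e i) else 0)" for i
  define S where "S n x = (\<Sum>i=m..n. ip N g (e i) * e i x)" for n x
  have S: "sqint N (S n)" for n
    unfolding S_def[abs_def] by (rule sqint_sum) (auto intro: sqint_cmult e)
  have sumc: "summable (\<lambda>i. (c i)\<^sup>2)"
  proof (rule summableI_nonneg_bounded)
    fix n
    have "(\<Sum>i<n. (c i)\<^sup>2) = (\<Sum>i\<in>{i\<in>{..<n}. i \<ge> m}. (ip N g (e i))\<^sup>2)"
      by (simp add: c_def sum.If_cases if_distrib[of "\<lambda>x. x\<^sup>2"] Int_def)
    also have "\<dots> \<le> (nrm N g)\<^sup>2" by (rule Bessel) (use e on g in auto)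
    finally show "(\<Sum>i<n. (c i)\<^sup>2) \<le> (nrm N g)\<^sup>2" .
  qed simp
  have diffS: "(nrm N (\<lambda>x. S j x - S i x))\<^sup>2 = (\<Sum>k=Suc i..<Suc j. (c k)\<^sup>2)" if "i \<le> j" for i j
  proof -
    \<comment> \<open>The maximum covers the case i < m, in which the shorter sum is empty.\<close>
    have "S j x - S i x = (\<Sum>k=max m (Suc i)..j. ip N g (e k) * e k x)" for x
    proof -
      have "{m..j} = {m..i} \<union> {max m (Suc i)..j}" using that by auto
      then have "S j x = S i x + (\<Sum>k=max m (Suc i)..j. ip N g (e k) * e k x)"
        unfolding S_def by (simp only:) (rule sum.union_disjoint, auto)
      then show ?thesis by simp
    qed
    then have "(nrm N (\<lambda>x. S j x - S i x))\<^sup>2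
        = (nrm N (\<lambda>x. \<Sum>k=max m (Suc i)..j. ip N g (e k) * e k x))\<^sup>2"
      by simp
    also have "\<dots> = (\<Sum>k=max m (Suc i)..j. (ip N g (e k))\<^sup>2)"
      by (rule nrm_sum_orthonormal) (use e on in auto)
    also have "\<dots> = (\<Sum>k=Suc i..<Suc j. (c k)\<^sup>2)"
      by (rule sum.mono_neutral_cong_left) (auto simp: c_def)
    finally show ?thesis .
  qed
  obtain h where h: "sqint N h" "(\<lambda>n. nrm N (\<lambda>x. S n x - h x)) \<longlonglongrightarrow> 0"
  proof (rule L2_complete[OF assms(1) S])
    fix r :: real assume "r > 0"
    then obtain M where M: "\<And>i j. i \<ge> M \<Longrightarrow> norm (\<Sum>k=i..<j. (c k)\<^sup>2) < r\<^sup>2"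
      using summable_Cauchy[THEN iffD1, OF sumc, rule_format, of "r\<^sup>2"] by auto
    have *: "nrm N (\<lambda>x. S j x - S i x) < r" if "i \<ge> M" "i \<le> j" for i j
      using M[of "Suc i" "Suc j"] diffS[of i j] that \<open>r > 0\<close>
      by (intro power2_less_imp_less[of _ r]) (auto simp: abs_less_iff)
    have "nrm N (\<lambda>x. S i x - S j x) < r" if "i \<ge> M" "j \<ge> M" for i j
    proof (cases "i \<le> j")
      case True
      have "nrm N (\<lambda>x. S i x - S j x) = nrm N (\<lambda>x. S j x - S i x)"
        using nrm_cmult[of N "-1" "\<lambda>x. S j x - S i x"] by simp
      then show ?thesis using *[of i j] True that by simp
    qed (use *[of j i] that in simp)
    then show "\<exists>m. \<forall>i\<ge>m. \<forall>j\<ge>m. nrm N (\<lambda>x. S i x - S j x) < r" by blast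
  qed blast
  have "ip N h (e k) = ip N g (e k)" if "k \<ge> m" for k
  proof -
    have "(\<lambda>n. ip N (S n) (e k)) \<longlonglongrightarrow> ip N h (e k)"
      by (rule tendsto_ip[OF S h(1) e[OF that] h(2)])
    moreover have ev: "eventually (\<lambda>n. ip N (S n) (e k) = ip N g (e k)) sequentially"
      using eventually_ge_at_top[of k]
    proof eventually_elim
      case (elim n)
      show ?case unfolding S_def[abs_def] by (rule ip_sum_orthonormal) (use e on elim that in auto)
    qed
    ultimately show ?thesis
      using LIMSEQ_unique[OF _ tendsto_eventually[OF ev]] by simp
  qed
  then show ?thesis using that[OF h(1) h(2)[unfolded S_def]] by blast
qed

section \<open>Square-integrable kernels\<close>

definition kap :: "'b measure \<Rightarrow> ('a \<Rightarrow> 'b \<Rightarrow> real) \<Rightarrow> ('b \<Rightarrow> real) \<Rightarrow> 'a \<Rightarrow> real" where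
  "kap N L g u = (\<integral>v. L u v * g v \<partial>N)"

text \<open>As an inner product on the product space, the form is bounded through Cauchy-Schwarz by
  the Hilbert-Schmidt norm of the kernel.\<close>

definition kform :: "'a measure \<Rightarrow> 'b measure \<Rightarrow> ('a \<Rightarrow> 'b \<Rightarrow> real) \<Rightarrow> ('a \<Rightarrow> real) \<Rightarrow> ('b \<Rightarrow> real) \<Rightarrow> real" where
  "kform N1 N2 L f g = ip (N1 \<Otimes>\<^sub>M N2) (case_prod L) (\<lambda>(u, v). f u * g v)"

text \<open>The kernel of A composed with the transpose of B. Contracting the second arguments is
  what makes the case A = B positive.\<close>

definition kcomp :: "'c measure \<Rightarrow> ('a \<Rightarrow> 'c \<Rightarrow> real) \<Rightarrow> ('b \<Rightarrow> 'c \<Rightarrow> real) \<Rightarrow> 'a \<Rightarrow> 'b \<Rightarrow> real" where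
  "kcomp N A B u v = (\<integral>z. A u z * B v z \<partial>N)"

lemma sqint_dominated:
  assumes g: "sqint N g" and f: "f \<in> borel_measurable N" and le: "AE x in N. \<bar>f x\<bar> \<le> \<bar>g x\<bar>"
  shows "sqint N f" and "nrm N f \<le> nrm N g"
proof -
  have le2: "AE x in N. (f x)\<^sup>2 \<le> (g x)\<^sup>2"
    using le by eventually_elim (simp add: abs_le_square_iff)
  have "integrable N (\<lambda>x. (f x)\<^sup>2)"
  proof (rule Bochner_Integration.integrable_bound)
    show "integrable N (\<lambda>x. (g x)\<^sup>2)" using g by (simp add: sqint_def)
    show "(\<lambda>x. (f x)\<^sup>2) \<in> borel_measurable N" using f by simp
    show "AE x in N. norm ((f x)\<^sup>2) \<le> norm ((g x)\<^sup>2)" using le2 by eventually_elim simp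
  qed
  then show sf: "sqint N f" using f by (simp add: sqint_def)
  have "(nrm N f)\<^sup>2 \<le> (nrm N g)\<^sup>2"
    unfolding nrm_sq_integral by (rule integral_mono_AE) (use sf g le2 in \<open>auto simp: sqint_def\<close>)
  then show "nrm N f \<le> nrm N g" by (rule power2_le_imp_le) (rule nrm_nonneg)
qed

lemma AE_pair_fst:
  assumes "sigma_finite_measure N2" "AE x in N1. P x"
  shows "AE z in N1 \<Otimes>\<^sub>M N2. P (fst z)"
proof -
  interpret sigma_finite_measure N2 by fact
  obtain A where A: "A \<in> null_sets N1" "{x\<in>space N1. \<not> P x} \<subseteq> A"
    using assms(2) by (auto simp: eventually_ae_filter)
  have "A \<times> space N2 \<in> null_sets (N1 \<Otimes>\<^sub>M N2)"
    using A(1) by (intro times_in_null_sets1) auto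
  then show ?thesis
    by (rule AE_I') (use A(2) in \<open>auto simp: space_pair_measure\<close>)
qed

lemma AE_pair_snd:
  assumes "sigma_finite_measure N2" "AE y in N2. P y"
  shows "AE z in N1 \<Otimes>\<^sub>M N2. P (snd z)"
proof -
  interpret sigma_finite_measure N2 by fact
  obtain A where A: "A \<in> null_sets N2" "{x\<in>space N2. \<not> P x} \<subseteq> A"
    using assms(2) by (auto simp: eventually_ae_filter)
  have "space N1 \<times> A \<in> null_sets (N1 \<Otimes>\<^sub>M N2)"
    using A(1) by (intro times_in_null_sets2) auto
  then show ?thesis
    by (rule AE_I') (use A(2) in \<open>auto simp: space_pair_measure\<close>)
qed

context
  fixes N1 :: "'a measure" and N2 :: "'b measure"
  assumes sf: "sigma_finite_measure N1" "sigma_finite_measure N2"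
begin

interpretation pair_sigma_finite N1 N2
  using sf by (simp add: pair_sigma_finite_def)

lemma sqint_tensor:
  assumes f: "sqint N1 f" and g: "sqint N2 g"
  shows "sqint (N1 \<Otimes>\<^sub>M N2) (\<lambda>(u, v). f u * g v)"
    and "nrm (N1 \<Otimes>\<^sub>M N2) (\<lambda>(u, v). f u * g v) = nrm N1 f * nrm N2 g"
proof -
  have [measurable]: "f \<in> borel_measurable N1" "g \<in> borel_measurable N2"
    using f g by (auto simp: sqint_def)
  have eq: "(\<integral>v. norm (((f u * g v))\<^sup>2) \<partial>N2) = (f u)\<^sup>2 * (nrm N2 g)\<^sup>2" for u
    by (simp add: power_mult_distrib nrm_sq_integral)
  have int: "integrable (N1 \<Otimes>\<^sub>M N2) (\<lambda>z. (f (fst z) * g (snd z))\<^sup>2)"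
  proof (rule Fubini_integrable)
    show "integrable N1 (\<lambda>u. \<integral>v. norm ((f (fst (u, v)) * g (snd (u, v)))\<^sup>2) \<partial>N2)"
      using f by (simp only: fst_conv snd_conv eq) (simp add: sqint_def)
    show "AE u in N1. integrable N2 (\<lambda>v. (f (fst (u, v)) * g (snd (u, v)))\<^sup>2)"
      using g by (simp add: sqint_def power_mult_distrib)
  qed simp
  then show "sqint (N1 \<Otimes>\<^sub>M N2) (\<lambda>(u, v). f u * g v)"
    by (simp add: sqint_def split_beta)
  have "(nrm (N1 \<Otimes>\<^sub>M N2) (\<lambda>(u, v). f u * g v))\<^sup>2 = (\<integral>u. \<integral>v. (f u * g v)\<^sup>2 \<partial>N2 \<partial>N1)"
    using integral_fst'[OF int] by (simp add: nrm_sq_integral split_beta)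
  also have "\<dots> = (\<integral>u. (f u)\<^sup>2 * (nrm N2 g)\<^sup>2 \<partial>N1)"
    using eq by simp
  also have "\<dots> = (nrm N1 f * nrm N2 g)\<^sup>2"
    by (simp add: power_mult_distrib nrm_sq_integral)
  finally show "nrm (N1 \<Otimes>\<^sub>M N2) (\<lambda>(u, v). f u * g v) = nrm N1 f * nrm N2 g"
    by (rule power2_eq_imp_eq) (simp_all add: nrm_nonneg)
qed

lemma sqint_transpose:
  assumes "sqint (N1 \<Otimes>\<^sub>M N2) (case_prod L)"
  shows "sqint (N2 \<Otimes>\<^sub>M N1) (\<lambda>(v, u). L u v)"
    and "nrm (N2 \<Otimes>\<^sub>M N1) (\<lambda>(v, u). L u v) = nrm (N1 \<Otimes>\<^sub>M N2) (case_prod L)"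
proof -
  have [measurable]: "case_prod L \<in> borel_measurable (N1 \<Otimes>\<^sub>M N2)"
    using assms by (simp add: sqint_def)
  have "integrable (N2 \<Otimes>\<^sub>M N1) (\<lambda>(v, u). (\<lambda>z. (case_prod L z)\<^sup>2) (u, v))"
    by (subst integrable_product_swap_iff) (use assms in \<open>simp add: sqint_def\<close>)
  then have "integrable (N2 \<Otimes>\<^sub>M N1) (\<lambda>z. (case z of (v, u) \<Rightarrow> L u v)\<^sup>2)"
    by (simp add: split_beta')
  moreover have "(\<lambda>(v, u). L u v) \<in> borel_measurable (N2 \<Otimes>\<^sub>M N1)"
    using measurable_pair_swap[of "case_prod L" N1 N2 borel] by simp
  ultimately show "sqint (N2 \<Otimes>\<^sub>M N1) (\<lambda>(v, u). L u v)"
    by (simp add: sqint_def)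
  have "(\<integral>(v, u). (\<lambda>z. (case_prod L z)\<^sup>2) (u, v) \<partial>(N2 \<Otimes>\<^sub>M N1)) = (\<integral>z. (case_prod L z)\<^sup>2 \<partial>(N1 \<Otimes>\<^sub>M N2))"
    by (rule integral_product_swap) simp
  then have "(nrm (N2 \<Otimes>\<^sub>M N1) (\<lambda>(v, u). L u v))\<^sup>2 = (nrm (N1 \<Otimes>\<^sub>M N2) (case_prod L))\<^sup>2"
    by (simp add: nrm_sq_integral split_beta')
  then show "nrm (N2 \<Otimes>\<^sub>M N1) (\<lambda>(v, u). L u v) = nrm (N1 \<Otimes>\<^sub>M N2) (case_prod L)"
    by (rule power2_eq_imp_eq) (simp_all add: nrm_nonneg)
qed

text \<open>Fubini for the squared kernel. Row norms bound \<open>kap\<close> and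
  \<open>kcomp\<close> pointwise; with the sample space as first factor they are the random norms to
  which Markov's inequality is applied.\<close>

lemma sqint_row_nrm:
  assumes L: "sqint (N1 \<Otimes>\<^sub>M N2) (case_prod L)"
  shows "sqint N1 (\<lambda>u. nrm N2 (L u))"
    and "nrm N1 (\<lambda>u. nrm N2 (L u)) = nrm (N1 \<Otimes>\<^sub>M N2) (case_prod L)"
proof -
  have [measurable]: "case_prod L \<in> borel_measurable (N1 \<Otimes>\<^sub>M N2)"
    using L by (simp add: sqint_def)
  have int: "integrable (N1 \<Otimes>\<^sub>M N2) (\<lambda>z. (case_prod L z)\<^sup>2)"
    using L by (simp add: sqint_def)
  have [measurable]: "(\<lambda>u. nrm N2 (L u)) \<in> borel_measurable N1"
    unfolding nrm_def ip_def by measurable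
  show "sqint N1 (\<lambda>u. nrm N2 (L u))"
    using integrable_fst'[OF int] by (simp add: sqint_def nrm_sq_integral)
  have "(nrm N1 (\<lambda>u. nrm N2 (L u)))\<^sup>2 = (nrm (N1 \<Otimes>\<^sub>M N2) (case_prod L))\<^sup>2"
    using integral_fst'[OF int] by (simp add: nrm_sq_integral)
  then show "nrm N1 (\<lambda>u. nrm N2 (L u)) = nrm (N1 \<Otimes>\<^sub>M N2) (case_prod L)"
    by (rule power2_eq_imp_eq) (simp_all add: nrm_nonneg)
qed

lemma sqint_kap:
  assumes L: "sqint (N1 \<Otimes>\<^sub>M N2) (case_prod L)" and g: "sqint N2 g"
  shows "sqint N1 (kap N2 L g)"
proof -
  have [measurable]: "case_prod L \<in> borel_measurable (N1 \<Otimes>\<^sub>M N2)" "g \<in> borel_measurable N2"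
    using L g by (auto simp: sqint_def)
  have "AE u in N1. sqint N2 (L u)"
    using sqint_section_AE[OF sf L] by simp
  then have "AE u in N1. \<bar>kap N2 L g u\<bar> \<le> \<bar>nrm N2 g * nrm N2 (L u)\<bar>"
  proof eventually_elim
    case (elim u)
    show ?case using ip_Cauchy_Schwarz[OF elim g] by (simp add: kap_def ip_def abs_mult nrm_nonneg mult.commute)
  qed
  moreover have "kap N2 L g \<in> borel_measurable N1"
    unfolding kap_def[abs_def] by measurable
  ultimately show ?thesis
    using sqint_dominated(1)[OF sqint_cmult[OF sqint_row_nrm(1)[OF L]]] by blast
qed

lemma kform_bound:
  assumes "sqint (N1 \<Otimes>\<^sub>M N2) (case_prod L)" "sqint N1 f" "sqint N2 g"
  shows "\<bar>kform N1 N2 L f g\<bar> \<le> nrm (N1 \<Otimes>\<^sub>M N2) (case_prod L) * (nrm N1 f * nrm N2 g)"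
  unfolding kform_def using ip_Cauchy_Schwarz[OF assms(1) sqint_tensor(1)[OF assms(2,3)]]
  by (simp add: sqint_tensor(2)[OF assms(2,3)])

text \<open>Fubini in both orders: the same number reads as f against L g or as the transpose of L
  on f against g.\<close>

lemma kform_kap:
  assumes L: "sqint (N1 \<Otimes>\<^sub>M N2) (case_prod L)" and f: "sqint N1 f" and g: "sqint N2 g"
  shows "kform N1 N2 L f g = ip N1 f (kap N2 L g)"
    and "kform N1 N2 L f g = ip N2 (kap N1 (\<lambda>v u. L u v) f) g"
proof -
  have int: "integrable (N1 \<Otimes>\<^sub>M N2) (\<lambda>(u, v). L u v * (f u * g v))"
    using sqint_mult_integrable[OF L sqint_tensor(1)[OF f g]] by (simp add: split_beta')
  have k: "kform N1 N2 L f g = (\<integral>(u, v). L u v * (f u * g v) \<partial>(N1 \<Otimes>\<^sub>M N2))"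
    by (simp add: kform_def ip_def split_beta')
  show "kform N1 N2 L f g = ip N1 f (kap N2 L g)"
    unfolding k integral_fst[OF int, symmetric] ip_def kap_def
    by (intro Bochner_Integration.integral_cong refl) (simp add: mult.left_commute)
  show "kform N1 N2 L f g = ip N2 (kap N1 (\<lambda>v u. L u v) f) g"
    unfolding k integral_snd[OF int, symmetric] ip_def kap_def
    by (intro Bochner_Integration.integral_cong refl) (simp flip: mult.assoc)
qed

lemma kform_add_left:
  assumes "sqint (N1 \<Otimes>\<^sub>M N2) (case_prod L)" "sqint N1 f" "sqint N1 f'" "sqint N2 g"
  shows "kform N1 N2 L (\<lambda>x. f x + f' x) g = kform N1 N2 L f g + kform N1 N2 L f' g"
  using assms by (simp add: kform_kap(1) ip_add_left sqint_kap sqint_add)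

lemma kform_cmult_left:
  assumes "sqint (N1 \<Otimes>\<^sub>M N2) (case_prod L)" "sqint N1 f" "sqint N2 g"
  shows "kform N1 N2 L (\<lambda>x. c * f x) g = c * kform N1 N2 L f g"
  using assms by (simp add: kform_kap(1) ip_cmult_left sqint_cmult)

lemma kform_diff_kernel:
  assumes "sqint (N1 \<Otimes>\<^sub>M N2) (case_prod L)" "sqint (N1 \<Otimes>\<^sub>M N2) (case_prod L')" "sqint N1 f" "sqint N2 g"
  shows "kform N1 N2 (\<lambda>u v. L u v - L' u v) f g = kform N1 N2 L f g - kform N1 N2 L' f g"
  unfolding kform_def using ip_diff_left[OF assms(1,2) sqint_tensor(1)[OF assms(3,4)]]
  by (simp add: split_beta')

lemma kform_sum_kernel:
  assumes "\<And>k. k \<in> I \<Longrightarrow> sqint (N1 \<Otimes>\<^sub>M N2) (case_prod (L k))" "sqint N1 f" "sqint N2 g"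
  shows "kform N1 N2 (\<lambda>u v. \<Sum>k\<in>I. L k u v) f g = (\<Sum>k\<in>I. kform N1 N2 (L k) f g)"
  unfolding kform_def using ip_sum_left[OF assms(1) sqint_tensor(1)[OF assms(2,3)]]
  by (simp add: split_beta')

lemma sqint_sum_kernel:
  assumes "\<And>k. k \<in> I \<Longrightarrow> sqint (N1 \<Otimes>\<^sub>M N2) (case_prod (L k))"
  shows "sqint (N1 \<Otimes>\<^sub>M N2) (\<lambda>(u, v). \<Sum>k\<in>I. L k u v)"
  using sqint_sum[OF assms] by (simp add: split_beta')

end

context
  fixes N1 :: "'a measure" and N2 :: "'b measure" and N3 :: "'c measure" and A B
  assumes sf: "sigma_finite_measure N1" "sigma_finite_measure N2" "sigma_finite_measure N3"
    and A: "sqint (N1 \<Otimes>\<^sub>M N3) (case_prod A)" and B: "sqint (N2 \<Otimes>\<^sub>M N3) (case_prod B)"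
begin

interpretation N3: sigma_finite_measure N3
  using sf by simp

text \<open>Cauchy-Schwarz on rows dominates the composed kernel almost everywhere by the tensor
  product of the row norms of A and B, whose norm factorises.\<close>

lemma
  shows sqint_kcomp: "sqint (N1 \<Otimes>\<^sub>M N2) (case_prod (kcomp N3 A B))"
    and nrm_kcomp_le: "nrm (N1 \<Otimes>\<^sub>M N2) (case_prod (kcomp N3 A B))
      \<le> nrm (N1 \<Otimes>\<^sub>M N3) (case_prod A) * nrm (N2 \<Otimes>\<^sub>M N3) (case_prod B)"
proof -
  have mA[measurable]: "case_prod A \<in> borel_measurable (N1 \<Otimes>\<^sub>M N3)"
    and mB[measurable]: "case_prod B \<in> borel_measurable (N2 \<Otimes>\<^sub>M N3)"
    using A B by (auto simp: sqint_def)
  have [measurable]: "(\<lambda>z. case_prod A (fst (fst z), snd z)) \<in> borel_measurable ((N1 \<Otimes>\<^sub>M N2) \<Otimes>\<^sub>M N3)"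
    "(\<lambda>z. case_prod B (snd (fst z), snd z)) \<in> borel_measurable ((N1 \<Otimes>\<^sub>M N2) \<Otimes>\<^sub>M N3)"
    by (intro measurable_compose[OF _ mA] measurable_compose[OF _ mB], measurable)+
  have "(\<lambda>(x, z). A (fst x) z * B (snd x) z) \<in> borel_measurable ((N1 \<Otimes>\<^sub>M N2) \<Otimes>\<^sub>M N3)"
    using borel_measurable_times[OF \<open>(\<lambda>z. case_prod A (fst (fst z), snd z)) \<in> _\<close> \<open>(\<lambda>z. case_prod B (snd (fst z), snd z)) \<in> _\<close>]
    by (simp add: split_beta')
  then have "(\<lambda>x. \<integral>z. A (fst x) z * B (snd x) z \<partial>N3) \<in> borel_measurable (N1 \<Otimes>\<^sub>M N2)"
    by (rule N3.borel_measurable_lebesgue_integral)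
  then have m: "case_prod (kcomp N3 A B) \<in> borel_measurable (N1 \<Otimes>\<^sub>M N2)"
    by (simp add: kcomp_def split_beta')
  have ae: "AE x in N1 \<Otimes>\<^sub>M N2. \<bar>case_prod (kcomp N3 A B) x\<bar> \<le> \<bar>case x of (u, v) \<Rightarrow> nrm N3 (A u) * nrm N3 (B v)\<bar>"
    using AE_pair_fst[OF sf(2) sqint_section_AE[OF sf(1,3) A]] AE_pair_snd[OF sf(2) sqint_section_AE[OF sf(2,3) B]]
  proof eventually_elim
    case (elim x)
    then have "sqint N3 (A (fst x))" "sqint N3 (B (snd x))" by auto
    from ip_Cauchy_Schwarz[OF this] show ?case
      by (simp add: split_beta kcomp_def ip_def abs_mult nrm_nonneg)
  qed
  note T = sqint_tensor[OF sf(1,2) sqint_row_nrm(1)[OF sf(1,3) A] sqint_row_nrm(1)[OF sf(2,3) B]]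
  show "sqint (N1 \<Otimes>\<^sub>M N2) (case_prod (kcomp N3 A B))"
    by (rule sqint_dominated(1)[OF T(1) m ae])
  show "nrm (N1 \<Otimes>\<^sub>M N2) (case_prod (kcomp N3 A B))
      \<le> nrm (N1 \<Otimes>\<^sub>M N3) (case_prod A) * nrm (N2 \<Otimes>\<^sub>M N3) (case_prod B)"
    using sqint_dominated(2)[OF T(1) m ae] T(2) sqint_row_nrm(2)[OF sf(1,3) A] sqint_row_nrm(2)[OF sf(2,3) B]
    by simp
qed

text \<open>Moves both transposes off the kernel; with A = B and f = g the form becomes a squared
  norm. Applying \<open>kform_kap\<close> twice replaces a Fubini argument for an integrand in three
  variables.\<close>

lemma kform_kcomp:
  assumes f: "sqint N1 f" and g: "sqint N2 g"
  shows "kform N1 N2 (kcomp N3 A B) f g = ip N3 (kap N1 (\<lambda>z u. A u z) f) (kap N2 (\<lambda>z v. B v z) g)"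
proof -
  define h where "h = kap N2 (\<lambda>z v. B v z) g"
  have h: "sqint N3 h"
    unfolding h_def using sqint_kap[OF sf(3,2) _ g, of "\<lambda>z v. B v z"] sqint_transpose(1)[OF sf(2,3) B] by simp
  \<comment> \<open>For almost every u the row \<open>A u\<close> is itself a square-integrable
    function, so B can be transposed against it.\<close>
  have ae: "AE u in N1. kap N2 (kcomp N3 A B) g u = kap N3 A h u"
    using sqint_section_AE[OF sf(1,3) A]
  proof eventually_elim
    case (elim u)
    then have Au: "sqint N3 (A u)" by simp
    have "kap N2 (kcomp N3 A B) g u = ip N2 g (kap N3 B (A u))"
      by (simp add: kap_def kcomp_def ip_def mult.commute)
    also have "\<dots> = kform N2 N3 B g (A u)"
      by (rule kform_kap(1)[OF sf(2,3) B g Au, symmetric])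
    also have "\<dots> = ip N3 h (A u)"
      unfolding h_def by (rule kform_kap(2)[OF sf(2,3) B g Au])
    finally show ?case by (simp add: kap_def ip_def mult.commute)
  qed
  have "kform N1 N2 (kcomp N3 A B) f g = ip N1 (kap N2 (kcomp N3 A B) g) f"
    using kform_kap(1)[OF sf(1,2) sqint_kcomp f g] by (simp add: ip_commute)
  also have "\<dots> = ip N1 (kap N3 A h) f"
    by (rule ip_cong_AE[OF ae sqint_kap[OF sf(1,2) sqint_kcomp g] sqint_kap[OF sf(1,3) A h] f])
  also have "\<dots> = ip N3 (kap N1 (\<lambda>z u. A u z) f) h"
    using kform_kap[OF sf(1,3) A f h] by (simp add: ip_commute)
  finally show ?thesis by (simp add: h_def)
qed

end

section \<open>The interval\<close>

abbreviation Iab :: "real \<Rightarrow> real \<Rightarrow> real measure" where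
  "Iab a b \<equiv> restrict_space lborel {a..b}"

lemma finite_measure_Iab: "finite_measure (Iab a b)"
  by (rule finite_measureI) (simp add: emeasure_restrict_space space_restrict_space emeasure_lborel_Icc_eq)

lemma sigma_finite_Iab: "sigma_finite_measure (Iab a b)"
  using finite_measure_Iab[of a b] by (simp add: finite_measure_def)

lemma space_Iab: "space (Iab a b) = {a..b}"
  by (simp add: space_restrict_space)

lemma inL2_iff_sqint: "inL2 a b f \<longleftrightarrow> sqint (Iab a b) f"
  unfolding inL2_def sqint_def set_borel_measurable_def set_integrable_def
  by (simp add: borel_measurable_restrict_space_iff integrable_restrict_space)

lemma set_integral_eq_Iab: "(LINT u:{a..b}|lborel. f u) = (\<integral>u. f u \<partial>Iab a b)" for f :: "real \<Rightarrow> real"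
  by (simp add: set_lebesgue_integral_def integral_restrict_space)

lemma L2ip_eq_ip: "L2ip a b f g = ip (Iab a b) f g"
  by (simp add: L2ip_def ip_def set_integral_eq_Iab)

lemma L2norm_eq_nrm: "L2norm a b f = nrm (Iab a b) f"
  by (simp add: L2norm_def nrm_def ip_def set_integral_eq_Iab power2_eq_square)

lemma ae_eq_on_iff: "ae_eq_on a b f g \<longleftrightarrow> (AE u in Iab a b. f u = g u)"
  by (simp add: ae_eq_on_def AE_restrict_space_iff)

lemma kapply_eq_kap: "kapply a b L g = kap (Iab a b) L g"
  by (simp add: kapply_def kap_def[abs_def] set_integral_eq_Iab)

lemma Nk_eq_kcomp: "Nk a b Mk k = kcomp (Iab a b) (Mk k) (Mk k)"
  by (simp add: Nk_def[abs_def] kcomp_def[abs_def] set_integral_eq_Iab)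

text \<open>Links \<open>HSnorm\<close>, an integral against planar Lebesgue measure, to the product
  measure that Fubini works with. The \<sigma>-algebras agree because the identity is measurable
  both ways, the measures because they agree on rectangles.\<close>

lemma pair_Iab: "Iab a b \<Otimes>\<^sub>M Iab a b = restrict_space lborel ({a..b} \<times> {a..b})"
proof (rule pair_measure_eqI[OF sigma_finite_Iab sigma_finite_Iab])
  show "sets (Iab a b \<Otimes>\<^sub>M Iab a b) = sets (restrict_space lborel ({a..b} \<times> {a..b}))"
  proof -
    let ?P = "restrict_space (lborel \<Otimes>\<^sub>M lborel) ({a..b} \<times> {a..b}) :: (real \<times> real) measure"
    have sp: "space (Iab a b \<Otimes>\<^sub>M Iab a b) = {a..b} \<times> {a..b}" "space ?P = {a..b} \<times> {a..b}"
      by (auto simp: space_pair_measure space_restrict_space)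
    have id1: "(\<lambda>x. x) \<in> measurable (Iab a b \<Otimes>\<^sub>M Iab a b) ?P"
    proof (rule measurable_restrict_space2)
      have "(\<lambda>x. (fst x, snd x)) \<in> measurable (Iab a b \<Otimes>\<^sub>M Iab a b) (lborel \<Otimes>\<^sub>M lborel)"
        by (intro measurable_Pair measurable_compose[OF measurable_fst] measurable_compose[OF measurable_snd]
            measurable_restrict_space1 measurable_ident_sets) auto
      then show "(\<lambda>x. x) \<in> measurable (Iab a b \<Otimes>\<^sub>M Iab a b) (lborel \<Otimes>\<^sub>M lborel)" by simp
    qed (auto simp: sp)
    have id2: "(\<lambda>x. (fst x, snd x)) \<in> measurable ?P (Iab a b \<Otimes>\<^sub>M Iab a b)"
      by (intro measurable_Pair measurable_restrict_space2 measurable_restrict_space1) (auto simp: sp)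
    have "sets (Iab a b \<Otimes>\<^sub>M Iab a b) = sets ?P"
    proof (intro equalityI subsetI)
      fix A assume A: "A \<in> sets (Iab a b \<Otimes>\<^sub>M Iab a b)"
      have "A \<subseteq> space ?P" using sets.sets_into_space[OF A] sp by simp
      then have "(\<lambda>x. (fst x, snd x)) -` A \<inter> space ?P = A" by auto
      with measurable_sets[OF id2 A] show "A \<in> sets ?P" by simp
    next
      fix A assume A: "A \<in> sets ?P"
      have "A \<subseteq> space (Iab a b \<Otimes>\<^sub>M Iab a b)" using sets.sets_into_space[OF A] sp by simp
      then have "(\<lambda>x. x) -` A \<inter> space (Iab a b \<Otimes>\<^sub>M Iab a b) = A" by auto
      with measurable_sets[OF id1 A] show "A \<in> sets (Iab a b \<Otimes>\<^sub>M Iab a b)" by simp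
    qed
    then show ?thesis by (simp only: lborel_prod)
  qed
  fix A B assume A: "A \<in> sets (Iab a b)" and B: "B \<in> sets (Iab a b)"
  then have AB: "A \<in> sets lborel" "B \<in> sets lborel" "A \<subseteq> {a..b}" "B \<subseteq> {a..b}"
    by (auto simp: sets_restrict_space_iff)
  have "emeasure (restrict_space lborel ({a..b} \<times> {a..b})) (A \<times> B) = emeasure (lborel \<Otimes>\<^sub>M lborel) (A \<times> B)"
  proof -
    have "{a..b} \<times> {a..b} \<in> sets (lborel \<Otimes>\<^sub>M lborel)" by measurable
    then have "{a..b} \<times> {a..b} \<in> sets (lborel :: (real \<times> real) measure)" by (simp only: lborel_prod)
    then show ?thesis
      unfolding lborel_prod by (intro emeasure_restrict_space) (use AB in auto)
  qed
  also have "\<dots> = emeasure lborel A * emeasure lborel B"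
    by (rule lborel.emeasure_pair_measure_Times[OF AB(1,2)])
  finally show "emeasure (Iab a b) A * emeasure (Iab a b) B
      = emeasure (restrict_space lborel ({a..b} \<times> {a..b})) (A \<times> B)"
    using AB by (simp add: emeasure_restrict_space)
qed

lemma HSnorm_eq_nrm: "HSnorm a b L = nrm (Iab a b \<Otimes>\<^sub>M Iab a b) (case_prod L)"
proof -
  have "{a..b} \<times> {a..b} \<in> sets (lborel \<Otimes>\<^sub>M lborel)" by measurable
  then have "{a..b} \<times> {a..b} \<in> sets (lborel :: (real \<times> real) measure)"
    by (simp only: lborel_prod)
  then show ?thesis
    unfolding pair_Iab HSnorm_def nrm_def ip_def set_lebesgue_integral_def
    by (simp add: integral_restrict_space split_beta power2_eq_square)
qed

section \<open>Perturbation of symmetric forms\<close>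

text \<open>Gaussian elimination. It supplies the dimension count of the min-max argument: some
  nonzero combination of j functions is orthogonal to j - 1 given ones.\<close>

lemma homogeneous_system_nontrivial:
  fixes A :: "nat \<Rightarrow> 'i \<Rightarrow> real"
  assumes "finite I" "card I = Suc m"
  shows "\<exists>c. (\<exists>i\<in>I. c i \<noteq> 0) \<and> (\<forall>k<m. (\<Sum>i\<in>I. A k i * c i) = 0)"
  using assms
proof (induction m arbitrary: I A)
  case 0
  then obtain i where "i \<in> I" by fastforce
  then show ?case by (intro exI[of _ "\<lambda>_. 1"]) auto
next
  case (Suc m)
  show ?case
  proof (cases "\<exists>i0\<in>I. A m i0 \<noteq> 0")
    case False
    obtain i0 where i0: "i0 \<in> I" using Suc.prems by fastforce
    have "card (I - {i0}) = Suc m" using Suc.prems i0 by simp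
    from Suc.IH[OF _ this, of A] obtain c where
      c: "\<exists>i\<in>I - {i0}. c i \<noteq> 0" "\<And>k. k < m \<Longrightarrow> (\<Sum>i\<in>I - {i0}. A k i * c i) = 0"
      using Suc.prems by auto
    define c' where "c' i = (if i = i0 then 0 else c i)" for i
    have eq: "(\<Sum>i\<in>I. A k i * c' i) = (\<Sum>i\<in>I - {i0}. A k i * c i)" for k
      using Suc.prems i0 by (subst sum.remove[OF _ i0]) (auto simp: c'_def intro!: sum.cong)
    have "\<forall>k<Suc m. (\<Sum>i\<in>I. A k i * c' i) = 0"
      using c(2) False unfolding eq by (auto simp: less_Suc_eq)
    moreover have "\<exists>i\<in>I. c' i \<noteq> 0" using c(1) by (auto simp: c'_def)
    ultimately show ?thesis by blast
  next
    case True
    then obtain i0 where i0: "i0 \<in> I" "A m i0 \<noteq> 0" by auto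
    have "card (I - {i0}) = Suc m" using Suc.prems i0 by simp
    \<comment> \<open>The pivot \<open>A m i0\<close> eliminates the unknown \<open>i0\<close> from
      the other equations.\<close>
    from Suc.IH[OF _ this, of "\<lambda>k i. A k i - A k i0 * A m i / A m i0"] obtain c where
      c: "\<exists>i\<in>I - {i0}. c i \<noteq> 0"
        "\<And>k. k < m \<Longrightarrow> (\<Sum>i\<in>I - {i0}. (A k i - A k i0 * A m i / A m i0) * c i) = 0"
      using Suc.prems by auto
    define s where "s = (\<Sum>i\<in>I - {i0}. A m i * c i)"
    \<comment> \<open>Back substitution: this value of the eliminated unknown solves the last
      equation.\<close>
    define c' where "c' i = (if i = i0 then - s / A m i0 else c i)" for i
    have eq: "(\<Sum>i\<in>I. A k i * c' i) = - A k i0 * s / A m i0 + (\<Sum>i\<in>I - {i0}. A k i * c i)" for k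
      using Suc.prems i0 by (subst sum.remove[OF _ i0(1)]) (auto simp: c'_def intro!: sum.cong)
    have "(\<Sum>i\<in>I. A k i * c' i) = 0" if "k < m" for k
    proof -
      have "(\<Sum>i\<in>I - {i0}. (A k i - A k i0 * A m i / A m i0) * c i)
          = (\<Sum>i\<in>I - {i0}. A k i * c i - (A k i0 / A m i0) * (A m i * c i))"
        by (intro sum.cong) (auto simp: algebra_simps)
      also have "\<dots> = (\<Sum>i\<in>I - {i0}. A k i * c i) - (A k i0 / A m i0) * s"
        by (simp add: sum_subtractf s_def sum_distrib_left)
      finally show ?thesis using c(2)[OF that] unfolding eq by simp
    qed
    moreover have "(\<Sum>i\<in>I. A m i * c' i) = 0"
      unfolding eq using i0 by (simp add: s_def)
    ultimately have "\<forall>k<Suc m. (\<Sum>i\<in>I. A k i * c' i) = 0" by (auto simp: less_Suc_eq)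
    moreover have "\<exists>i\<in>I. c' i \<noteq> 0" using c(1) by (auto simp: c'_def)
    ultimately show ?thesis by blast
  qed
qed

text \<open>Linearity is relative to square-integrable arguments, because elsewhere the integrals
  behind a form may take the default value 0. Linearity in the second argument follows by
  symmetry.\<close>

definition symform :: "'a measure \<Rightarrow> (('a \<Rightarrow> real) \<Rightarrow> ('a \<Rightarrow> real) \<Rightarrow> real) \<Rightarrow> bool" where
  "symform N Q \<longleftrightarrow>
    (\<forall>f g h. sqint N f \<longrightarrow> sqint N g \<longrightarrow> sqint N h \<longrightarrow> Q (\<lambda>x. f x + g x) h = Q f h + Q g h) \<and>
    (\<forall>c f g. sqint N f \<longrightarrow> sqint N g \<longrightarrow> Q (\<lambda>x. c * f x) g = c * Q f g) \<and>
    (\<forall>f g. sqint N f \<longrightarrow> sqint N g \<longrightarrow> Q f g = Q g f)"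

lemma symform_add: "symform N Q \<Longrightarrow> sqint N f \<Longrightarrow> sqint N g \<Longrightarrow> sqint N h \<Longrightarrow>
    Q (\<lambda>x. f x + g x) h = Q f h + Q g h"
  by (simp add: symform_def)

lemma symform_cmult: "symform N Q \<Longrightarrow> sqint N f \<Longrightarrow> sqint N g \<Longrightarrow> Q (\<lambda>x. c * f x) g = c * Q f g"
  by (simp add: symform_def)

lemma symform_sym: "symform N Q \<Longrightarrow> sqint N f \<Longrightarrow> sqint N g \<Longrightarrow> Q f g = Q g f"
  by (simp add: symform_def)

lemma symform_diff:
  assumes "symform N Q" "sqint N f" "sqint N g" "sqint N h"
  shows "Q (\<lambda>x. f x - g x) h = Q f h - Q g h"
  using symform_add[OF assms(1,2) sqint_cmult[OF assms(3), of "-1"] assms(4)]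
    symform_cmult[OF assms(1,3,4), of "-1"] by simp

lemma symform_lincomb:
  assumes Q: "symform N Q" and f: "\<And>i. i \<in> I \<Longrightarrow> sqint N (f i)" and g: "sqint N g"
  shows "Q (\<lambda>x. \<Sum>i\<in>I. c i * f i x) g = (\<Sum>i\<in>I. c i * Q (f i) g)"
proof -
  have z: "Q (\<lambda>x. 0) g = 0"
    using symform_cmult[OF Q sqint_zero g, of 0] by simp
  show ?thesis using f
  proof (induction I rule: infinite_finite_induct)
    case (insert i I)
    have "Q (\<lambda>x. c i * f i x + (\<Sum>i\<in>I. c i * f i x)) g = Q (\<lambda>x. c i * f i x) g + Q (\<lambda>x. \<Sum>i\<in>I. c i * f i x) g"
      by (rule symform_add[OF Q _ _ g]) (use insert.prems in \<open>auto intro!: sqint_cmult sqint_sum\<close>)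
    then show ?case
      using insert symform_cmult[OF Q _ g, of "f i" "c i"] by simp
  qed (simp_all add: z)
qed

text \<open>In the span of \<open>f 1\<close>, ..., \<open>f j\<close> there is a nonzero g
  orthogonal to all \<open>h k\<close>. On that span the quotient of Q g g by the squared norm is at
  least \<open>t j\<close>, the smallest eigenvalue involved, and \<open>up\<close> bounds it by s.
  Since the \<open>h k\<close> are arbitrary, the lemma serves either eigensystem with the other as
  constraints.\<close>

lemma Courant_Fischer_le:
  fixes f :: "nat \<Rightarrow> 'a \<Rightarrow> real"
  assumes Q: "symform N Q" and f: "\<And>i. i \<in> {1..j} \<Longrightarrow> sqint N (f i)"
    and on: "\<And>i k. i \<in> {1..j} \<Longrightarrow> k \<in> {1..j} \<Longrightarrow> ip N (f i) (f k) = (if i = k then 1 else 0)"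
    and eig: "\<And>i g. i \<in> {1..j} \<Longrightarrow> sqint N g \<Longrightarrow> Q (f i) g = t i * ip N (f i) g"
    and t: "\<And>i. i \<in> {1..j} \<Longrightarrow> t j \<le> t i" and j: "1 \<le> j"
    and h: "\<And>k. k \<in> {1..<j} \<Longrightarrow> sqint N (h k)"
    and up: "\<And>g. sqint N g \<Longrightarrow> (\<And>k. k \<in> {1..<j} \<Longrightarrow> ip N g (h k) = 0) \<Longrightarrow> Q g g \<le> s * (nrm N g)\<^sup>2"
  shows "t j \<le> s"
proof -
  \<comment> \<open>There are j unknowns and j - 1 constraints; the equations count from 0 and the
    constraints from 1, hence \<open>Suc k\<close>.\<close>
  have "card {1..j} = Suc (j - 1)" using j by simp
  from homogeneous_system_nontrivial[OF _ this, of "\<lambda>k i. ip N (f i) (h (Suc k))"]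
  obtain c where c: "\<exists>i\<in>{1..j}. c i \<noteq> 0"
    "\<And>k. k < j - 1 \<Longrightarrow> (\<Sum>i\<in>{1..j}. ip N (f i) (h (Suc k)) * c i) = 0" by auto
  define g where "g x = (\<Sum>i\<in>{1..j}. c i * f i x)" for x
  have g: "sqint N g" unfolding g_def[abs_def] by (intro sqint_sum sqint_cmult f)
  have ng: "(nrm N g)\<^sup>2 = (\<Sum>i\<in>{1..j}. (c i)\<^sup>2)"
    unfolding g_def[abs_def] by (rule nrm_sum_orthonormal) (use f on in auto)
  have gf: "ip N g (f k) = c k" if "k \<in> {1..j}" for k
    unfolding g_def[abs_def] by (rule ip_sum_orthonormal) (use f on that in auto)
  have perp: "ip N g (h k) = 0" if k: "k \<in> {1..<j}" for k
  proof -
    have "ip N g (h k) = (\<Sum>i\<in>{1..j}. ip N (f i) (h k) * c i)"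
      unfolding g_def[abs_def] using f h[OF k]
      by (subst ip_sum_left) (auto simp: sqint_cmult ip_cmult_left mult.commute)
    moreover have "k - 1 < j - 1" "Suc (k - 1) = k" using k by auto
    ultimately show ?thesis using c(2)[of "k - 1"] by simp
  qed
  have "t j * (nrm N g)\<^sup>2 = (\<Sum>i\<in>{1..j}. t j * (c i)\<^sup>2)"
    by (simp add: ng sum_distrib_left)
  also have "\<dots> \<le> (\<Sum>i\<in>{1..j}. t i * (c i)\<^sup>2)"
    by (intro sum_mono mult_right_mono t) auto
  also have "\<dots> = (\<Sum>i\<in>{1..j}. c i * Q (f i) g)"
    using g gf by (intro sum.cong) (auto simp: eig ip_commute[of N _ g] power2_eq_square)
  also have "\<dots> = Q g g"
    unfolding g_def[abs_def] by (rule symform_lincomb[OF Q f, symmetric]) (use g in \<open>auto simp: g_def[abs_def]\<close>)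
  also have "\<dots> \<le> s * (nrm N g)\<^sup>2"
    by (rule up[OF g perp])
  finally have "t j * (nrm N g)\<^sup>2 \<le> s * (nrm N g)\<^sup>2" .
  moreover have "(nrm N g)\<^sup>2 > 0"
  proof -
    from c(1) obtain i where "i \<in> {1..j}" "c i \<noteq> 0" by blast
    then show ?thesis unfolding ng by (intro sum_pos2[of _ i]) auto
  qed
  ultimately show ?thesis by simp
qed

text \<open>Expand g in the complete system and let the partial sums converge, boundedness of Q
  giving continuity. Nonnegativity of \<open>t j\<close> is used because Bessel bounds the partial
  sums of squared coefficients from above only.\<close>

lemma quadratic_form_le_complete:
  fixes f :: "nat \<Rightarrow> 'a \<Rightarrow> real"
  assumes N: "finite_measure N" and Q: "symform N Q" and f: "\<And>i. i \<ge> 1 \<Longrightarrow> sqint N (f i)"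
    and on: "\<And>i k. i \<ge> 1 \<Longrightarrow> k \<ge> 1 \<Longrightarrow> ip N (f i) (f k) = (if i = k then 1 else 0)"
    and compl: "\<And>g. sqint N g \<Longrightarrow> (\<And>i. i \<ge> 1 \<Longrightarrow> ip N g (f i) = 0) \<Longrightarrow> nrm N g = 0"
    and bdd: "\<And>g h. sqint N g \<Longrightarrow> sqint N h \<Longrightarrow> \<bar>Q g h\<bar> \<le> B * (nrm N g * nrm N h)"
    and eig: "\<And>i g. i \<ge> 1 \<Longrightarrow> sqint N g \<Longrightarrow> Q (f i) g = t i * ip N (f i) g"
    and t: "\<And>i. i \<ge> j \<Longrightarrow> t i \<le> t j" "0 \<le> t j" and j: "1 \<le> j"
    and g: "sqint N g" and perp: "\<And>k. k \<in> {1..<j} \<Longrightarrow> ip N g (f k) = 0"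
  shows "Q g g \<le> t j * (nrm N g)\<^sup>2"
proof -
  obtain h where h: "sqint N h" "(\<lambda>n. nrm N (\<lambda>x. (\<Sum>i=1..n. ip N g (f i) * f i x) - h x)) \<longlonglongrightarrow> 0"
    "\<And>i. i \<ge> 1 \<Longrightarrow> ip N h (f i) = ip N g (f i)"
    using orthonormal_projection[OF N f on g, of 1] by auto
  define S where "S n x = (\<Sum>i=1..n. ip N g (f i) * f i x)" for n x
  have S: "sqint N (S n)" for n
    unfolding S_def[abs_def] by (intro sqint_sum sqint_cmult f) auto
  \<comment> \<open>The limit h has the same coefficients as g, so completeness forces h = g up to a
    null set.\<close>
  have hg: "nrm N (\<lambda>x. h x - g x) = 0"
    by (rule compl) (use h g f in \<open>auto simp: sqint_diff ip_diff_left\<close>)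
  have lim0: "(\<lambda>n. nrm N (\<lambda>x. S n x - g x)) \<longlonglongrightarrow> 0"
  proof (rule Lim_null_comparison)
    show "(\<lambda>n. nrm N (\<lambda>x. S n x - h x)) \<longlonglongrightarrow> 0" using h(2) by (simp add: S_def)
    have "nrm N (\<lambda>x. S n x - g x) \<le> nrm N (\<lambda>x. S n x - h x)" for n
      using nrm_triangle[OF sqint_diff[OF S[of n] h(1)] sqint_diff[OF h(1) g]] hg by simp
    then show "eventually (\<lambda>n. norm (nrm N (\<lambda>x. S n x - g x)) \<le> nrm N (\<lambda>x. S n x - h x)) sequentially"
      by (simp add: nrm_nonneg)
  qed
  \<comment> \<open>Only the first argument is expanded: the eigenvalue equation then turns each
    term into a squared coefficient.\<close>
  have "(\<lambda>n. Q (S n) g) \<longlonglongrightarrow> Q g g"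
  proof (rule LIM_zero_cancel, rule Lim_null_comparison)
    show "eventually (\<lambda>n. norm (Q (S n) g - Q g g) \<le> B * (nrm N (\<lambda>x. S n x - g x) * nrm N g)) sequentially"
      using bdd[OF sqint_diff[OF S g] g] by (simp add: symform_diff[OF Q S g g])
    show "(\<lambda>n. B * (nrm N (\<lambda>x. S n x - g x) * nrm N g)) \<longlonglongrightarrow> 0"
      by (intro tendsto_mult_right_zero tendsto_mult_left_zero lim0)
  qed
  moreover have "Q (S n) g \<le> t j * (nrm N g)\<^sup>2" for n
  proof -
    have "Q (S n) g = (\<Sum>i=1..n. ip N g (f i) * Q (f i) g)"
      unfolding S_def[abs_def] by (rule symform_lincomb[OF Q _ g]) (use f in auto)
    also have "\<dots> = (\<Sum>i=1..n. t i * (ip N g (f i))\<^sup>2)"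
      using g by (intro sum.cong) (auto simp: eig ip_commute[of N _ g] power2_eq_square)
    also have "\<dots> \<le> (\<Sum>i=1..n. t j * (ip N g (f i))\<^sup>2)"
    proof (rule sum_mono)
      fix i assume "i \<in> {1..n}"
      then show "t i * (ip N g (f i))\<^sup>2 \<le> t j * (ip N g (f i))\<^sup>2"
        using perp[of i] t(1)[of i] by (cases "i < j") (auto intro: mult_right_mono)
    qed
    also have "\<dots> = t j * (\<Sum>i=1..n. (ip N g (f i))\<^sup>2)" by (simp add: sum_distrib_left)
    also have "\<dots> \<le> t j * (nrm N g)\<^sup>2"
      by (intro mult_left_mono t(2) Bessel) (use f on g in auto)
    finally show ?thesis .
  qed
  ultimately show ?thesis by (intro LIMSEQ_le_const2) auto
qed

text \<open>The estimates below only use the forms \<open>Q\<close> and \<open>R\<close> of two operators, a finite eigensystem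
  \<open>(\<theta>, \<psi>)\<close> of \<open>Q\<close> that exhausts its range, and a complete eigensystem \<open>(t, f)\<close> of \<open>R\<close>.\<close>

locale form_perturbation =
  fixes N :: "'a measure" and Q R :: "('a \<Rightarrow> real) \<Rightarrow> ('a \<Rightarrow> real) \<Rightarrow> real"
    and d :: nat and \<theta> t :: "nat \<Rightarrow> real" and \<psi> f :: "nat \<Rightarrow> 'a \<Rightarrow> real" and \<delta> B :: real
  assumes N: "finite_measure N" and Q: "symform N Q" and R: "symform N R"
    and psi: "\<And>i. i \<in> {1..d} \<Longrightarrow> sqint N (\<psi> i)"
    and psi_on: "\<And>i k. i \<in> {1..d} \<Longrightarrow> k \<in> {1..d} \<Longrightarrow> ip N (\<psi> i) (\<psi> k) = (if i = k then 1 else 0)"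
    and psi_eig: "\<And>i g. i \<in> {1..d} \<Longrightarrow> sqint N g \<Longrightarrow> Q (\<psi> i) g = \<theta> i * ip N (\<psi> i) g"
    and Q_perp: "\<And>r g. sqint N r \<Longrightarrow> sqint N g \<Longrightarrow> (\<And>i. i \<in> {1..d} \<Longrightarrow> ip N r (\<psi> i) = 0) \<Longrightarrow> Q r g = 0"
    and theta_dec: "\<And>i k. i \<in> {1..d} \<Longrightarrow> k \<in> {1..d} \<Longrightarrow> i < k \<Longrightarrow> \<theta> k < \<theta> i"
    and theta_pos: "\<And>i. i \<in> {1..d} \<Longrightarrow> 0 < \<theta> i"
    and f: "\<And>i. i \<ge> 1 \<Longrightarrow> sqint N (f i)"
    and f_on: "\<And>i k. i \<ge> 1 \<Longrightarrow> k \<ge> 1 \<Longrightarrow> ip N (f i) (f k) = (if i = k then 1 else 0)"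
    and f_compl: "\<And>g. sqint N g \<Longrightarrow> (\<And>i. i \<ge> 1 \<Longrightarrow> ip N g (f i) = 0) \<Longrightarrow> nrm N g = 0"
    and f_eig: "\<And>i g. i \<ge> 1 \<Longrightarrow> sqint N g \<Longrightarrow> R (f i) g = t i * ip N (f i) g"
    and t_dec: "\<And>i k. 1 \<le> i \<Longrightarrow> i \<le> k \<Longrightarrow> t k \<le> t i"
    and R_pos: "\<And>g. sqint N g \<Longrightarrow> 0 \<le> R g g"
    and R_bdd: "\<And>g h. sqint N g \<Longrightarrow> sqint N h \<Longrightarrow> \<bar>R g h\<bar> \<le> B * (nrm N g * nrm N h)"
    and close: "\<And>g h. sqint N g \<Longrightarrow> sqint N h \<Longrightarrow> \<bar>R g h - Q g h\<bar> \<le> \<delta> * (nrm N g * nrm N h)"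
begin

lemma t_nonneg: "i \<ge> 1 \<Longrightarrow> 0 \<le> t i"
  using R_pos[OF f, of i] f_eig[OF _ f, of i i] f_on[of i i] by simp

lemma nrm_f: "i \<ge> 1 \<Longrightarrow> nrm N (f i) = 1"
  using f_on[of i i] by (simp add: nrm_def)

lemma nrm_psi: "i \<in> {1..d} \<Longrightarrow> nrm N (\<psi> i) = 1"
  using psi_on[of i i] by (simp add: nrm_def)

lemma theta_mono: "i \<in> {1..d} \<Longrightarrow> k \<in> {1..d} \<Longrightarrow> i \<le> k \<Longrightarrow> \<theta> k \<le> \<theta> i"
  using theta_dec[of i k] by (cases "i = k") auto

definition res :: "('a \<Rightarrow> real) \<Rightarrow> 'a \<Rightarrow> real" where
  "res g x = g x - (\<Sum>i=1..d. ip N g (\<psi> i) * \<psi> i x)"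

lemma sqint_res: "sqint N g \<Longrightarrow> sqint N (res g)"
  unfolding res_def[abs_def] by (intro sqint_diff sqint_sum sqint_cmult psi)

lemma ip_res: "sqint N g \<Longrightarrow> k \<in> {1..d} \<Longrightarrow> ip N (res g) (\<psi> k) = 0"
  unfolding res_def[abs_def] by (rule ip_residual) (use psi psi_on in auto)

lemma nrm_res: "sqint N g \<Longrightarrow> (nrm N (res g))\<^sup>2 = (nrm N g)\<^sup>2 - (\<Sum>i=1..d. (ip N g (\<psi> i))\<^sup>2)"
  unfolding res_def[abs_def] by (rule nrm_sq_residual) (use psi psi_on in auto)

lemma Q_res: "sqint N g \<Longrightarrow> sqint N h \<Longrightarrow> Q (res g) h = 0"
  by (rule Q_perp[OF sqint_res]) (auto simp: ip_res)

text \<open>The finite counterpart of \<open>quadratic_form_le_complete\<close>: Q does not see the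
  residual, so a finite expansion is exact and no limit arises.\<close>

lemma Q_quadratic_le:
  assumes j: "j \<in> {1..d}" and g: "sqint N g" and perp: "\<And>k. k \<in> {1..<j} \<Longrightarrow> ip N g (\<psi> k) = 0"
  shows "Q g g \<le> \<theta> j * (nrm N g)\<^sup>2"
proof -
  have "Q g g = Q (\<lambda>x. \<Sum>i=1..d. ip N g (\<psi> i) * \<psi> i x) g"
    using symform_diff[OF Q g sqint_res[OF g] g] Q_res[OF g g] by (simp add: res_def)
  also have "\<dots> = (\<Sum>i=1..d. ip N g (\<psi> i) * Q (\<psi> i) g)"
    by (rule symform_lincomb[OF Q psi g])
  also have "\<dots> = (\<Sum>i=1..d. \<theta> i * (ip N g (\<psi> i))\<^sup>2)"
    using g by (intro sum.cong) (auto simp: psi_eig ip_commute[of N _ g] power2_eq_square)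
  also have "\<dots> \<le> (\<Sum>i=1..d. \<theta> j * (ip N g (\<psi> i))\<^sup>2)"
  proof (rule sum_mono)
    fix i assume "i \<in> {1..d}"
    then show "\<theta> i * (ip N g (\<psi> i))\<^sup>2 \<le> \<theta> j * (ip N g (\<psi> i))\<^sup>2"
      using perp[of i] theta_mono[of j i] j by (cases "i < j") (auto intro: mult_right_mono)
  qed
  also have "\<dots> = \<theta> j * (\<Sum>i=1..d. (ip N g (\<psi> i))\<^sup>2)" by (simp add: sum_distrib_left)
  also have "\<dots> \<le> \<theta> j * (nrm N g)\<^sup>2"
    by (intro mult_left_mono Bessel) (use psi psi_on g theta_pos[OF j] in auto)
  finally show ?thesis .
qed

text \<open>Weyl's inequality, by two uses of \<open>Courant_Fischer_le\<close> with the
  eigensystems exchanged. The upper bounds come from \<open>Q_quadratic_le\<close> on one side and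
  from completeness of \<open>f\<close> on the other.\<close>

lemma eigenvalue_close:
  assumes j: "j \<in> {1..d}" shows "\<bar>t j - \<theta> j\<bar> \<le> \<delta>"
proof -
  have "t j \<le> \<theta> j + \<delta>"
  proof (rule Courant_Fischer_le[OF R, where f = f and h = \<psi>])
    fix g assume g: "sqint N g" and perp: "\<And>k. k \<in> {1..<j} \<Longrightarrow> ip N g (\<psi> k) = 0"
    have "R g g \<le> Q g g + \<delta> * (nrm N g)\<^sup>2"
      using close[OF g g] by (simp add: power2_eq_square)
    then show "R g g \<le> (\<theta> j + \<delta>) * (nrm N g)\<^sup>2"
      using Q_quadratic_le[OF j g perp] by (simp add: distrib_right)
  qed (use j f f_on f_eig t_dec psi in auto)
  moreover have "\<theta> j \<le> t j + \<delta>"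
  proof (rule Courant_Fischer_le[OF Q, where f = \<psi> and h = f])
    fix g assume g: "sqint N g" and perp: "\<And>k. k \<in> {1..<j} \<Longrightarrow> ip N g (f k) = 0"
    have "Q g g \<le> R g g + \<delta> * (nrm N g)\<^sup>2"
      using close[OF g g] by (simp add: power2_eq_square)
    moreover have "R g g \<le> t j * (nrm N g)\<^sup>2"
      by (rule quadratic_form_le_complete[OF N R f f_on f_compl R_bdd f_eig])
        (use j g perp t_dec t_nonneg[of j] in auto)
    ultimately show "Q g g \<le> (t j + \<delta>) * (nrm N g)\<^sup>2"
      by (simp add: distrib_right)
  qed (use j f psi psi_on psi_eig theta_mono in auto)
  ultimately show ?thesis by linarith
qed

text \<open>The bound \<open>s\<close> is left open: taking it from \<open>close\<close> would give
  \<delta>, whereas a second-order estimate on the orthogonal complement of the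
  \<open>\<psi> i\<close> gives the faster rate.\<close>

lemma eigenvalue_tail_le:
  assumes s: "\<And>g. sqint N g \<Longrightarrow> (\<And>k. k \<in> {1..d} \<Longrightarrow> ip N g (\<psi> k) = 0) \<Longrightarrow> R g g \<le> s * (nrm N g)\<^sup>2"
    and j: "j \<ge> d + 1"
  shows "t j \<le> s"
proof -
  have "t (d + 1) \<le> s"
  proof (rule Courant_Fischer_le[OF R, where f = f and h = \<psi>])
    fix g assume g: "sqint N g" and perp: "\<And>k. k \<in> {1..<d + 1} \<Longrightarrow> ip N g (\<psi> k) = 0"
    show "R g g \<le> s * (nrm N g)\<^sup>2" by (rule s[OF g]) (use perp in auto)
  qed (use j f f_on f_eig t_dec psi in auto)
  then show ?thesis using t_dec[of "d + 1" j] j by simp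
qed

text \<open>The difference of the forms at the pair (\<open>f j\<close>, \<open>\<psi> i\<close>) is
  the eigenvalue difference times the coefficient. The product form remains meaningful when the
  eigenvalues coincide.\<close>

lemma coefficient_bound:
  assumes i: "i \<in> {1..d}" and j: "j \<ge> 1"
  shows "\<bar>\<theta> i - t j\<bar> * \<bar>ip N (f j) (\<psi> i)\<bar> \<le> \<delta>"
proof -
  have fj: "sqint N (f j)" using f j by simp
  have "R (f j) (\<psi> i) - Q (f j) (\<psi> i) = (t j - \<theta> i) * ip N (f j) (\<psi> i)"
    using f_eig[OF j psi[OF i]] psi_eig[OF i fj] symform_sym[OF Q fj psi[OF i]]
    by (simp add: ip_commute[of N "\<psi> i"] left_diff_distrib)
  then have "\<bar>t j - \<theta> i\<bar> * \<bar>ip N (f j) (\<psi> i)\<bar> \<le> \<delta>"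
    using close[OF fj psi[OF i]] nrm_f[OF j] nrm_psi[OF i] by (simp add: abs_mult)
  then show ?thesis by (simp add: abs_minus_commute)
qed

text \<open>A coefficient c satisfies \<theta> c \<le> \<delta> + t c and is at most 1, so t c is
  absorbed as t. Division is by \<open>\<theta> i\<close> alone, and no separation of
  \<open>t j\<close> from \<open>\<theta> i\<close> is required.\<close>

lemma tail_projection_bound:
  assumes j: "j \<ge> 1"
  shows "nrm N (\<lambda>x. \<Sum>i=1..d. ip N (\<psi> i) (f j) * \<psi> i x) \<le> (\<delta> + t j) * (\<Sum>i=1..d. 1 / \<theta> i)"
proof -
  have fj: "sqint N (f j)" using f j by simp
  have "nrm N (\<lambda>x. \<Sum>i=1..d. ip N (\<psi> i) (f j) * \<psi> i x) \<le> (\<Sum>i=1..d. nrm N (\<lambda>x. ip N (\<psi> i) (f j) * \<psi> i x))"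
    by (rule nrm_sum_le) (intro sqint_cmult psi)
  also have "\<dots> = (\<Sum>i=1..d. \<bar>ip N (f j) (\<psi> i)\<bar>)"
    by (intro sum.cong) (auto simp: nrm_cmult nrm_psi ip_commute)
  also have "\<dots> \<le> (\<Sum>i=1..d. (\<delta> + t j) * (1 / \<theta> i))"
  proof (rule sum_mono)
    fix i assume i: "i \<in> {1..d}"
    define c where "c = \<bar>ip N (f j) (\<psi> i)\<bar>"
    have c1: "c \<le> 1"
      unfolding c_def using ip_Cauchy_Schwarz[OF fj psi[OF i]] nrm_f[OF j] nrm_psi[OF i] by simp
    have "(\<theta> i - t j) * c \<le> \<bar>\<theta> i - t j\<bar> * c" by (intro mult_right_mono) (auto simp: c_def)
    also have "\<dots> \<le> \<delta>" using coefficient_bound[OF i j] by (simp add: c_def)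
    finally have "\<theta> i * c \<le> \<delta> + t j * c" by (simp add: algebra_simps)
    also have "\<dots> \<le> \<delta> + t j" using c1 t_nonneg[OF j] by (simp add: mult_left_le)
    finally show "\<bar>ip N (f j) (\<psi> i)\<bar> \<le> (\<delta> + t j) * (1 / \<theta> i)"
      using theta_pos[OF i] by (simp add: c_def field_simps)
  qed
  finally show ?thesis by (simp add: sum_distrib_left)
qed

text \<open>\<open>f j\<close> is nearly a multiple of \<open>\<psi> j\<close>: its coefficients
  along the other \<open>\<psi> i\<close> and its residual are each at most 2 \<delta> / \<gamma>.
  The condition \<gamma> \<le> \<open>\<theta> j\<close> is the gap to the eigenvalue 0 on the
  complement. The sign of the coefficient along \<open>\<psi> j\<close> decides which entry of the
  minimum is small.\<close>

lemma eigenfunction_close: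
  assumes j: "j \<in> {1..d}" and gap: "0 < \<gamma>" "\<gamma> \<le> \<theta> j" "\<And>i. i \<in> {1..d} \<Longrightarrow> i \<noteq> j \<Longrightarrow> \<gamma> \<le> \<bar>\<theta> i - \<theta> j\<bar>"
  shows "min (nrm N (\<lambda>x. f j x - \<psi> j x)) (nrm N (\<lambda>x. f j x + \<psi> j x)) \<le> (4 * (real d + 1) / \<gamma>) * \<delta>"
proof -
  have j1: "j \<ge> 1" and fj: "sqint N (f j)" and pj: "sqint N (\<psi> j)" using j f psi by auto
  define m where "m = min (nrm N (\<lambda>x. f j x - \<psi> j x)) (nrm N (\<lambda>x. f j x + \<psi> j x))"
  have d0: "0 \<le> \<delta>" using eigenvalue_close[OF j] by linarith
  show ?thesis
  proof (cases "\<delta> \<le> \<gamma> / 2")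
    \<comment> \<open>For large \<delta> the trivial bound 2 for unit vectors already lies below 4
      \<delta> / \<gamma>. In the other case \<open>t j\<close> stays within half a gap of
      \<open>\<theta> j\<close>, which is the source of the factor 2 in 2 \<delta> /
      \<gamma>.\<close>
    case False
    have "m \<le> 2"
      using nrm_triangle[OF fj pj] nrm_f[OF j1] nrm_psi[OF j] by (simp add: m_def)
    also have "2 \<le> (4 / \<gamma>) * \<delta>" using False gap(1) by (simp add: field_simps)
    also have "\<dots> \<le> (4 * (real d + 1) / \<gamma>) * \<delta>"
      using d0 gap(1) by (intro mult_right_mono divide_right_mono) auto
    finally show ?thesis by (simp add: m_def)
  next
    case True
    define c where "c i = ip N (f j) (\<psi> i)" for i
    have tj: "\<gamma> / 2 \<le> t j" using eigenvalue_close[OF j] gap(2) True by linarith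
    have ci: "\<bar>c i\<bar> \<le> 2 * \<delta> / \<gamma>" if i: "i \<in> {1..d}" "i \<noteq> j" for i
    proof -
      have "\<gamma> / 2 \<le> \<bar>\<theta> i - t j\<bar>" using gap(3)[OF i] eigenvalue_close[OF j] True by linarith
      then have "\<gamma> / 2 * \<bar>c i\<bar> \<le> \<delta>"
        using coefficient_bound[OF i(1) j1] mult_right_mono[of "\<gamma>/2" "\<bar>\<theta> i - t j\<bar>" "\<bar>c i\<bar>"]
        by (simp add: c_def)
      then show ?thesis using gap(1) by (simp add: field_simps)
    qed
    define r where "r = res (f j)"
    have r: "sqint N r" unfolding r_def by (rule sqint_res[OF fj])
    have rn: "nrm N r \<le> 2 * \<delta> / \<gamma>"
    proof -
      have "ip N (f j) r = (nrm N r)\<^sup>2"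
      proof -
        have "ip N (\<lambda>x. \<Sum>i=1..d. c i * \<psi> i x) r = (\<Sum>i=1..d. c i * ip N r (\<psi> i))"
          using r psi by (subst ip_sum_left) (auto simp: sqint_cmult ip_cmult_left ip_commute[of N r])
        then have "ip N (\<lambda>x. \<Sum>i=1..d. c i * \<psi> i x) r = 0"
          using ip_res[OF fj] by (simp add: r_def)
        moreover have "ip N r r = ip N (f j) r - ip N (\<lambda>x. \<Sum>i=1..d. c i * \<psi> i x) r"
          unfolding r_def res_def[abs_def] c_def
          by (rule ip_diff_left[OF fj]) (use r psi in \<open>auto simp: r_def res_def[abs_def] intro!: sqint_sum sqint_cmult\<close>)
        ultimately show ?thesis by (simp add: nrm_sq)
      qed
      \<comment> \<open>The residual acts as an eigenvector of Q for the eigenvalue 0: since Q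
        vanishes on it, this is the gap argument again, with gap \<open>t j\<close>.\<close>
      then have "t j * (nrm N r)\<^sup>2 = R (f j) r" using f_eig[OF j1 r] by simp
      also have "\<dots> = R (f j) r - Q (f j) r"
        using symform_sym[OF Q fj r] Q_res[OF fj fj] by (simp add: r_def)
      also have "\<dots> \<le> \<delta> * nrm N r" using close[OF fj r] nrm_f[OF j1] by simp
      finally have "t j * (nrm N r)\<^sup>2 \<le> \<delta> * nrm N r" .
      then have "t j * nrm N r * nrm N r \<le> \<delta> * nrm N r"
        by (simp add: power2_eq_square mult.assoc)
      then have "t j * nrm N r \<le> \<delta>"
        using nrm_nonneg[of N r] d0 by (cases "nrm N r = 0") auto
      moreover have "\<gamma> / 2 * nrm N r \<le> t j * nrm N r"
        by (rule mult_right_mono[OF tj nrm_nonneg])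
      ultimately show ?thesis using gap(1) by (simp add: field_simps)
    qed
    \<comment> \<open>Pythagoras for the unit vector \<open>f j\<close>: d - 1 other coefficients
      and one residual make up the missing mass.\<close>
    have "1 - (c j)\<^sup>2 = (\<Sum>i\<in>{1..d} - {j}. (c i)\<^sup>2) + (nrm N r)\<^sup>2"
      using nrm_res[OF fj] nrm_f[OF j1] sum.remove[of "{1..d}" j "\<lambda>i. (c i)\<^sup>2"] j
      by (simp add: r_def c_def)
    also have "\<dots> \<le> (\<Sum>i\<in>{1..d} - {j}. (2 * \<delta> / \<gamma>)\<^sup>2) + (2 * \<delta> / \<gamma>)\<^sup>2"
    proof (intro add_mono sum_mono)
      fix i assume "i \<in> {1..d} - {j}"
      then have "\<bar>c i\<bar>\<^sup>2 \<le> (2 * \<delta> / \<gamma>)\<^sup>2" using ci[of i] by (intro power_mono) auto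
      then show "(c i)\<^sup>2 \<le> (2 * \<delta> / \<gamma>)\<^sup>2" by simp
    qed (rule power_mono[OF rn nrm_nonneg])
    also have "\<dots> \<le> (real d + 1) * (2 * \<delta> / \<gamma>)\<^sup>2"
      using j by (simp add: algebra_simps)
    finally have c1: "1 - (c j)\<^sup>2 \<le> (real d + 1) * (2 * \<delta> / \<gamma>)\<^sup>2" .
    have cj: "\<bar>c j\<bar> \<le> 1"
      unfolding c_def using ip_Cauchy_Schwarz[OF fj pj] nrm_f[OF j1] nrm_psi[OF j] by simp
    have m2: "m\<^sup>2 \<le> 2 - 2 * \<bar>c j\<bar>"
    proof (cases "c j \<ge> 0")
      case True
      have "m\<^sup>2 \<le> (nrm N (\<lambda>x. f j x - \<psi> j x))\<^sup>2" by (rule power_mono) (auto simp: m_def nrm_nonneg)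
      then show ?thesis using True by (simp add: nrm_sq_diff fj pj nrm_f[OF j1] nrm_psi[OF j] c_def)
    next
      case False
      have "m\<^sup>2 \<le> (nrm N (\<lambda>x. f j x + \<psi> j x))\<^sup>2" by (rule power_mono) (auto simp: m_def nrm_nonneg)
      then show ?thesis using False by (simp add: nrm_sq_add fj pj nrm_f[OF j1] nrm_psi[OF j] c_def)
    qed
    \<comment> \<open>As \<open>\<bar>c j\<bar>\<close> is at most 1, it dominates its
      square.\<close>
    also have "\<dots> \<le> 2 * (1 - (c j)\<^sup>2)"
      using cj mult_left_le[of "\<bar>c j\<bar>" "\<bar>c j\<bar>"] by (simp add: power2_eq_square)
    also have "\<dots> \<le> 2 * ((real d + 1) * (2 * \<delta> / \<gamma>)\<^sup>2)" using c1 by simp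
    also have "\<dots> = (real d + 1) * 2 * (2 * \<delta> / \<gamma>)\<^sup>2" by simp
    \<comment> \<open>Since 2 (d + 1) is at least 1, enlarging it to its square makes the right side
      a perfect square and yields the constant 4 (d + 1) / \<gamma>.\<close>
    also have "\<dots> \<le> (2 * (real d + 1))\<^sup>2 * (2 * \<delta> / \<gamma>)\<^sup>2"
    proof (rule mult_right_mono)
      show "(real d + 1) * 2 \<le> (2 * (real d + 1))\<^sup>2" by (simp add: power2_eq_square algebra_simps)
    qed simp
    also have "\<dots> = (2 * (real d + 1) * (2 * \<delta> / \<gamma>))\<^sup>2" by (rule power_mult_distrib[symmetric])
    also have "2 * (real d + 1) * (2 * \<delta> / \<gamma>) = 4 * (real d + 1) / \<gamma> * \<delta>" by (simp add: field_simps)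
    finally have "m \<le> 4 * (real d + 1) / \<gamma> * \<delta>"
      by (rule power2_le_imp_le) (use d0 gap(1) in simp)
    then show ?thesis by (simp add: m_def)
  qed
qed

end

section \<open>Stochastic order calculus\<close>

text \<open>The definition of \<open>bigOp\<close> allows a negative constant; enlarging it to a
  nonnegative one keeps the event small because the rate is nonnegative, and constants can then be
  multiplied.\<close>

lemma bigOpE:
  assumes "bigOp M Z r" "0 < \<epsilon>" and r: "\<And>n. 0 \<le> r n"
  obtains C m where "0 \<le> C"
    "\<And>n. n \<ge> m \<Longrightarrow> \<exists>A\<in>sets M. {\<omega>\<in>space M. \<bar>Z n \<omega>\<bar> > C * r n} \<subseteq> A \<and> measure M A < \<epsilon>"
proof -
  obtain C m where C: "\<And>n. n \<ge> m \<Longrightarrow> \<exists>A\<in>sets M. {\<omega>\<in>space M. \<bar>Z n \<omega>\<bar> > C * r n} \<subseteq> A \<and> measure M A < \<epsilon>"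
    using assms(1)[unfolded bigOp_def, rule_format, OF assms(2)] by blast
  obtain K where K: "C \<le> K" "0 \<le> K" using max.cobounded1[of C 0] max.cobounded2[of 0 C] by blast
  have sub: "{\<omega>\<in>space M. \<bar>Z n \<omega>\<bar> > K * r n} \<subseteq> {\<omega>\<in>space M. \<bar>Z n \<omega>\<bar> > C * r n}" for n
    using le_less_trans[OF mult_right_mono[OF K(1) r[of n]]] by blast
  have "\<exists>A\<in>sets M. {\<omega>\<in>space M. \<bar>Z n \<omega>\<bar> > K * r n} \<subseteq> A \<and> measure M A < \<epsilon>" if "n \<ge> m" for n
    using C[OF that] subset_trans[OF sub] by blast
  then show ?thesis by (rule that[OF K(2)])
qed

context prob_space
begin

text \<open>One null set serves all n and is added to the covering event, so Z may be
  non-measurable. The bound is asked for n > p only, where the estimators divide by a positive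
  number.\<close>

lemma bigOp_mono:
  assumes W: "bigOp M W r" and le: "AE \<omega> in M. \<forall>n>p. \<bar>Z n \<omega>\<bar> \<le> \<bar>W n \<omega>\<bar>"
  shows "bigOp M Z r"
  unfolding bigOp_def
proof (intro allI impI)
  fix \<epsilon> :: real assume "\<epsilon> > 0"
  from W[unfolded bigOp_def, rule_format, OF this]
  obtain C m where C: "\<And>n. n \<ge> m \<Longrightarrow> \<exists>A\<in>sets M. {\<omega>\<in>space M. \<bar>W n \<omega>\<bar> > C * r n} \<subseteq> A \<and> measure M A < \<epsilon>"
    by blast
  obtain B where B: "B \<in> null_sets M" "{\<omega>\<in>space M. \<not> (\<forall>n>p. \<bar>Z n \<omega>\<bar> \<le> \<bar>W n \<omega>\<bar>)} \<subseteq> B"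
    using le by (auto simp: eventually_ae_filter)
  show "\<exists>C m. \<forall>n\<ge>m. \<exists>A\<in>sets M. {\<omega>\<in>space M. \<bar>Z n \<omega>\<bar> > C * r n} \<subseteq> A \<and> measure M A < \<epsilon>"
  proof (intro exI[of _ C] exI[of _ "max m (Suc p)"] allI impI)
    fix n assume n: "n \<ge> max m (Suc p)"
    then obtain A where A: "A \<in> sets M" "{\<omega>\<in>space M. \<bar>W n \<omega>\<bar> > C * r n} \<subseteq> A" "measure M A < \<epsilon>"
      using C[of n] by auto
    have "{\<omega>\<in>space M. \<bar>Z n \<omega>\<bar> > C * r n} \<subseteq> A \<union> B"
    proof
      fix \<omega> assume w: "\<omega> \<in> {\<omega>\<in>space M. \<bar>Z n \<omega>\<bar> > C * r n}"
      show "\<omega> \<in> A \<union> B"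
      proof (cases "\<omega> \<in> B")
        case False
        then have "\<forall>n>p. \<bar>Z n \<omega>\<bar> \<le> \<bar>W n \<omega>\<bar>" using B(2) w by blast
        then have "\<bar>Z n \<omega>\<bar> \<le> \<bar>W n \<omega>\<bar>" using n by simp
        then show ?thesis using w A(2) by auto
      qed simp
    qed
    moreover have "measure M (A \<union> B) < \<epsilon>" "A \<union> B \<in> sets M"
      using A B by (auto simp: measure_Un_null_set)
    ultimately show "\<exists>A\<in>sets M. {\<omega>\<in>space M. \<bar>Z n \<omega>\<bar> > C * r n} \<subseteq> A \<and> measure M A < \<epsilon>" by blast
  qed
qed

lemma bigOp_rate:
  assumes Z: "bigOp M Z r" and r: "\<And>n. 0 \<le> r n" "\<And>n. r n \<le> r' n"
  shows "bigOp M Z r'"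
  unfolding bigOp_def
proof (intro allI impI)
  fix \<epsilon> :: real assume "\<epsilon> > 0"
  then obtain C m where C: "0 \<le> C"
    "\<And>n. n \<ge> m \<Longrightarrow> \<exists>A\<in>sets M. {\<omega>\<in>space M. \<bar>Z n \<omega>\<bar> > C * r n} \<subseteq> A \<and> measure M A < \<epsilon>"
    by (rule bigOpE[OF Z _ r(1)]) blast
  have sub: "{\<omega>\<in>space M. \<bar>Z n \<omega>\<bar> > C * r' n} \<subseteq> {\<omega>\<in>space M. \<bar>Z n \<omega>\<bar> > C * r n}" for n
    using le_less_trans[OF mult_left_mono[OF r(2)[of n] C(1)]] by blast
  have "\<exists>A\<in>sets M. {\<omega>\<in>space M. \<bar>Z n \<omega>\<bar> > C * r' n} \<subseteq> A \<and> measure M A < \<epsilon>" if "n \<ge> m" for n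
    using C(2)[OF that] subset_trans[OF sub] by blast
  then show "\<exists>C m. \<forall>n\<ge>m. \<exists>A\<in>sets M. {\<omega>\<in>space M. \<bar>Z n \<omega>\<bar> > C * r' n} \<subseteq> A \<and> measure M A < \<epsilon>"
    by blast
qed

text \<open>Each of the two events gets half of \<epsilon>; off their union the implication
  \<open>step\<close> is deterministic, with \<open>K\<close> computing the new constant. Sums,
  products and multiples are instances.\<close>

lemma bigOp_combine:
  assumes Z: "bigOp M Z r" and W: "bigOp M W s" and r: "\<And>n. 0 \<le> r n" and s: "\<And>n. 0 \<le> s n"
    and step: "\<And>C D n \<omega>. 0 \<le> C \<Longrightarrow> 0 \<le> D \<Longrightarrow> \<bar>Z n \<omega>\<bar> \<le> C * r n \<Longrightarrow> \<bar>W n \<omega>\<bar> \<le> D * s n \<Longrightarrow> \<bar>V n \<omega>\<bar> \<le> K C D * q n"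
  shows "bigOp M V q"
  unfolding bigOp_def
proof (intro allI impI)
  fix \<epsilon> :: real assume e: "\<epsilon> > 0"
  then have e2: "\<epsilon> / 2 > 0" by simp
  obtain C m where C: "0 \<le> C"
    "\<And>n. n \<ge> m \<Longrightarrow> \<exists>A\<in>sets M. {\<omega>\<in>space M. \<bar>Z n \<omega>\<bar> > C * r n} \<subseteq> A \<and> measure M A < \<epsilon> / 2"
    by (rule bigOpE[OF Z e2 r]) blast
  obtain D m' where D: "0 \<le> D"
    "\<And>n. n \<ge> m' \<Longrightarrow> \<exists>A\<in>sets M. {\<omega>\<in>space M. \<bar>W n \<omega>\<bar> > D * s n} \<subseteq> A \<and> measure M A < \<epsilon> / 2"
    by (rule bigOpE[OF W e2 s]) blast
  show "\<exists>C m. \<forall>n\<ge>m. \<exists>A\<in>sets M. {\<omega>\<in>space M. \<bar>V n \<omega>\<bar> > C * q n} \<subseteq> A \<and> measure M A < \<epsilon>"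
  proof (intro exI[of _ "K C D"] exI[of _ "max m m'"] allI impI)
    fix n assume n: "n \<ge> max m m'"
    obtain A where A: "A \<in> sets M" "{\<omega>\<in>space M. \<bar>Z n \<omega>\<bar> > C * r n} \<subseteq> A" "measure M A < \<epsilon> / 2"
      using C(2)[of n] n by auto
    obtain B where B: "B \<in> sets M" "{\<omega>\<in>space M. \<bar>W n \<omega>\<bar> > D * s n} \<subseteq> B" "measure M B < \<epsilon> / 2"
      using D(2)[of n] n by auto
    have "{\<omega>\<in>space M. \<bar>V n \<omega>\<bar> > K C D * q n} \<subseteq> A \<union> B"
    proof
      fix \<omega> assume w: "\<omega> \<in> {\<omega>\<in>space M. \<bar>V n \<omega>\<bar> > K C D * q n}"
      then have "\<not> (\<bar>Z n \<omega>\<bar> \<le> C * r n \<and> \<bar>W n \<omega>\<bar> \<le> D * s n)"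
        using step[OF C(1) D(1), of n \<omega>] by auto
      then show "\<omega> \<in> A \<union> B" using A(2) B(2) w by (auto simp: not_le)
    qed
    moreover have "measure M (A \<union> B) < \<epsilon>"
      using measure_Un_le[OF A(1) B(1)] A(3) B(3) by linarith
    ultimately show "\<exists>A\<in>sets M. {\<omega>\<in>space M. \<bar>V n \<omega>\<bar> > K C D * q n} \<subseteq> A \<and> measure M A < \<epsilon>"
      using A(1) B(1) by blast
  qed
qed

lemma bigOp_add:
  assumes "bigOp M Z r" "bigOp M W r" and r: "\<And>n. 0 \<le> r n"
  shows "bigOp M (\<lambda>n \<omega>. Z n \<omega> + W n \<omega>) r"
proof (rule bigOp_combine[OF assms(1,2) r r, where K = "\<lambda>C D. C + D"])
  fix C D n \<omega> assume "\<bar>Z n \<omega>\<bar> \<le> C * r n" "\<bar>W n \<omega>\<bar> \<le> D * r n"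
  then show "\<bar>Z n \<omega> + W n \<omega>\<bar> \<le> (C + D) * r n" by (simp add: distrib_right)
qed

lemma bigOp_mult:
  assumes "bigOp M Z r" "bigOp M W s" and r: "\<And>n. 0 \<le> r n" and s: "\<And>n. 0 \<le> s n"
  shows "bigOp M (\<lambda>n \<omega>. Z n \<omega> * W n \<omega>) (\<lambda>n. r n * s n)"
proof (rule bigOp_combine[OF assms(1,2) r s, where K = "\<lambda>C D. C * D"])
  fix C D n \<omega> assume "0 \<le> C" "\<bar>Z n \<omega>\<bar> \<le> C * r n" "\<bar>W n \<omega>\<bar> \<le> D * s n"
  then have "\<bar>Z n \<omega>\<bar> * \<bar>W n \<omega>\<bar> \<le> (C * r n) * (D * s n)"
    by (intro mult_mono) (use r in auto)
  then show "\<bar>Z n \<omega> * W n \<omega>\<bar> \<le> (C * D) * (r n * s n)" by (simp add: abs_mult mult_ac)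
qed

lemma bigOp_cmult:
  assumes "bigOp M Z r" and r: "\<And>n. 0 \<le> r n"
  shows "bigOp M (\<lambda>n \<omega>. c * Z n \<omega>) r"
proof (rule bigOp_combine[OF assms(1,1) r r, where K = "\<lambda>C D. \<bar>c\<bar> * C"])
  fix C D n \<omega> assume "\<bar>Z n \<omega>\<bar> \<le> C * r n"
  then show "\<bar>c * Z n \<omega>\<bar> \<le> \<bar>c\<bar> * C * r n" by (simp add: abs_mult mult.assoc mult_left_mono)
qed

lemma bigOp_zero: "(\<And>n. 0 \<le> r n) \<Longrightarrow> bigOp M (\<lambda>n \<omega>. 0) r"
  unfolding bigOp_def by (intro allI impI exI[of _ 0] exI[of _ 0] bexI[of _ "{}"]) auto

lemma bigOp_sum:
  assumes "\<And>k. k \<in> I \<Longrightarrow> bigOp M (Z k) r" and r: "\<And>n. 0 \<le> r n"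
  shows "bigOp M (\<lambda>n \<omega>. \<Sum>k\<in>I. Z k n \<omega>) r"
  using assms(1)
proof (induction I rule: infinite_finite_induct)
  case (insert k I)
  then show ?case using bigOp_add[where Z = "Z k" and W = "\<lambda>n \<omega>. \<Sum>k\<in>I. Z k n \<omega>", OF _ _ r] by simp
qed (simp_all add: bigOp_zero r)

text \<open>Chebyshev's inequality: the second moment of the random norm is the squared norm of
  \<open>F n\<close> on the product space.\<close>

lemma bigOp_section_nrm:
  assumes N: "sigma_finite_measure N" and F: "\<And>n. sqint (M \<Otimes>\<^sub>M N) (F n)"
    and le: "\<And>n. n > p \<Longrightarrow> (nrm (M \<Otimes>\<^sub>M N) (F n))\<^sup>2 \<le> c * (r n)\<^sup>2" and r: "\<And>n. n > p \<Longrightarrow> 0 < r n"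
  shows "bigOp M (\<lambda>n \<omega>. nrm N (\<lambda>x. F n (\<omega>, x))) r"
  unfolding bigOp_def
proof (intro allI impI)
  fix \<epsilon> :: real assume e: "\<epsilon> > 0"
  \<comment> \<open>Chosen so that \<open>\<bar>c\<bar>\<close> / C^2 falls strictly below
    \<epsilon>; the added 1 also keeps C positive when c = 0.\<close>
  define C where "C = sqrt ((\<bar>c\<bar> + 1) / \<epsilon>)"
  have C2: "C\<^sup>2 = (\<bar>c\<bar> + 1) / \<epsilon>" using e by (simp add: C_def)
  have C0: "C > 0" using e by (simp add: C_def)
  show "\<exists>C m. \<forall>n\<ge>m. \<exists>A\<in>sets M. {\<omega>\<in>space M. \<bar>nrm N (\<lambda>x. F n (\<omega>, x))\<bar> > C * r n} \<subseteq> A \<and> measure M A < \<epsilon>"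
  proof (intro exI[of _ C] exI[of _ "Suc p"] allI impI)
    fix n assume n: "Suc p \<le> n"
    define D where "D \<omega> = nrm N (\<lambda>x. F n (\<omega>, x))" for \<omega>
    have S: "sqint M D" "nrm M D = nrm (M \<Otimes>\<^sub>M N) (F n)"
      using sqint_row_nrm[OF sigma_finite_measure_axioms N, of "\<lambda>\<omega> x. F n (\<omega>, x)"] F[of n]
      by (simp_all add: D_def[abs_def])
    have [measurable]: "D \<in> borel_measurable M" using S by (simp add: sqint_def)
    have rn: "r n > 0" using r n by simp
    define A where "A = {\<omega>\<in>space M. (D \<omega>)\<^sup>2 \<ge> (C * r n)\<^sup>2}"
    have "measure M A \<le> (\<integral>\<omega>. (D \<omega>)\<^sup>2 \<partial>M) / (C * r n)\<^sup>2"
      unfolding A_def by (rule integral_Markov_inequality_measure[where A = "{}"])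
        (use S C0 rn in \<open>auto simp: sqint_def\<close>)
    also have "\<dots> \<le> (\<bar>c\<bar> * (r n)\<^sup>2) / (C * r n)\<^sup>2"
    proof (rule divide_right_mono)
      have "(\<integral>\<omega>. (D \<omega>)\<^sup>2 \<partial>M) \<le> c * (r n)\<^sup>2"
        using le[of n] n S(2) by (simp add: nrm_sq_integral[symmetric])
      also have "\<dots> \<le> \<bar>c\<bar> * (r n)\<^sup>2" by (intro mult_right_mono) auto
      finally show "(\<integral>\<omega>. (D \<omega>)\<^sup>2 \<partial>M) \<le> \<bar>c\<bar> * (r n)\<^sup>2" .
    qed simp
    also have "\<dots> = \<bar>c\<bar> / C\<^sup>2" using rn by (simp add: power_mult_distrib)
    also have "\<dots> < \<epsilon>" using e by (simp add: C2 field_simps)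
    finally have "measure M A < \<epsilon>" .
    moreover have "A \<in> sets M" unfolding A_def by measurable
    moreover have "{\<omega>\<in>space M. \<bar>nrm N (\<lambda>x. F n (\<omega>, x))\<bar> > C * r n} \<subseteq> A"
    proof
      fix \<omega> assume w: "\<omega> \<in> {\<omega>\<in>space M. \<bar>nrm N (\<lambda>x. F n (\<omega>, x))\<bar> > C * r n}"
      then have "C * r n \<le> D \<omega>" by (auto simp: D_def nrm_nonneg)
      then have "(C * r n)\<^sup>2 \<le> (D \<omega>)\<^sup>2" using C0 rn by (intro power_mono) auto
      then show "\<omega> \<in> A" using w by (simp add: A_def)
    qed
    ultimately show "\<exists>A\<in>sets M. {\<omega>\<in>space M. \<bar>nrm N (\<lambda>x. F n (\<omega>, x))\<bar> > C * r n} \<subseteq> A \<and> measure M A < \<epsilon>"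
      by blast
  qed
qed

end

section \<open>Mixing and weakly dependent sums\<close>

text \<open>Two measures with densities \<open>h1\<close> and \<open>h2\<close> are compared on F,
  and the inequality passes from sets to F-measurable functions. As the densities need only be
  M-measurable, one of them can carry the factor from the other \<sigma>-algebra.\<close>

lemma nn_integral_subalgebra_mono:
  assumes F: "subalgebra M F" and [measurable]: "h1 \<in> borel_measurable M" "h2 \<in> borel_measurable M"
    and le: "\<And>A. A \<in> sets F \<Longrightarrow> (\<integral>\<^sup>+x. indicator A x * h1 x \<partial>M) \<le> (\<integral>\<^sup>+x. indicator A x * h2 x \<partial>M)"
    and f: "f \<in> borel_measurable F"
  shows "(\<integral>\<^sup>+x. f x * h1 x \<partial>M) \<le> (\<integral>\<^sup>+x. f x * h2 x \<partial>M)"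
proof -
  note FM = measurable_from_subalg[OF F]
  have sp: "space F = space M" using F by (simp add: subalgebra_def)
  show ?thesis using f
  proof (induction rule: borel_measurable_induct)
    case (cong f g)
    have "(\<integral>\<^sup>+x. f x * h x \<partial>M) = (\<integral>\<^sup>+x. g x * h x \<partial>M)" for h
      using cong(3) sp by (intro nn_integral_cong) auto
    then show ?case using cong(4) by simp
  next
    case (set A)
    then show ?case using le by simp
  next
    case (mult u c)
    have [measurable]: "u \<in> borel_measurable M" using mult FM by blast
    show ?case using mult by (simp add: mult.assoc nn_integral_cmult mult_left_mono)
  next
    case (add u v)
    have [measurable]: "u \<in> borel_measurable M" "v \<in> borel_measurable M" using add FM by blast+
    show ?case using add by (simp add: distrib_right nn_integral_add add_mono)
  next
    case (seq U)
    have [measurable]: "U i \<in> borel_measurable M" for i using seq FM by blast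
    have "(\<integral>\<^sup>+x. (SUP i. U i) x * h1 x \<partial>M) = (\<integral>\<^sup>+x. (SUP i. U i x * h1 x) \<partial>M)"
      by (simp add: SUP_mult_right_ennreal image_comp)
    also have "\<dots> = (SUP i. \<integral>\<^sup>+x. U i x * h1 x \<partial>M)"
      by (rule nn_integral_monotone_convergence_SUP)
        (use seq in \<open>auto simp: incseq_def le_fun_def intro!: mult_right_mono\<close>)
    also have "\<dots> \<le> (\<integral>\<^sup>+x. (SUP i. U i) x * h2 x \<partial>M)"
    proof (rule SUP_least)
      fix i
      have "(\<integral>\<^sup>+x. U i x * h1 x \<partial>M) \<le> (\<integral>\<^sup>+x. U i x * h2 x \<partial>M)" by (rule seq)
      also have "\<dots> \<le> (\<integral>\<^sup>+x. (SUP i. U i) x * h2 x \<partial>M)"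
        by (intro nn_integral_mono mult_right_mono) (auto intro!: SUP_upper)
      finally show "(\<integral>\<^sup>+x. U i x * h1 x \<partial>M) \<le> (\<integral>\<^sup>+x. (SUP i. U i) x * h2 x \<partial>M)" .
    qed
    finally show ?case .
  qed
qed

context prob_space
begin

context
  fixes F G :: "'a measure" and r :: real
  assumes F: "subalgebra M F" and G: "subalgebra M G" and r: "0 \<le> r"
    and mix: "\<And>A B. A \<in> sets F \<Longrightarrow> B \<in> sets G \<Longrightarrow>
      \<bar>measure M (A \<inter> B) - measure M A * measure M B\<bar> \<le> r * (measure M A * measure M B)"
begin

text \<open>Two additive one-sided inequalities avoid subtraction of extended reals. Each is lifted
  from sets to functions in one factor at a time.\<close>

lemma mixing_nn_integral:
  assumes f: "f \<in> borel_measurable F" and g: "g \<in> borel_measurable G"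
  shows "(\<integral>\<^sup>+x. f x * g x \<partial>M) \<le> ennreal (1 + r) * (\<integral>\<^sup>+x. f x \<partial>M) * (\<integral>\<^sup>+x. g x \<partial>M)"
    and "(\<integral>\<^sup>+x. f x \<partial>M) * (\<integral>\<^sup>+x. g x \<partial>M) \<le> (\<integral>\<^sup>+x. f x * g x \<partial>M) + ennreal r * (\<integral>\<^sup>+x. f x \<partial>M) * (\<integral>\<^sup>+x. g x \<partial>M)"
proof -
  have [measurable]: "f \<in> borel_measurable M" "g \<in> borel_measurable M"
    using measurable_from_subalg[OF F f] measurable_from_subalg[OF G g] by auto
  have AB: "emeasure M (A \<inter> B) \<le> ennreal (1 + r) * emeasure M A * emeasure M B"
    "emeasure M A * emeasure M B \<le> emeasure M (A \<inter> B) + ennreal r * emeasure M A * emeasure M B"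
    if "A \<in> sets F" "B \<in> sets G" for A B
    using mix[OF that] r
    by (auto simp: emeasure_eq_measure ennreal_mult[symmetric] ennreal_plus[symmetric] algebra_simps
        simp del: ennreal_plus intro!: ennreal_leI)
  have FM: "A \<in> sets M" if "A \<in> sets F" for A using that F by (auto simp: subalgebra_def)
  have GM: "A \<in> sets M" if "A \<in> sets G" for A using that G by (auto simp: subalgebra_def)
  define If Ig where "If = (\<integral>\<^sup>+x. f x \<partial>M)" and "Ig = (\<integral>\<^sup>+x. g x \<partial>M)"
  have const: "(\<integral>\<^sup>+x. h x * c \<partial>M) = (\<integral>\<^sup>+x. h x \<partial>M) * c" if "h \<in> borel_measurable M" for h c
    using that by (rule nn_integral_multc)
  have split: "(\<integral>\<^sup>+x. h x * (k x + c) \<partial>M) = (\<integral>\<^sup>+x. h x * k x \<partial>M) + (\<integral>\<^sup>+x. h x \<partial>M) * c"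
    if [measurable]: "h \<in> borel_measurable M" "k \<in> borel_measurable M" for h k c
    unfolding distrib_left const[OF that(1), symmetric] by (rule nn_integral_add) measurable
  have ind: "(\<integral>\<^sup>+x. indicator A x * indicator B x \<partial>M) = emeasure M (A \<inter> B)"
    if "A \<in> sets M" "B \<in> sets M" for A B
    using that by (simp add: indicator_inter_arith[symmetric])
  \<comment> \<open>B stays fixed while sets A are replaced by f.\<close>
  have fB1: "(\<integral>\<^sup>+x. f x * indicator B x \<partial>M) \<le> (\<integral>\<^sup>+x. f x * (ennreal (1 + r) * emeasure M B) \<partial>M)"
    if B: "B \<in> sets G" for B
  proof (rule nn_integral_subalgebra_mono[OF F _ _ _ f])
    fix A assume A: "A \<in> sets F"
    have "(\<integral>\<^sup>+x. indicator A x * (ennreal (1 + r) * emeasure M B) \<partial>M) = ennreal (1 + r) * emeasure M A * emeasure M B"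
      using FM[OF A] by (subst const) (simp_all add: mult_ac)
    then show "(\<integral>\<^sup>+x. indicator A x * indicator B x \<partial>M) \<le> (\<integral>\<^sup>+x. indicator A x * (ennreal (1 + r) * emeasure M B) \<partial>M)"
      using AB(1)[OF A B] ind[OF FM[OF A] GM[OF B]] by simp
  qed (use GM[OF B] in simp_all)
  have fB2: "(\<integral>\<^sup>+x. f x * emeasure M B \<partial>M) \<le> (\<integral>\<^sup>+x. f x * (indicator B x + ennreal r * emeasure M B) \<partial>M)"
    if B: "B \<in> sets G" for B
  proof (rule nn_integral_subalgebra_mono[OF F _ _ _ f])
    fix A assume A: "A \<in> sets F"
    have "(\<integral>\<^sup>+x. indicator A x * (indicator B x + ennreal r * emeasure M B) \<partial>M)
        = emeasure M (A \<inter> B) + ennreal r * emeasure M A * emeasure M B"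
      using FM[OF A] GM[OF B] by (subst split) (simp_all add: ind mult_ac)
    moreover have "(\<integral>\<^sup>+x. indicator A x * emeasure M B \<partial>M) = emeasure M A * emeasure M B"
      using FM[OF A] by (subst const) simp_all
    ultimately show "(\<integral>\<^sup>+x. indicator A x * emeasure M B \<partial>M) \<le> (\<integral>\<^sup>+x. indicator A x * (indicator B x + ennreal r * emeasure M B) \<partial>M)"
      using AB(2)[OF A B] by simp
  qed (use GM[OF B] in simp_all)
  \<comment> \<open>Now f stays fixed and, using \<open>fB1\<close>, sets B are replaced by
    g.\<close>
  have "(\<integral>\<^sup>+x. g x * f x \<partial>M) \<le> (\<integral>\<^sup>+x. g x * (ennreal (1 + r) * If) \<partial>M)"
  proof (rule nn_integral_subalgebra_mono[OF G _ _ _ g])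
    fix B assume B: "B \<in> sets G"
    have "(\<integral>\<^sup>+x. indicator B x * (ennreal (1 + r) * If) \<partial>M) = If * (ennreal (1 + r) * emeasure M B)"
      using GM[OF B] by (subst const) (simp_all add: mult_ac)
    moreover have "(\<integral>\<^sup>+x. f x * (ennreal (1 + r) * emeasure M B) \<partial>M) = If * (ennreal (1 + r) * emeasure M B)"
      by (subst const) (simp_all add: If_def)
    moreover have "(\<integral>\<^sup>+x. indicator B x * f x \<partial>M) = (\<integral>\<^sup>+x. f x * indicator B x \<partial>M)"
      by (simp add: mult.commute)
    ultimately show "(\<integral>\<^sup>+x. indicator B x * f x \<partial>M) \<le> (\<integral>\<^sup>+x. indicator B x * (ennreal (1 + r) * If) \<partial>M)"
      using fB1[OF B] by simp
  qed simp_all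
  also have "\<dots> = ennreal (1 + r) * If * Ig"
    by (subst const) (simp_all add: Ig_def mult_ac)
  finally show "(\<integral>\<^sup>+x. f x * g x \<partial>M) \<le> ennreal (1 + r) * (\<integral>\<^sup>+x. f x \<partial>M) * (\<integral>\<^sup>+x. g x \<partial>M)"
    by (simp add: If_def Ig_def mult.commute[of "g _"])
  have "If * Ig = (\<integral>\<^sup>+x. g x * If \<partial>M)"
    by (subst const) (simp_all add: Ig_def mult.commute)
  also have "\<dots> \<le> (\<integral>\<^sup>+x. g x * (f x + ennreal r * If) \<partial>M)"
  proof (rule nn_integral_subalgebra_mono[OF G _ _ _ g])
    fix B assume B: "B \<in> sets G"
    have "(\<integral>\<^sup>+x. indicator B x * (f x + ennreal r * If) \<partial>M)
        = (\<integral>\<^sup>+x. f x * indicator B x \<partial>M) + If * (ennreal r * emeasure M B)"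
      using GM[OF B] by (subst split) (simp_all add: mult_ac)
    moreover have "(\<integral>\<^sup>+x. f x * (indicator B x + ennreal r * emeasure M B) \<partial>M)
        = (\<integral>\<^sup>+x. f x * indicator B x \<partial>M) + If * (ennreal r * emeasure M B)"
      using GM[OF B] by (subst split) (simp_all add: If_def)
    moreover have "(\<integral>\<^sup>+x. f x * emeasure M B \<partial>M) = (\<integral>\<^sup>+x. indicator B x * If \<partial>M)"
      using GM[OF B] by (subst (1 2) const) (simp_all add: If_def mult.commute)
    ultimately show "(\<integral>\<^sup>+x. indicator B x * If \<partial>M) \<le> (\<integral>\<^sup>+x. indicator B x * (f x + ennreal r * If) \<partial>M)"
      using fB2[OF B] by simp
  qed simp_all
  also have "\<dots> = (\<integral>\<^sup>+x. f x * g x \<partial>M) + ennreal r * If * Ig"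
    by (subst split) (simp_all add: Ig_def mult_ac)
  finally show "(\<integral>\<^sup>+x. f x \<partial>M) * (\<integral>\<^sup>+x. g x \<partial>M) \<le> (\<integral>\<^sup>+x. f x * g x \<partial>M) + ennreal r * (\<integral>\<^sup>+x. f x \<partial>M) * (\<integral>\<^sup>+x. g x \<partial>M)"
    by (simp add: If_def Ig_def)
qed

text \<open>The relative form of the mixing bound gives E(fg) \<le> (1 + r) E f E g, so a product of
  merely integrable functions is integrable.\<close>

lemma mixing_nonneg:
  assumes f: "f \<in> borel_measurable F" "integrable M f" "\<And>x. 0 \<le> f x"
    and g: "g \<in> borel_measurable G" "integrable M g" "\<And>x. 0 \<le> g x"
  shows "integrable M (\<lambda>x. f x * g x)"
    and "\<bar>(\<integral>x. f x * g x \<partial>M) - (\<integral>x. f x \<partial>M) * (\<integral>x. g x \<partial>M)\<bar> \<le> r * ((\<integral>x. f x \<partial>M) * (\<integral>x. g x \<partial>M))"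
proof -
  have [measurable]: "f \<in> borel_measurable M" "g \<in> borel_measurable M" using f g by auto
  have fg: "(\<integral>\<^sup>+x. ennreal (f x) \<partial>M) = ennreal (\<integral>x. f x \<partial>M)" "(\<integral>\<^sup>+x. ennreal (g x) \<partial>M) = ennreal (\<integral>x. g x \<partial>M)"
    using f g by (auto intro!: nn_integral_eq_integral)
  have n: "0 \<le> (\<integral>x. f x \<partial>M)" "0 \<le> (\<integral>x. g x \<partial>M)" using f g by auto
  have mf: "(\<lambda>x. ennreal (f x)) \<in> borel_measurable F" "(\<lambda>x. ennreal (g x)) \<in> borel_measurable G"
    using f g by auto
  have u: "(\<integral>\<^sup>+x. ennreal (f x * g x) \<partial>M) \<le> ennreal ((1 + r) * ((\<integral>x. f x \<partial>M) * (\<integral>x. g x \<partial>M)))"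
    using mixing_nn_integral(1)[OF mf] f g n r
    by (simp add: fg ennreal_mult[symmetric] mult.assoc del: ennreal_plus)
  have l: "ennreal ((\<integral>x. f x \<partial>M) * (\<integral>x. g x \<partial>M)) \<le> (\<integral>\<^sup>+x. ennreal (f x * g x) \<partial>M) + ennreal (r * ((\<integral>x. f x \<partial>M) * (\<integral>x. g x \<partial>M)))"
    using mixing_nn_integral(2)[OF mf] f g n r
    by (simp add: fg ennreal_mult[symmetric] mult.assoc del: ennreal_plus)
  show int: "integrable M (\<lambda>x. f x * g x)"
  proof (rule integrableI_bounded)
    have "(\<integral>\<^sup>+x. ennreal (norm (f x * g x)) \<partial>M) = (\<integral>\<^sup>+x. ennreal (f x * g x) \<partial>M)"
      using f g by (simp add: abs_mult)
    also have "\<dots> < \<infinity>" using le_less_trans[OF u] by simp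
    finally show "(\<integral>\<^sup>+x. ennreal (norm (f x * g x)) \<partial>M) < \<infinity>" .
  qed simp
  have e: "(\<integral>\<^sup>+x. ennreal (f x * g x) \<partial>M) = ennreal (\<integral>x. f x * g x \<partial>M)"
    by (rule nn_integral_eq_integral[OF int]) (use f g in auto)
  have i0: "0 \<le> (\<integral>x. f x * g x \<partial>M)" using f g by auto
  have "(\<integral>x. f x * g x \<partial>M) \<le> (1 + r) * ((\<integral>x. f x \<partial>M) * (\<integral>x. g x \<partial>M))"
    using u n r unfolding e by (subst (asm) ennreal_le_iff) auto
  moreover have "(\<integral>x. f x \<partial>M) * (\<integral>x. g x \<partial>M) \<le> (\<integral>x. f x * g x \<partial>M) + r * ((\<integral>x. f x \<partial>M) * (\<integral>x. g x \<partial>M))"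
    using l n r i0 unfolding e by (subst (asm) ennreal_plus[symmetric]) (auto simp del: ennreal_plus simp: ennreal_le_iff)
  ultimately show "\<bar>(\<integral>x. f x * g x \<partial>M) - (\<integral>x. f x \<partial>M) * (\<integral>x. g x \<partial>M)\<bar> \<le> r * ((\<integral>x. f x \<partial>M) * (\<integral>x. g x \<partial>M))"
    by (simp add: distrib_right abs_le_iff)
qed

text \<open>Split both functions into positive and negative parts. The four bounds add up without a
  further constant, because the mean of each absolute value is the sum of the means of its two
  parts.\<close>

lemma mixing_covariance:
  assumes f: "f \<in> borel_measurable F" "integrable M f" and g: "g \<in> borel_measurable G" "integrable M g"
  shows "\<bar>(\<integral>x. f x * g x \<partial>M) - (\<integral>x. f x \<partial>M) * (\<integral>x. g x \<partial>M)\<bar> \<le> r * ((\<integral>x. \<bar>f x\<bar> \<partial>M) * (\<integral>x. \<bar>g x\<bar> \<partial>M))"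
proof -
  define fp fm gp gm where "fp x = max (f x) 0" and "fm x = max (- f x) 0"
    and "gp x = max (g x) 0" and "gm x = max (- g x) 0" for x
  have meas: "fp \<in> borel_measurable F" "fm \<in> borel_measurable F" "gp \<in> borel_measurable G" "gm \<in> borel_measurable G"
    using f g unfolding fp_def[abs_def] fm_def[abs_def] gp_def[abs_def] gm_def[abs_def] by auto
  have int: "integrable M fp" "integrable M fm" "integrable M gp" "integrable M gm"
    using f g unfolding fp_def[abs_def] fm_def[abs_def] gp_def[abs_def] gm_def[abs_def] by auto
  have pos: "0 \<le> fp x" "0 \<le> fm x" "0 \<le> gp x" "0 \<le> gm x" for x
    by (auto simp: fp_def fm_def gp_def gm_def)
  have dec: "f x = fp x - fm x" "g x = gp x - gm x" "\<bar>f x\<bar> = fp x + fm x" "\<bar>g x\<bar> = gp x + gm x" for x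
    by (auto simp: fp_def fm_def gp_def gm_def max_def)
  note pp = mixing_nonneg[OF meas(1) int(1) pos(1) meas(3) int(3) pos(3)]
  note pm = mixing_nonneg[OF meas(1) int(1) pos(1) meas(4) int(4) pos(4)]
  note mp = mixing_nonneg[OF meas(2) int(2) pos(2) meas(3) int(3) pos(3)]
  note mm = mixing_nonneg[OF meas(2) int(2) pos(2) meas(4) int(4) pos(4)]
  have "(\<integral>x. f x * g x \<partial>M) = (\<integral>x. fp x * gp x - fp x * gm x - fm x * gp x + fm x * gm x \<partial>M)"
    by (intro Bochner_Integration.integral_cong) (auto simp: dec(1,2) algebra_simps)
  also have "\<dots> = (\<integral>x. fp x * gp x \<partial>M) - (\<integral>x. fp x * gm x \<partial>M) - (\<integral>x. fm x * gp x \<partial>M) + (\<integral>x. fm x * gm x \<partial>M)"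
    using pp(1) pm(1) mp(1) mm(1) by simp
  finally have 1: "(\<integral>x. f x * g x \<partial>M) = \<dots>" .
  have 2: "(\<integral>x. f x \<partial>M) = (\<integral>x. fp x \<partial>M) - (\<integral>x. fm x \<partial>M)" "(\<integral>x. g x \<partial>M) = (\<integral>x. gp x \<partial>M) - (\<integral>x. gm x \<partial>M)"
    "(\<integral>x. \<bar>f x\<bar> \<partial>M) = (\<integral>x. fp x \<partial>M) + (\<integral>x. fm x \<partial>M)" "(\<integral>x. \<bar>g x\<bar> \<partial>M) = (\<integral>x. gp x \<partial>M) + (\<integral>x. gm x \<partial>M)"
    unfolding dec(3,4) unfolding dec(1,2) using int by simp_all
  show ?thesis unfolding 1 2
    using pp(2) pm(2) mp(2) mm(2) by (simp only: abs_le_iff algebra_simps) linarith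
qed

end

end

section \<open>Second moments of weakly dependent sums and their averages\<close>

lemma nrm_sum_weakly_dependent:
  fixes W :: "nat \<Rightarrow> 'a \<Rightarrow> real"
  assumes W: "\<And>i. sqint P (W i)" and c: "summable c" "\<And>h. 0 \<le> c h"
    and le: "\<And>i j. i \<le> j \<Longrightarrow> \<bar>ip P (W i) (W j)\<bar> \<le> c (j - i)"
  shows "(nrm P (\<lambda>x. \<Sum>j=1..m. W j x))\<^sup>2 \<le> real m * (2 * suminf c)"
proof -
  have "(nrm P (\<lambda>x. \<Sum>j=1..m. W j x))\<^sup>2 = (\<Sum>i=1..m. \<Sum>j=1..m. ip P (W i) (W j))"
    using W by (simp add: nrm_sq ip_sum_left ip_sum_right sqint_sum)
  \<comment> \<open>In each row of the Gram matrix the entries left of the diagonal and those from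
    it onwards have distinct lags, so either group is at most \<open>suminf c\<close>.\<close>
  also have "\<dots> \<le> (\<Sum>i=1..m. 2 * suminf c)"
  proof (rule sum_mono)
    fix i assume i: "i \<in> {1..m}"
    have "(\<Sum>j=1..m. ip P (W i) (W j)) = (\<Sum>j\<in>{1..<i}. ip P (W i) (W j)) + (\<Sum>j\<in>{i..m}. ip P (W i) (W j))"
      using i by (subst sum.union_disjoint[symmetric]) (auto intro!: sum.cong)
    also have "\<dots> \<le> (\<Sum>j\<in>{1..<i}. c (i - j)) + (\<Sum>j\<in>{i..m}. c (j - i))"
    proof (intro add_mono sum_mono)
      fix j assume "j \<in> {1..<i}"
      then show "ip P (W i) (W j) \<le> c (i - j)" using le[of j i] by (simp add: ip_commute[of P "W i"])
    next
      fix j assume "j \<in> {i..m}"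
      then show "ip P (W i) (W j) \<le> c (j - i)" using le[of i j] by simp
    qed
    also have "(\<Sum>j\<in>{1..<i}. c (i - j)) \<le> suminf c"
    proof -
      have "(\<Sum>j\<in>{1..<i}. c (i - j)) = sum c ((\<lambda>j. i - j) ` {1..<i})"
        by (subst sum.reindex) (auto simp: inj_on_def)
      also have "\<dots> \<le> suminf c" by (rule sum_le_suminf) (use c in auto)
      finally show ?thesis .
    qed
    also have "(\<Sum>j\<in>{i..m}. c (j - i)) \<le> suminf c"
    proof -
      have "(\<Sum>j\<in>{i..m}. c (j - i)) = sum c ((\<lambda>j. j - i) ` {i..m})"
        by (subst sum.reindex) (auto simp: inj_on_def)
      also have "\<dots> \<le> suminf c" by (rule sum_le_suminf) (use c in auto)
      finally show ?thesis .
    qed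
    finally show "(\<Sum>j=1..m. ip P (W i) (W j)) \<le> 2 * suminf c" by simp
  qed
  finally show ?thesis by simp
qed

text \<open>\<open>V i\<close> may depend on the times i to i + k, so mixing acts only at lags
  beyond k, with the gap reduced by k. Hypotheses are pointwise in x, as mixing and stationarity are
  available there, and are integrated afterwards. The shift s lets one constant serve also the
  lagged averages.\<close>

lemma (in prob_space) weakly_dependent_field_sum:
  fixes V :: "int \<Rightarrow> 'a \<times> 'b \<Rightarrow> real"
  assumes N: "sigma_finite_measure N" and V: "\<And>i. sqint (M \<Otimes>\<^sub>M N) (V i)"
    and stat: "\<And>i x. x \<in> space N \<Longrightarrow> (\<integral>\<omega>. (V i (\<omega>, x))\<^sup>2 \<partial>M) = (\<integral>\<omega>. (V 0 (\<omega>, x))\<^sup>2 \<partial>M)"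
    and cov: "\<And>i h x. x \<in> space N \<Longrightarrow> h \<ge> 1 \<Longrightarrow>
      \<bar>\<integral>\<omega>. V i (\<omega>, x) * V (i + int (k + h)) (\<omega>, x) \<partial>M\<bar> \<le> \<rho> h * w x"
    and rho: "summable \<rho>" "\<And>h. 0 \<le> \<rho> h" and w: "integrable N w" "\<And>x. 0 \<le> w x"
  obtains c where "\<And>m s. (nrm (M \<Otimes>\<^sub>M N) (\<lambda>z. \<Sum>j=1..m. V (int j + s) z))\<^sup>2 \<le> real m * c"
proof -
  interpret N: sigma_finite_measure N by fact
  interpret pair_sigma_finite M N ..
  let ?P = "M \<Otimes>\<^sub>M N"
  define W0 where "W0 = (\<integral>x. w x \<partial>N)"
  have W0: "0 \<le> W0" unfolding W0_def using w by auto
  have sw: "ip ?P (V i) (V j) = (\<integral>x. (\<integral>\<omega>. V i (\<omega>, x) * V j (\<omega>, x) \<partial>M) \<partial>N)"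
    and iw: "integrable N (\<lambda>x. \<integral>\<omega>. V i (\<omega>, x) * V j (\<omega>, x) \<partial>M)" for i j
  proof -
    have "integrable ?P (\<lambda>(\<omega>, x). V i (\<omega>, x) * V j (\<omega>, x))"
      using sqint_mult_integrable[OF V V, of i j] by (simp add: split_beta')
    from integral_snd[OF this] integrable_snd[OF this]
    show "ip ?P (V i) (V j) = (\<integral>x. (\<integral>\<omega>. V i (\<omega>, x) * V j (\<omega>, x) \<partial>M) \<partial>N)"
      "integrable N (\<lambda>x. \<integral>\<omega>. V i (\<omega>, x) * V j (\<omega>, x) \<partial>M)"
      by (simp_all add: ip_def split_beta')
  qed
  have same: "nrm ?P (V i) = nrm ?P (V 0)" for i
  proof -
    have "ip ?P (V i) (V i) = ip ?P (V 0) (V 0)"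
      unfolding sw by (rule Bochner_Integration.integral_cong[OF refl])
        (rule stat[unfolded power2_eq_square])
    then show ?thesis by (simp add: nrm_def)
  qed
  \<comment> \<open>Lags up to k are handled by Cauchy-Schwarz and equal norms; being finitely many,
    they do not affect summability.\<close>
  define c where "c h = (if h \<le> k then (nrm ?P (V 0))\<^sup>2 else \<rho> (h - k) * W0)" for h
  have c0: "0 \<le> c h" for h using rho W0 by (auto simp: c_def)
  have "summable (\<lambda>h. c (h + Suc k))"
  proof -
    have "summable (\<lambda>h. \<rho> (h + 1) * W0)"
      by (intro summable_mult2 summable_ignore_initial_segment rho)
    then show ?thesis by (simp add: c_def)
  qed
  then have cs: "summable c" by (subst (asm) summable_iff_shift)
  have le: "\<bar>ip ?P (V (int i + s)) (V (int j + s))\<bar> \<le> c (j - i)" if "i \<le> j" for i j s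
  proof (cases "j - i \<le> k")
    case True
    then show ?thesis
      using ip_Cauchy_Schwarz[OF V V, of "int i + s" "int j + s"]
      by (simp add: same[of "int i + s"] same[of "int j + s"] c_def power2_eq_square)
  next
    case False
    define h where "h = j - i - k"
    have h: "h \<ge> 1" "int j + s = (int i + s) + int (k + h)" using False that by (auto simp: h_def)
    have "\<bar>ip ?P (V (int i + s)) (V (int j + s))\<bar>
        \<le> (\<integral>x. \<bar>\<integral>\<omega>. V (int i + s) (\<omega>, x) * V (int j + s) (\<omega>, x) \<partial>M\<bar> \<partial>N)"
      unfolding sw by (rule integral_abs_bound)
    also have "\<dots> \<le> (\<integral>x. \<rho> h * w x \<partial>N)"
    proof (rule integral_mono)
      show "integrable N (\<lambda>x. \<bar>\<integral>\<omega>. V (int i + s) (\<omega>, x) * V (int j + s) (\<omega>, x) \<partial>M\<bar>)"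
        using iw by auto
      show "integrable N (\<lambda>x. \<rho> h * w x)" using w by auto
      show "\<bar>\<integral>\<omega>. V (int i + s) (\<omega>, x) * V (int j + s) (\<omega>, x) \<partial>M\<bar> \<le> \<rho> h * w x" if "x \<in> space N" for x
        using cov[OF that h(1), of "int i + s"] by (simp only: h(2))
    qed
    also have "\<dots> = c (j - i)" using False by (simp add: c_def h_def W0_def)
    finally show ?thesis .
  qed
  have "(nrm ?P (\<lambda>z. \<Sum>j=1..m. V (int j + s) z))\<^sup>2 \<le> real m * (2 * suminf c)" for m s
    by (rule nrm_sum_weakly_dependent[OF V cs c0 le])
  then show ?thesis by (rule that)
qed

lemma (in prob_space) bigOp_average:
  fixes V :: "int \<Rightarrow> 'a \<times> 'b \<Rightarrow> real"
  assumes N: "sigma_finite_measure N" and V: "\<And>i. sqint (M \<Otimes>\<^sub>M N) (V i)"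
    and le: "\<And>m s. (nrm (M \<Otimes>\<^sub>M N) (\<lambda>z. \<Sum>j=1..m. V (int j + s) z))\<^sup>2 \<le> real m * c"
  shows "bigOp M (\<lambda>n \<omega>. nrm N (\<lambda>x. (\<Sum>j=1..n-p. V (int j + s) (\<omega>, x)) / (real n - real p))) (\<lambda>n. 1 / sqrt (real n))"
proof (rule bigOp_section_nrm[OF N, where F = "\<lambda>n z. (\<Sum>j=1..n-p. V (int j + s) z) / (real n - real p)"])
  fix n
  have S: "sqint (M \<Otimes>\<^sub>M N) (\<lambda>z. \<Sum>j=1..n-p. V (int j + s) z)"
    by (rule sqint_sum) (rule V)
  show "sqint (M \<Otimes>\<^sub>M N) (\<lambda>z. (\<Sum>j=1..n-p. V (int j + s) z) / (real n - real p))"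
    using sqint_cmult[OF S, of "1 / (real n - real p)"] by simp
  \<comment> \<open>The bound for a single summand forces c to be nonnegative.\<close>
  have "0 \<le> real 1 * c" by (rule order_trans[OF zero_le_power2 le])
  then have "0 \<le> c" by simp
  assume n: "n > p"
  define m where "m = real n - real p"
  have m: "m > 0" "real (n - p) = m" using n by (auto simp: m_def)
  \<comment> \<open>For n > p this trades the divisor n - p for n at the cost of the factor p +
    1.\<close>
  have mn: "real n \<le> (real p + 1) * m"
  proof -
    have "real p * (real p + 1) \<le> real p * real n" using n by (intro mult_left_mono) auto
    then show ?thesis by (simp add: m_def algebra_simps)
  qed
  have "(nrm (M \<Otimes>\<^sub>M N) (\<lambda>z. (\<Sum>j=1..n-p. V (int j + s) z) / (real n - real p)))\<^sup>2
      = (1 / m)\<^sup>2 * (nrm (M \<Otimes>\<^sub>M N) (\<lambda>z. \<Sum>j=1..n-p. V (int j + s) z))\<^sup>2"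
    using nrm_cmult[of "M \<Otimes>\<^sub>M N" "1 / m" "\<lambda>z. \<Sum>j=1..n-p. V (int j + s) z"]
    by (simp add: m_def power_mult_distrib power_divide)
  also have "\<dots> \<le> (1 / m)\<^sup>2 * (m * c)"
    using le[of s "n - p"] m by (intro mult_left_mono) auto
  also have "\<dots> = c * (1 / m)" using m by (simp add: power2_eq_square)
  also have "\<dots> \<le> c * ((real p + 1) / real n)"
    using mn m n \<open>0 \<le> c\<close> by (intro mult_left_mono) (auto simp: field_simps)
  also have "\<dots> = c * (real p + 1) * (1 / sqrt (real n))\<^sup>2" by (simp add: power_divide)
  finally show "(nrm (M \<Otimes>\<^sub>M N) (\<lambda>z. (\<Sum>j=1..n-p. V (int j + s) z) / (real n - real p)))\<^sup>2
      \<le> c * (real p + 1) * (1 / sqrt (real n))\<^sup>2" .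
qed (auto)

section \<open>Sums of squared kernels\<close>

text \<open>The common shape of \<open>Kop\<close> and \<open>Khat\<close>, a sum of L times its
  transpose, so that each operator estimate is proved once for both.\<close>

definition ksq :: "'a measure \<Rightarrow> nat \<Rightarrow> (nat \<Rightarrow> 'a \<Rightarrow> 'a \<Rightarrow> real) \<Rightarrow> 'a \<Rightarrow> 'a \<Rightarrow> real" where
  "ksq N p L u v = (\<Sum>k=1..p. kcomp N (L k) (L k) u v)"

context
  fixes N :: "'a measure" and p :: nat
  assumes sf: "sigma_finite_measure N"
begin

lemma sqint_ksq:
  assumes "\<And>k. sqint (N \<Otimes>\<^sub>M N) (case_prod (L k))"
  shows "sqint (N \<Otimes>\<^sub>M N) (case_prod (ksq N p L))"
  using sqint_sum_kernel[OF sf sf, of "{1..p}" "\<lambda>k. kcomp N (L k) (L k)"] sqint_kcomp[OF sf sf sf assms assms]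
  by (simp add: ksq_def[abs_def])

lemma kform_ksq:
  assumes L: "\<And>k. sqint (N \<Otimes>\<^sub>M N) (case_prod (L k))" and f: "sqint N f" and g: "sqint N g"
  shows "kform N N (ksq N p L) f g = (\<Sum>k=1..p. ip N (kap N (\<lambda>z u. L k u z) f) (kap N (\<lambda>z u. L k u z) g))"
proof -
  have "kform N N (ksq N p L) f g = (\<Sum>k=1..p. kform N N (kcomp N (L k) (L k)) f g)"
    unfolding ksq_def[abs_def] by (rule kform_sum_kernel[OF sf sf sqint_kcomp[OF sf sf sf L L] f g])
  then show ?thesis by (simp add: kform_kcomp[OF sf sf sf L L f g])
qed

lemma symform_ksq:
  assumes L: "\<And>k. sqint (N \<Otimes>\<^sub>M N) (case_prod (L k))"
  shows "symform N (kform N N (ksq N p L))"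
  unfolding symform_def
proof (intro conjI allI impI)
  fix f g assume "sqint N f" "sqint N g"
  then show "kform N N (ksq N p L) f g = kform N N (ksq N p L) g f"
    unfolding kform_ksq[OF L \<open>sqint N f\<close> \<open>sqint N g\<close>] kform_ksq[OF L \<open>sqint N g\<close> \<open>sqint N f\<close>]
    by (intro sum.cong refl ip_commute)
qed (simp_all add: kform_add_left[OF sf sf sqint_ksq[OF L]] kform_cmult_left[OF sf sf sqint_ksq[OF L]])

lemma kform_ksq_nonneg:
  assumes L: "\<And>k. sqint (N \<Otimes>\<^sub>M N) (case_prod (L k))" and g: "sqint N g"
  shows "0 \<le> kform N N (ksq N p L) g g"
  unfolding kform_ksq[OF L g g] by (intro sum_nonneg ip_self_nonneg)

lemma kform_ksq_eigen:
  assumes L: "\<And>k. sqint (N \<Otimes>\<^sub>M N) (case_prod (L k))" and f: "sqint N f" and g: "sqint N g"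
    and eig: "AE u in N. kap N (ksq N p L) f u = \<theta> * f u"
  shows "kform N N (ksq N p L) f g = \<theta> * ip N f g"
proof -
  have "kform N N (ksq N p L) f g = kform N N (ksq N p L) g f"
    by (rule symform_sym[OF symform_ksq[OF L] f g])
  also have "\<dots> = ip N (kap N (ksq N p L) f) g"
    unfolding kform_kap(1)[OF sf sf sqint_ksq[OF L] g f] by (rule ip_commute)
  also have "\<dots> = ip N (\<lambda>u. \<theta> * f u) g"
    by (rule ip_cong_AE[OF eig sqint_kap[OF sf sf sqint_ksq[OF L] f] sqint_cmult[OF f] g])
  finally show ?thesis by (simp add: ip_cmult_left)
qed

text \<open>With D = A - B, the difference of A A^T and B B^T is D A^T + B D^T. Replacing the norm
  of A by at most that of D plus that of B leaves only the norm of the limit kernel B.\<close>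

lemma nrm_kcomp_diff:
  assumes A: "sqint (N \<Otimes>\<^sub>M N) (case_prod A)" and B: "sqint (N \<Otimes>\<^sub>M N) (case_prod B)"
  shows "nrm (N \<Otimes>\<^sub>M N) (\<lambda>(u, v). kcomp N A A u v - kcomp N B B u v)
    \<le> nrm (N \<Otimes>\<^sub>M N) (\<lambda>(u, v). A u v - B u v) *
       (nrm (N \<Otimes>\<^sub>M N) (\<lambda>(u, v). A u v - B u v) + 2 * nrm (N \<Otimes>\<^sub>M N) (case_prod B))"
proof -
  let ?P = "N \<Otimes>\<^sub>M N"
  define D where "D u v = A u v - B u v" for u v
  have D: "sqint ?P (case_prod D)"
    using sqint_diff[OF A B] by (simp add: D_def[abs_def] split_beta')
  define q where "q = nrm ?P (case_prod D)"
  have q: "q = nrm ?P (\<lambda>(u, v). A u v - B u v)" by (simp add: q_def D_def[abs_def])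
  have nA: "nrm ?P (case_prod A) \<le> q + nrm ?P (case_prod B)"
    using nrm_triangle[OF D B] by (simp add: q_def D_def[abs_def] split_beta')
  note DA = sqint_kcomp[OF sf sf sf D A] and BD = sqint_kcomp[OF sf sf sf B D]
  have AA: "sqint ?P (\<lambda>(u, v). kcomp N A A u v - kcomp N B B u v)"
    using sqint_diff[OF sqint_kcomp[OF sf sf sf A A] sqint_kcomp[OF sf sf sf B B]] by (simp add: split_beta')
  \<comment> \<open>The identity holds almost everywhere only: splitting the inner integral needs
    the four rows to be square integrable.\<close>
  have "AE x in ?P. \<bar>case x of (u, v) \<Rightarrow> kcomp N A A u v - kcomp N B B u v\<bar>
      \<le> \<bar>case_prod (kcomp N D A) x + case_prod (kcomp N B D) x\<bar>"
    using AE_pair_fst[OF sf sqint_section_AE[OF sf sf A]] AE_pair_snd[OF sf sqint_section_AE[OF sf sf A]]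
      AE_pair_fst[OF sf sqint_section_AE[OF sf sf B]] AE_pair_snd[OF sf sqint_section_AE[OF sf sf B]]
  proof eventually_elim
    case (elim x)
    obtain u v where x: "x = (u, v)" by (cases x)
    have s: "sqint N (A u)" "sqint N (A v)" "sqint N (B u)" "sqint N (B v)" using elim by (auto simp: x)
    have "D u = (\<lambda>z. A u z - B u z)" "D v = (\<lambda>z. A v z - B v z)" by (auto simp: D_def)
    then have "ip N (A u) (A v) - ip N (B u) (B v) = ip N (D u) (A v) + ip N (B u) (D v)"
      using s by (simp add: ip_diff_left ip_diff_right)
    then show ?case by (simp add: x kcomp_def ip_def)
  qed
  then have "nrm ?P (\<lambda>(u, v). kcomp N A A u v - kcomp N B B u v)
      \<le> nrm ?P (\<lambda>x. case_prod (kcomp N D A) x + case_prod (kcomp N B D) x)"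
    by (rule sqint_dominated(2)[OF sqint_add[OF DA BD] sqint_measurable[OF AA]])
  also have "\<dots> \<le> nrm ?P (case_prod (kcomp N D A)) + nrm ?P (case_prod (kcomp N B D))"
    by (rule nrm_triangle[OF DA BD])
  also have "\<dots> \<le> q * nrm ?P (case_prod A) + nrm ?P (case_prod B) * q"
    unfolding q_def by (intro add_mono nrm_kcomp_le[OF sf sf sf D A] nrm_kcomp_le[OF sf sf sf B D])
  also have "\<dots> \<le> q * (q + nrm ?P (case_prod B)) + nrm ?P (case_prod B) * q"
    by (intro add_right_mono mult_left_mono nA) (simp add: q_def nrm_nonneg)
  finally show ?thesis by (simp add: q algebra_simps)
qed

lemma nrm_ksq_diff:
  assumes L: "\<And>k. sqint (N \<Otimes>\<^sub>M N) (case_prod (L k))" and L': "\<And>k. sqint (N \<Otimes>\<^sub>M N) (case_prod (L' k))"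
  shows "nrm (N \<Otimes>\<^sub>M N) (\<lambda>(u, v). ksq N p L u v - ksq N p L' u v)
    \<le> (\<Sum>k=1..p. nrm (N \<Otimes>\<^sub>M N) (\<lambda>(u, v). L k u v - L' k u v) *
       (nrm (N \<Otimes>\<^sub>M N) (\<lambda>(u, v). L k u v - L' k u v) + 2 * nrm (N \<Otimes>\<^sub>M N) (case_prod (L' k))))"
proof -
  let ?P = "N \<Otimes>\<^sub>M N"
  have s: "sqint ?P (\<lambda>(u, v). kcomp N (L k) (L k) u v - kcomp N (L' k) (L' k) u v)" for k
    using sqint_diff[OF sqint_kcomp[OF sf sf sf L L] sqint_kcomp[OF sf sf sf L' L'], of k k] by (simp add: split_beta')
  have "nrm ?P (\<lambda>(u, v). ksq N p L u v - ksq N p L' u v)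
      = nrm ?P (\<lambda>x. \<Sum>k=1..p. (case x of (u, v) \<Rightarrow> kcomp N (L k) (L k) u v - kcomp N (L' k) (L' k) u v))"
    by (simp add: ksq_def split_beta' sum_subtractf)
  also have "\<dots> \<le> (\<Sum>k=1..p. nrm ?P (\<lambda>(u, v). kcomp N (L k) (L k) u v - kcomp N (L' k) (L' k) u v))"
    by (rule nrm_sum_le) (rule s)
  also have "\<dots> \<le> (\<Sum>k=1..p. nrm ?P (\<lambda>(u, v). L k u v - L' k u v) *
       (nrm ?P (\<lambda>(u, v). L k u v - L' k u v) + 2 * nrm ?P (case_prod (L' k))))"
    by (intro sum_mono nrm_kcomp_diff L L')
  finally show ?thesis .
qed

text \<open>On the kernel of the limiting form the perturbed form is of second order, because it is a sum of squares.\<close>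

lemma kform_ksq_on_kernel:
  assumes L: "\<And>k. sqint (N \<Otimes>\<^sub>M N) (case_prod (L k))" and L': "\<And>k. sqint (N \<Otimes>\<^sub>M N) (case_prod (L' k))"
    and g: "sqint N g" and ker: "kform N N (ksq N p L') g g = 0"
  shows "kform N N (ksq N p L) g g \<le> (\<Sum>k=1..p. (nrm (N \<Otimes>\<^sub>M N) (\<lambda>(u, v). L k u v - L' k u v))\<^sup>2) * (nrm N g)\<^sup>2"
proof -
  have "(nrm N (kap N (\<lambda>z u. L k u z) g))\<^sup>2 \<le> (nrm (N \<Otimes>\<^sub>M N) (\<lambda>(u, v). L k u v - L' k u v))\<^sup>2 * (nrm N g)\<^sup>2"
    if k: "k \<in> {1..p}" for k
  proof -
    define q where "q = nrm (N \<Otimes>\<^sub>M N) (\<lambda>(u, v). L k u v - L' k u v)"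
    define y where "y = kap N (\<lambda>z u. L k u z) g"
    define y' where "y' = kap N (\<lambda>z u. L' k u z) g"
    have y: "sqint N y" "sqint N y'"
      unfolding y_def y'_def
      using sqint_kap[OF sf sf _ g, of "\<lambda>z u. L k u z"] sqint_kap[OF sf sf _ g, of "\<lambda>z u. L' k u z"]
        sqint_transpose(1)[OF sf sf L[of k]] sqint_transpose(1)[OF sf sf L'[of k]] by auto
    have "ip N y' y' = 0"
      using ker k unfolding kform_ksq[OF L' g g] y'_def
      by (subst (asm) sum_nonneg_eq_0_iff) (auto simp: ip_self_nonneg)
    then have y'0: "ip N y' y = 0"
      using ip_eq_0_if_nrm_eq_0[OF y(2,1)] by (simp add: nrm_def)
    have D: "sqint (N \<Otimes>\<^sub>M N) (case_prod (\<lambda>u v. L k u v - L' k u v))"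
      using sqint_diff[OF L L', of k k] by (simp add: split_beta')
    \<comment> \<open>Here y is the transpose of \<open>L k\<close> applied to g; the vector
      \<open>y'\<close> for \<open>L' k\<close> is orthogonal to everything, so y may be computed
      with the difference kernel, and one factor \<open>nrm N y\<close> cancels afterwards.\<close>
    have "(nrm N y)\<^sup>2 = kform N N (L k) g y"
      using kform_kap(2)[OF sf sf L g y(1), of k] unfolding nrm_sq by (simp flip: y_def)
    also have "\<dots> = kform N N (L k) g y - kform N N (L' k) g y"
      using y'0 unfolding kform_kap(2)[OF sf sf L' g y(1)] y'_def by simp
    also have "\<dots> = kform N N (\<lambda>u v. L k u v - L' k u v) g y"
      by (rule kform_diff_kernel[OF sf sf L L' g y(1), symmetric])
    also have "\<dots> \<le> q * (nrm N g * nrm N y)"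
      using kform_bound[OF sf sf D g y(1)] by (simp add: q_def)
    finally have le: "nrm N y * nrm N y \<le> q * nrm N g * nrm N y" by (simp add: power2_eq_square mult.assoc)
    have "nrm N y \<le> q * nrm N g"
    proof (cases "nrm N y = 0")
      case True
      then show ?thesis by (simp add: q_def nrm_nonneg)
    next
      case False
      then show ?thesis using le nrm_nonneg[of N y] by (auto simp: mult_le_cancel_right)
    qed
    from power_mono[OF this nrm_nonneg, of 2] show ?thesis by (simp add: y_def q_def power_mult_distrib)
  qed
  then show ?thesis
    unfolding kform_ksq[OF L g g] sum_distrib_right nrm_sq[symmetric] by (intro sum_mono) auto
qed

end

section \<open>The \<open>\<psi>\<close>-mixing coefficients and stationarity\<close>

text \<open>\<open>Fgen\<close> as a measure space, so that \<open>borel_measurable\<close> and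
  \<open>subalgebra\<close> can refer to it.\<close>

definition Fsig :: "'w measure \<Rightarrow> real \<Rightarrow> real \<Rightarrow> (int \<Rightarrow> 'w \<Rightarrow> real \<Rightarrow> real) \<Rightarrow> int set \<Rightarrow> 'w measure" where
  "Fsig M a b Y S = sigma (space M)
     {(\<lambda>\<omega>. Y t \<omega> u) -` B \<inter> space M | t u B. t \<in> S \<and> u \<in> {a..b} \<and> B \<in> sets borel}"

lemma space_Fsig: "space (Fsig M a b Y S) = space M"
  unfolding Fsig_def by (rule space_measure_of) auto

lemma sets_Fsig: "sets (Fsig M a b Y S) = Fgen M a b Y S"
  unfolding Fsig_def Fgen_def by (rule sets_measure_of) auto

lemma measurable_Fsig:
  assumes "t \<in> S" "u \<in> {a..b}"
  shows "(\<lambda>\<omega>. Y t \<omega> u) \<in> borel_measurable (Fsig M a b Y S)"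
proof (rule measurableI)
  fix B :: "real set" assume "B \<in> sets borel"
  then show "(\<lambda>\<omega>. Y t \<omega> u) -` B \<inter> space (Fsig M a b Y S) \<in> sets (Fsig M a b Y S)"
    unfolding space_Fsig sets_Fsig Fgen_def using assms by (intro sigma_sets.Basic) blast
qed simp

lemma subalgebra_Fsig:
  assumes "\<And>t u. u \<in> {a..b} \<Longrightarrow> (\<lambda>\<omega>. Y t \<omega> u) \<in> borel_measurable M"
  shows "subalgebra M (Fsig M a b Y S)"
  unfolding subalgebra_def space_Fsig sets_Fsig Fgen_def
proof (intro conjI refl sets.sigma_sets_subset subsetI)
  fix A assume "A \<in> {(\<lambda>\<omega>. Y t \<omega> u) -` B \<inter> space M | t u B. t \<in> S \<and> u \<in> {a..b} \<and> B \<in> sets borel}"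
  then show "A \<in> sets M" using measurable_sets[OF assms] by auto
qed

text \<open>Multiplying out the quotient in \<open>psi_coef\<close> gives the product form that
  integrates well. Pairs with a null event, left out of the supremum, satisfy it because both sides
  vanish.\<close>

lemma (in prob_space)
  assumes meas: "\<And>t u. u \<in> {a..b} \<Longrightarrow> (\<lambda>\<omega>. Y t \<omega> u) \<in> borel_measurable M"
    and fin: "psi_coef M a b Y l \<noteq> \<infinity>"
  shows psi_coef_nonneg: "0 \<le> real_of_ereal (psi_coef M a b Y l)"
    and psi_coef_mixing: "A \<in> sets (Fsig M a b Y {..0}) \<Longrightarrow> B \<in> sets (Fsig M a b Y {int l..}) \<Longrightarrow>
      \<bar>measure M (A \<inter> B) - measure M A * measure M B\<bar>
        \<le> real_of_ereal (psi_coef M a b Y l) * (measure M A * measure M B)"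
proof -
  define r where "r = real_of_ereal (psi_coef M a b Y l)"
  have ge: "ereal \<bar>1 - (measure M (A \<inter> B) / measure M A) / measure M B\<bar> \<le> psi_coef M a b Y l"
    if "A \<in> Fgen M a b Y {..0}" "B \<in> Fgen M a b Y {int l..}" "measure M A * measure M B > 0" for A B
    unfolding psi_coef_def using that by (intro Sup_upper) blast
  have sp: "space M \<in> Fgen M a b Y S" for S
    using sets.top[of "Fsig M a b Y S"] by (simp add: sets_Fsig space_Fsig)
  \<comment> \<open>The pair of full spaces contributes the value 0, so the supremum is over a
    nonempty set and not negative.\<close>
  have "0 \<le> psi_coef M a b Y l"
    using ge[OF sp sp] by (simp add: prob_space flip: zero_ereal_def)
  then have r: "psi_coef M a b Y l = ereal r" "0 \<le> r"
    using fin unfolding r_def by (cases "psi_coef M a b Y l"; simp)+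
  then show "0 \<le> real_of_ereal (psi_coef M a b Y l)" by simp
  assume A: "A \<in> sets (Fsig M a b Y {..0})" and B: "B \<in> sets (Fsig M a b Y {int l..})"
  have AM: "A \<in> sets M" and BM: "B \<in> sets M"
    using A B subalgebra_Fsig[of a b Y M, OF meas] unfolding subalgebra_def by blast+
  have "\<bar>measure M (A \<inter> B) - measure M A * measure M B\<bar> \<le> r * (measure M A * measure M B)"
  proof (cases "measure M A * measure M B > 0")
    case True
    then have pos: "measure M A > 0" "measure M B > 0"
      using measure_nonneg[of M A] measure_nonneg[of M B] by (auto simp: zero_less_mult_iff)
    have "\<bar>1 - (measure M (A \<inter> B) / measure M A) / measure M B\<bar> \<le> r"
      using ge[of A B] A B True r by (simp add: sets_Fsig)
    then have "(measure M A * measure M B) * \<bar>1 - (measure M (A \<inter> B) / measure M A) / measure M B\<bar>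
        \<le> (measure M A * measure M B) * r"
      using True by (intro mult_left_mono) auto
    moreover have "(measure M A * measure M B) * \<bar>1 - (measure M (A \<inter> B) / measure M A) / measure M B\<bar>
        = \<bar>(measure M A * measure M B) * (1 - (measure M (A \<inter> B) / measure M A) / measure M B)\<bar>"
      using True by (simp add: abs_mult)
    moreover have "(measure M A * measure M B) * (1 - (measure M (A \<inter> B) / measure M A) / measure M B)
        = measure M A * measure M B - measure M (A \<inter> B)"
      using pos by (simp add: field_simps)
    ultimately show ?thesis by (simp add: abs_minus_commute mult.commute)
  next
    case False
    then have zero: "measure M A * measure M B = 0"
      using mult_nonneg_nonneg[OF measure_nonneg measure_nonneg, of M A M B] by linarith
    have "measure M (A \<inter> B) \<le> measure M A" "measure M (A \<inter> B) \<le> measure M B"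
      using AM BM by (auto intro!: finite_measure_mono)
    then have "measure M (A \<inter> B) = 0"
      using zero measure_nonneg[of M "A \<inter> B"] unfolding mult_eq_0_iff by linarith
    then show ?thesis unfolding zero by simp
  qed
  then show "\<bar>measure M (A \<inter> B) - measure M A * measure M B\<bar>
        \<le> real_of_ereal (psi_coef M a b Y l) * (measure M A * measure M B)" by (simp add: r_def)
qed

text \<open>Terms of the series in C1 tend to 0, so eventually the root of the coefficient is at
  most 1; the coefficient is then below its root and below the corresponding term. Lag 0 is replaced
  by 0 because C1 does not make that coefficient finite.\<close>

lemma summable_psi_coef:
  assumes "psi_mixing_C1 M a b Y" and nonneg: "\<And>l. l \<ge> 1 \<Longrightarrow> 0 \<le> real_of_ereal (psi_coef M a b Y l)"
  shows "summable (\<lambda>l. if l = 0 then 0 else real_of_ereal (psi_coef M a b Y l))"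
proof -
  define r where "r l = real_of_ereal (psi_coef M a b Y l)" for l
  have s: "summable (\<lambda>l. real l * sqrt (r l))" using assms(1) by (simp add: psi_mixing_C1_def r_def)
  then have "(\<lambda>l. real l * sqrt (r l)) \<longlonglongrightarrow> 0" by (rule summable_LIMSEQ_zero)
  then have "eventually (\<lambda>l. real l * sqrt (r l) < 1) sequentially" by (rule order_tendstoD) simp
  then have "eventually (\<lambda>l. norm (if l = 0 then 0 else r l) \<le> real l * sqrt (r l)) sequentially"
    using eventually_ge_at_top[of 1]
  proof eventually_elim
    case (elim l)
    have r0: "0 \<le> r l" using nonneg elim by (simp add: r_def)
    have "sqrt (r l) \<le> real l * sqrt (r l)" using elim r0 mult_right_mono[of 1 "real l" "sqrt (r l)"] by simp
    then have "sqrt (r l) \<le> 1" using elim by linarith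
    then have "sqrt (r l) * sqrt (r l) \<le> 1 * sqrt (r l)" using r0 by (intro mult_right_mono) auto
    then have "r l \<le> sqrt (r l)" using r0 by simp
    also have "\<dots> \<le> real l * sqrt (r l)" by fact
    finally show ?case using r0 elim by simp
  qed
  from summable_comparison_test_ev[OF this s] show ?thesis unfolding r_def .
qed

lemma stationary_integral:
  fixes G :: "(int \<times> real \<Rightarrow> real) \<Rightarrow> real"
  assumes st: "strictly_stationary M a b Y" and J: "finite J" "J \<subseteq> UNIV \<times> {a..b}"
    and meas: "\<And>t u. u \<in> {a..b} \<Longrightarrow> (\<lambda>\<omega>. Y t \<omega> u) \<in> borel_measurable M"
    and G: "G \<in> borel_measurable (Pi\<^sub>M J (\<lambda>_. borel))"
  shows "(\<integral>\<omega>. G (\<lambda>x\<in>J. Y (fst x + h) \<omega> (snd x)) \<partial>M) = (\<integral>\<omega>. G (\<lambda>x\<in>J. Y (fst x) \<omega> (snd x)) \<partial>M)"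
proof -
  have m: "(\<lambda>\<omega>. \<lambda>x\<in>J. Y (fst x + h) \<omega> (snd x)) \<in> measurable M (Pi\<^sub>M J (\<lambda>_. borel))" for h
    using J(2) by (intro measurable_restrict meas) auto
  have "(\<integral>\<omega>. G (\<lambda>x\<in>J. Y (fst x + h) \<omega> (snd x)) \<partial>M)
      = integral\<^sup>L (distr M (Pi\<^sub>M J (\<lambda>_. borel)) (\<lambda>\<omega>. \<lambda>x\<in>J. Y (fst x + h) \<omega> (snd x))) G"
    by (rule integral_distr[OF m G, symmetric])
  also have "\<dots> = integral\<^sup>L (distr M (Pi\<^sub>M J (\<lambda>_. borel)) (\<lambda>\<omega>. \<lambda>x\<in>J. Y (fst x) \<omega> (snd x))) G"
    using st J by (simp add: strictly_stationary_def)
  also have "\<dots> = (\<integral>\<omega>. G (\<lambda>x\<in>J. Y (fst x) \<omega> (snd x)) \<partial>M)"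
    using integral_distr[OF m[of 0] G] by simp
  finally show ?thesis .
qed

lemma stationary_lagged_products:
  assumes st: "strictly_stationary M a b Y" and uv: "u \<in> {a..b}" "v \<in> {a..b}"
    and meas: "\<And>t u. u \<in> {a..b} \<Longrightarrow> (\<lambda>\<omega>. Y t \<omega> u) \<in> borel_measurable M"
  shows "(\<integral>\<omega>. (Y (i + h) \<omega> u - m u) * (Y (j + h) \<omega> u - m u) \<partial>M) = (\<integral>\<omega>. (Y i \<omega> u - m u) * (Y j \<omega> u - m u) \<partial>M)"
    and "(\<integral>\<omega>. ((Y (i + h) \<omega> u - m u) * (Y (i + k + h) \<omega> v - m v) - c) * ((Y (j + h) \<omega> u - m u) * (Y (j + k + h) \<omega> v - m v) - c) \<partial>M)
      = (\<integral>\<omega>. ((Y i \<omega> u - m u) * (Y (i + k) \<omega> v - m v) - c) * ((Y j \<omega> u - m u) * (Y (j + k) \<omega> v - m v) - c) \<partial>M)"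
proof -
  \<comment> \<open>These four evaluation points carry both integrands, so finite-dimensional
    stationarity is used with a single index set.\<close>
  define J where "J = {(i, u), (j, u), (i + k, v), (j + k, v)}"
  have J: "finite J" "J \<subseteq> UNIV \<times> {a..b}" using uv by (auto simp: J_def)
  have inJ: "(i, u) \<in> J" "(j, u) \<in> J" "(i + k, v) \<in> J" "(j + k, v) \<in> J" by (auto simp: J_def)
  have comp[measurable]: "(\<lambda>x. x z) \<in> borel_measurable (Pi\<^sub>M J (\<lambda>_. borel))" if "z \<in> J" for z
    using that by (rule measurable_component_singleton)
  note st_int = stationary_integral[OF st J meas]
  note cs = comp[OF inJ(1)] comp[OF inJ(2)] comp[OF inJ(3)] comp[OF inJ(4)]
  have G1: "(\<lambda>x. (x (i, u) - m u) * (x (j, u) - m u)) \<in> borel_measurable (Pi\<^sub>M J (\<lambda>_. borel))"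
    by (intro borel_measurable_times borel_measurable_diff cs borel_measurable_const)
  have G2: "(\<lambda>x. ((x (i, u) - m u) * (x (i + k, v) - m v) - c) * ((x (j, u) - m u) * (x (j + k, v) - m v) - c))
      \<in> borel_measurable (Pi\<^sub>M J (\<lambda>_. borel))"
    by (intro borel_measurable_times borel_measurable_diff cs borel_measurable_const)
  show "(\<integral>\<omega>. (Y (i + h) \<omega> u - m u) * (Y (j + h) \<omega> u - m u) \<partial>M) = (\<integral>\<omega>. (Y i \<omega> u - m u) * (Y j \<omega> u - m u) \<partial>M)"
    using st_int[OF _ G1, of h] inJ by simp
  show "(\<integral>\<omega>. ((Y (i + h) \<omega> u - m u) * (Y (i + k + h) \<omega> v - m v) - c) * ((Y (j + h) \<omega> u - m u) * (Y (j + k + h) \<omega> v - m v) - c) \<partial>M)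
      = (\<integral>\<omega>. ((Y i \<omega> u - m u) * (Y (i + k) \<omega> v - m v) - c) * ((Y j \<omega> u - m u) * (Y (j + k) \<omega> v - m v) - c) \<partial>M)"
    using st_int[OF _ G2, of h] inJ by simp
qed

section \<open>The model\<close>

locale functional_factor_model = prob_space M
  for M :: "'w measure" +
  fixes a b :: real
    and X eps Y :: "int \<Rightarrow> 'w \<Rightarrow> real \<Rightarrow> real"
    and mu :: "real \<Rightarrow> real" and Mk :: "nat \<Rightarrow> real \<Rightarrow> real \<Rightarrow> real"
  assumes Y_def: "\<And>t \<omega> u. Y t \<omega> u = X t \<omega> u + eps t \<omega> u"
    and X_meas: "\<And>t. (\<lambda>(\<omega>, u). X t \<omega> u) \<in> borel_measurable (M \<Otimes>\<^sub>M lborel)"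
    and eps_meas: "\<And>t. (\<lambda>(\<omega>, u). eps t \<omega> u) \<in> borel_measurable (M \<Otimes>\<^sub>M lborel)"
    and X_sq: "\<And>t u. u \<in> {a..b} \<Longrightarrow> integrable M (\<lambda>\<omega>. (X t \<omega> u)^2)"
    and eps_sq: "\<And>t u. u \<in> {a..b} \<Longrightarrow> integrable M (\<lambda>\<omega>. (eps t \<omega> u)^2)"
    and moment: "\<And>t. (\<integral>\<^sup>+u\<in>{a..b}. (\<integral>\<^sup>+\<omega>. ennreal ((X t \<omega> u)^2 + (eps t \<omega> u)^2) \<partial>M) \<partial>lborel) < \<infinity>"
    and eps_mean: "\<And>t u. u \<in> {a..b} \<Longrightarrow> (\<integral>\<omega>. eps t \<omega> u \<partial>M) = 0"
    and eps_uncorr: "\<And>t s u v. t \<noteq> s \<Longrightarrow> u \<in> {a..b} \<Longrightarrow> v \<in> {a..b} \<Longrightarrow>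
                       (\<integral>\<omega>. eps t \<omega> u * eps s \<omega> v \<partial>M) = 0"
    and mu_eq: "\<And>t u. u \<in> {a..b} \<Longrightarrow> (\<integral>\<omega>. X t \<omega> u \<partial>M) = mu u"
    and Mk_eq: "\<And>t k u v. u \<in> {a..b} \<Longrightarrow> v \<in> {a..b} \<Longrightarrow>
                   (\<integral>\<omega>. (X t \<omega> u - mu u) * (X (t + int k) \<omega> v - mu v) \<partial>M) = Mk k u v"
    and stationary: "strictly_stationary M a b Y" and mixing: "psi_mixing_C1 M a b Y"
    and C2: "\<And>t. (\<integral>\<^sup>+\<omega>. ((\<integral>\<^sup>+u\<in>{a..b}. ennreal ((Y t \<omega> u)^2) \<partial>lborel))^2 \<partial>M) < \<infinity>"
    and C4: "\<And>s t u v. u \<in> {a..b} \<Longrightarrow> v \<in> {a..b} \<Longrightarrow>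
               (\<integral>\<omega>. (X s \<omega> u - mu u) * eps t \<omega> v \<partial>M) = 0"
begin

abbreviation "I \<equiv> Iab a b"

lemma sfM: "sigma_finite_measure M" by (rule sigma_finite_measure_axioms)
lemma sfI: "sigma_finite_measure I" by (rule sigma_finite_Iab)

interpretation I: finite_measure I by (rule finite_measure_Iab)
interpretation MI: pair_sigma_finite M I
  using sfM sfI by (simp add: pair_sigma_finite_def)
interpretation II: pair_sigma_finite I I
  using sfI by (simp add: pair_sigma_finite_def)

lemma sfII: "sigma_finite_measure (I \<Otimes>\<^sub>M I)"
  by (rule II.sigma_finite_measure_axioms)

text \<open>\<open>mu\<close> is only known on \<open>{a..b}\<close>; \<open>m\<close> is a version of it that is measurable on the whole line.\<close>

definition m :: "real \<Rightarrow> real" where "m u = (\<integral>\<omega>. X 0 \<omega> u \<partial>M)"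
definition Xc :: "int \<Rightarrow> 'w \<Rightarrow> real \<Rightarrow> real" where "Xc t \<omega> u = X t \<omega> u - m u"
definition Z :: "int \<Rightarrow> 'w \<Rightarrow> real \<Rightarrow> real" where "Z t \<omega> u = Y t \<omega> u - m u"

lemma m_eq: "u \<in> {a..b} \<Longrightarrow> m u = mu u"
  by (simp add: m_def mu_eq)

lemma Z_eq: "Z t \<omega> u = Xc t \<omega> u + eps t \<omega> u"
  by (simp add: Z_def Xc_def Y_def)

lemma measurable_I:
  assumes "f \<in> borel_measurable (M \<Otimes>\<^sub>M lborel)" shows "f \<in> borel_measurable (M \<Otimes>\<^sub>M I)"
proof -
  have "(\<lambda>x. (fst x, snd x)) \<in> measurable (M \<Otimes>\<^sub>M I) (M \<Otimes>\<^sub>M lborel)"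
    by (intro measurable_Pair measurable_fst measurable_compose[OF measurable_snd]
        measurable_restrict_space1 measurable_ident_sets) auto
  from measurable_compose[OF this assms] show ?thesis by simp
qed

lemma X_I[measurable]: "(\<lambda>(\<omega>, u). X t \<omega> u) \<in> borel_measurable (M \<Otimes>\<^sub>M I)"
  by (rule measurable_I[OF X_meas])

lemma eps_I[measurable]: "(\<lambda>(\<omega>, u). eps t \<omega> u) \<in> borel_measurable (M \<Otimes>\<^sub>M I)"
  by (rule measurable_I[OF eps_meas])

lemma X_u[measurable]: "(\<lambda>\<omega>. X t \<omega> u) \<in> borel_measurable M"
  using measurable_Pair1[OF X_meas[of t], of u] by simp

lemma eps_u[measurable]: "(\<lambda>\<omega>. eps t \<omega> u) \<in> borel_measurable M"
  using measurable_Pair1[OF eps_meas[of t], of u] by simp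

lemma Y_u[measurable]: "(\<lambda>\<omega>. Y t \<omega> u) \<in> borel_measurable M"
  unfolding Y_def by simp

lemma sqint_const: "sqint M (\<lambda>\<omega>. c)"
  by (simp add: sqint_def)

lemma sqint_X: "u \<in> {a..b} \<Longrightarrow> sqint M (\<lambda>\<omega>. X t \<omega> u)"
  using X_sq by (simp add: sqint_def)

lemma sqint_eps: "u \<in> {a..b} \<Longrightarrow> sqint M (\<lambda>\<omega>. eps t \<omega> u)"
  using eps_sq by (simp add: sqint_def)

lemma sqint_Xc: "u \<in> {a..b} \<Longrightarrow> sqint M (\<lambda>\<omega>. Xc t \<omega> u)"
  unfolding Xc_def by (intro sqint_diff sqint_X sqint_const)

lemma sqint_Z: "u \<in> {a..b} \<Longrightarrow> sqint M (\<lambda>\<omega>. Z t \<omega> u)"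
  unfolding Z_eq by (intro sqint_add sqint_Xc sqint_eps)

lemma sqint_imp_integrable: "sqint M f \<Longrightarrow> integrable M f"
  using sqint_mult_integrable[OF _ sqint_const[of 1]] by simp

lemma expectation_Z: "u \<in> {a..b} \<Longrightarrow> (\<integral>\<omega>. Z t \<omega> u \<partial>M) = 0"
  using sqint_imp_integrable[OF sqint_X, of u t] sqint_imp_integrable[OF sqint_eps, of u t]
  by (simp add: Z_eq Xc_def mu_eq m_eq eps_mean prob_space)

lemma Mk_Xc:
  assumes "u \<in> {a..b}" "v \<in> {a..b}"
  shows "ip M (\<lambda>\<omega>. Xc t \<omega> u) (\<lambda>\<omega>. Xc (t + int k) \<omega> v) = Mk k u v"
  using assms Mk_eq[of u v t k] by (simp add: ip_def Xc_def m_eq)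

text \<open>At positive lags C4 and the uncorrelated noise remove every term containing
  \<open>eps\<close>, so observed and latent lagged covariances agree. At lag 0 the noise variance
  would remain, which is why K starts with k = 1.\<close>

lemma Mk_Z:
  assumes uv: "u \<in> {a..b}" "v \<in> {a..b}" and k: "k \<ge> 1"
  shows "ip M (\<lambda>\<omega>. Z t \<omega> u) (\<lambda>\<omega>. Z (t + int k) \<omega> v) = Mk k u v"
proof -
  have "ip M (\<lambda>\<omega>. Xc t \<omega> u) (\<lambda>\<omega>. eps (t + int k) \<omega> v) = 0"
    using C4[OF uv] by (simp add: ip_def Xc_def m_eq[OF uv(1)])
  moreover have "ip M (\<lambda>\<omega>. eps t \<omega> u) (\<lambda>\<omega>. Xc (t + int k) \<omega> v) = 0"
    using C4[OF uv(2,1)] by (subst ip_commute) (simp add: ip_def Xc_def m_eq[OF uv(2)])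
  moreover have "ip M (\<lambda>\<omega>. eps t \<omega> u) (\<lambda>\<omega>. eps (t + int k) \<omega> v) = 0"
    using eps_uncorr[OF _ uv, of t "t + int k"] k by (simp add: ip_def)
  ultimately show ?thesis
    unfolding Z_eq using uv
    by (simp add: ip_add_left ip_add_right sqint_Xc sqint_eps sqint_add Mk_Xc)
qed

lemma
  shows sqint_MI_X: "sqint (M \<Otimes>\<^sub>M I) (\<lambda>(\<omega>, u). X t \<omega> u)"
    and sqint_MI_eps: "sqint (M \<Otimes>\<^sub>M I) (\<lambda>(\<omega>, u). eps t \<omega> u)"
proof -
  let ?f = "\<lambda>(\<omega>, u). ennreal ((X t \<omega> u)\<^sup>2 + (eps t \<omega> u)\<^sup>2)"
  have "(\<integral>\<^sup>+z. ?f z \<partial>(M \<Otimes>\<^sub>M I)) = (\<integral>\<^sup>+u. (\<integral>\<^sup>+\<omega>. ennreal ((X t \<omega> u)^2 + (eps t \<omega> u)^2) \<partial>M) \<partial>I)"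
    using MI.nn_integral_snd[of ?f] by simp
  also have "\<dots> < \<infinity>"
    using moment[of t] by (simp add: nn_integral_restrict_space)
  finally have fin: "(\<integral>\<^sup>+z. ?f z \<partial>(M \<Otimes>\<^sub>M I)) < \<infinity>" .
  have *: "integrable (M \<Otimes>\<^sub>M I) (\<lambda>z. (case z of (\<omega>, u) \<Rightarrow> g \<omega> u)\<^sup>2)"
    if [measurable]: "(\<lambda>(\<omega>, u). g \<omega> u) \<in> borel_measurable (M \<Otimes>\<^sub>M I)"
      and "\<And>\<omega> u. (g \<omega> u)\<^sup>2 \<le> (X t \<omega> u)\<^sup>2 + (eps t \<omega> u)\<^sup>2" for g
  proof (rule integrableI_bounded)
    have "(\<integral>\<^sup>+z. ennreal (norm ((case z of (\<omega>, u) \<Rightarrow> g \<omega> u)\<^sup>2)) \<partial>(M \<Otimes>\<^sub>M I)) \<le> (\<integral>\<^sup>+z. ?f z \<partial>(M \<Otimes>\<^sub>M I))"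
      using that(2) by (intro nn_integral_mono) (auto intro!: ennreal_leI simp del: ennreal_plus)
    from le_less_trans[OF this fin]
    show "(\<integral>\<^sup>+z. ennreal (norm ((case z of (\<omega>, u) \<Rightarrow> g \<omega> u)\<^sup>2)) \<partial>(M \<Otimes>\<^sub>M I)) < \<infinity>" .
  qed simp
  show "sqint (M \<Otimes>\<^sub>M I) (\<lambda>(\<omega>, u). X t \<omega> u)"
    unfolding sqint_def by (intro conjI X_I *) simp_all
  show "sqint (M \<Otimes>\<^sub>M I) (\<lambda>(\<omega>, u). eps t \<omega> u)"
    unfolding sqint_def by (intro conjI eps_I *) simp_all
qed

lemma sqint_I_m: "sqint I m"
proof (rule sqint_dominated(1))
  show "sqint I (\<lambda>u. nrm M (\<lambda>\<omega>. X 0 \<omega> u))"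
    using sqint_row_nrm(1)[OF sfI sfM, of "\<lambda>u \<omega>. X 0 \<omega> u"] sqint_transpose(1)[OF sfM sfI sqint_MI_X[of 0]]
    by simp
  show "m \<in> borel_measurable I"
  proof -
    have "(\<lambda>(u, \<omega>). X 0 \<omega> u) \<in> borel_measurable (I \<Otimes>\<^sub>M M)"
      using measurable_pair_swap[OF X_I[of 0]] by simp
    then show ?thesis unfolding m_def[abs_def] by (rule borel_measurable_lebesgue_integral)
  qed
  have "\<bar>m u\<bar> \<le> \<bar>nrm M (\<lambda>\<omega>. X 0 \<omega> u)\<bar>" if "u \<in> space I" for u
  proof -
    have u: "u \<in> {a..b}" using that by (simp add: space_Iab)
    have "nrm M (\<lambda>\<omega>. 1) = 1" by (simp add: nrm_def ip_def prob_space)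
    then show ?thesis
      using ip_Cauchy_Schwarz[OF sqint_X[OF u, of 0] sqint_const[of 1]]
      by (simp add: m_def ip_def nrm_nonneg)
  qed
  then show "AE u in I. \<bar>m u\<bar> \<le> \<bar>nrm M (\<lambda>\<omega>. X 0 \<omega> u)\<bar>" by (intro AE_I2)
qed

lemma sqint_MI_m: "sqint (M \<Otimes>\<^sub>M I) (\<lambda>(\<omega>, u). m u)"
  using sqint_tensor(1)[OF sfM sfI sqint_const[of 1] sqint_I_m] by simp

lemma sqint_MI_Xc: "sqint (M \<Otimes>\<^sub>M I) (\<lambda>(\<omega>, u). Xc t \<omega> u)"
  using sqint_diff[OF sqint_MI_X[of t] sqint_MI_m] by (simp add: Xc_def[abs_def] split_beta')

lemma sqint_MI_Z: "sqint (M \<Otimes>\<^sub>M I) (\<lambda>(\<omega>, u). Z t \<omega> u)"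
  using sqint_add[OF sqint_MI_Xc[of t] sqint_MI_eps[of t]] by (simp add: Z_eq[abs_def] split_beta')

text \<open>Views \<open>Mk k\<close> as a composition through the sample space. Its form then
  becomes the covariance of two scores of X, and \<open>sqint_kcomp\<close> gives its square
  integrability.\<close>

lemma kernel_eq_kcomp:
  assumes "x \<in> space (I \<Otimes>\<^sub>M I)"
  shows "case_prod (Mk k) x = case_prod (kcomp M (\<lambda>u \<omega>. Xc 0 \<omega> u) (\<lambda>u \<omega>. Xc (int k) \<omega> u)) x"
  using assms Mk_Xc[of "fst x" "snd x" 0 k]
  by (auto simp: space_pair_measure space_Iab kcomp_def ip_def split_beta)

lemma sqint_Xc_swap: "sqint (I \<Otimes>\<^sub>M M) (case_prod (\<lambda>u \<omega>. Xc t \<omega> u))"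
  using sqint_transpose(1)[OF sfM sfI sqint_MI_Xc[of t]] by simp

lemma sqint_Mk: "sqint (I \<Otimes>\<^sub>M I) (case_prod (Mk k))"
  by (subst sqint_cong[OF kernel_eq_kcomp]) (auto intro: sqint_kcomp[OF sfI sfI sfM sqint_Xc_swap sqint_Xc_swap])

lemma kform_Mk:
  assumes "sqint I f" "sqint I g"
  shows "kform I I (Mk k) f g = ip M (kap I (Xc 0) f) (kap I (Xc (int k)) g)"
proof -
  have "kform I I (Mk k) f g = kform I I (kcomp M (\<lambda>u \<omega>. Xc 0 \<omega> u) (\<lambda>u \<omega>. Xc (int k) \<omega> u)) f g"
    unfolding kform_def by (rule ip_cong[OF kernel_eq_kcomp refl])
  also have "\<dots> = ip M (kap I (\<lambda>\<omega> u. Xc 0 \<omega> u) f) (kap I (\<lambda>\<omega> u. Xc (int k) \<omega> u) g)"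
    by (rule kform_kcomp[OF sfI sfI sfM sqint_Xc_swap sqint_Xc_swap assms])
  finally show ?thesis .
qed

text \<open>The hypothesis \<open>ker\<close> says that the score of \<open>Xc 0\<close> along f has
  zero second moment; Cauchy-Schwarz then kills its covariance with any score at any lag.\<close>

lemma kform_Mk_eq_0:
  assumes f: "sqint I f" and g: "sqint I g" and ker: "kform I I (Mk 0) f f = 0"
  shows "kform I I (Mk k) f g = 0"
proof -
  have "nrm M (kap I (Xc 0) f) = 0"
    using ker kform_Mk[OF f f, of 0] by (simp add: nrm_def)
  then show ?thesis
    unfolding kform_Mk[OF f g]
    by (intro ip_eq_0_if_nrm_eq_0 sqint_kap[OF sfM sfI] sqint_MI_Xc f g)
qed

subsection \<open>Fourth moments\<close>

text \<open>With \<open>A t\<close> the squared path norm of \<open>Z t\<close>, integrating the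
  squared product over the square gives \<open>A s * A t\<close>, whose mean is bounded by the
  second moments of both. C2 concerns Y, so centring is paid for by \<open>A_le\<close>. Extended
  reals postpone all questions of integrability.\<close>

lemma sqint_ZZ: "sqint (M \<Otimes>\<^sub>M (I \<Otimes>\<^sub>M I)) (\<lambda>(\<omega>, u, v). Z s \<omega> u * Z t \<omega> v)"
proof -
  have Zm[measurable]: "(\<lambda>(\<omega>, u). Z t \<omega> u) \<in> borel_measurable (M \<Otimes>\<^sub>M I)" for t
    using sqint_MI_Z by (rule sqint_measurable)
  have Zw: "(\<lambda>u. Z t \<omega> u) \<in> borel_measurable I" if "\<omega> \<in> space M" for t \<omega>
    using measurable_Pair2[OF Zm[of t] that] by simp
  have mm[measurable]: "m \<in> borel_measurable I" using sqint_I_m by (rule sqint_measurable)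
  define A where "A t \<omega> = (\<integral>\<^sup>+u. ennreal ((Z t \<omega> u)\<^sup>2) \<partial>I)" for t \<omega>
  define y where "y t \<omega> = (\<integral>\<^sup>+u. ennreal ((Y t \<omega> u)\<^sup>2) \<partial>I)" for t \<omega>
  define c where "c = (\<integral>\<^sup>+u. ennreal ((m u)\<^sup>2) \<partial>I)"
  have Am[measurable]: "A t \<in> borel_measurable M" for t
    unfolding A_def[abs_def] by measurable
  have cfin: "c < \<infinity>"
    using sqint_I_m unfolding c_def sqint_def by (simp add: integrable_iff_bounded)
  have [measurable]: "(\<lambda>(\<omega>, u). Y t \<omega> u) \<in> borel_measurable (M \<Otimes>\<^sub>M I)" for t
    unfolding Y_def by measurable
  have Yw: "(\<lambda>u. Y t \<omega> u) \<in> borel_measurable I" if "\<omega> \<in> space M" for t \<omega>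
    using measurable_Pair2[OF \<open>(\<lambda>(\<omega>, u). Y t \<omega> u) \<in> borel_measurable (M \<Otimes>\<^sub>M I)\<close> that] by simp
  have ym[measurable]: "y t \<in> borel_measurable M" for t
    unfolding y_def[abs_def] by measurable
  \<comment> \<open>Argued through the maximum, since the usual square-of-a-difference argument has
    no counterpart in extended nonnegative reals.\<close>
  have sq_sum: "(x + z)\<^sup>2 \<le> 4 * (x\<^sup>2 + z\<^sup>2)" for x z :: ennreal
  proof -
    have "(x + z)\<^sup>2 \<le> (2 * max x z)\<^sup>2"
      unfolding mult_2 by (intro power_mono add_mono) auto
    also have "\<dots> = 4 * (max x z)\<^sup>2" by (simp add: power_mult_distrib)
    also have "(max x z)\<^sup>2 \<le> x\<^sup>2 + z\<^sup>2" by (auto simp: max_def)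
    finally show ?thesis by (simp add: mult_left_mono)
  qed
  have prod_le: "x * z \<le> x\<^sup>2 + z\<^sup>2" for x z :: ennreal
  proof -
    have "x * z \<le> (max x z)\<^sup>2" unfolding power2_eq_square by (intro mult_mono) auto
    also have "\<dots> \<le> x\<^sup>2 + z\<^sup>2" by (auto simp: max_def)
    finally show ?thesis .
  qed
  have A_le: "A t \<omega> \<le> 2 * y t \<omega> + 2 * c" if w: "\<omega> \<in> space M" for t \<omega>
  proof -
    have "A t \<omega> \<le> (\<integral>\<^sup>+u. 2 * ennreal ((Y t \<omega> u)\<^sup>2) + 2 * ennreal ((m u)\<^sup>2) \<partial>I)"
      unfolding A_def
    proof (rule nn_integral_mono)
      fix u
      have "(Z t \<omega> u)\<^sup>2 \<le> 2 * (Y t \<omega> u)\<^sup>2 + 2 * (m u)\<^sup>2"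
        using zero_le_power2[of "Y t \<omega> u + m u"] by (simp add: Z_def power2_sum power2_diff)
      then have "ennreal ((Z t \<omega> u)\<^sup>2) \<le> ennreal (2 * (Y t \<omega> u)\<^sup>2 + 2 * (m u)\<^sup>2)" by (rule ennreal_leI)
      then show "ennreal ((Z t \<omega> u)\<^sup>2) \<le> 2 * ennreal ((Y t \<omega> u)\<^sup>2) + 2 * ennreal ((m u)\<^sup>2)"
        by (simp add: ennreal_mult)
    qed
    also have "\<dots> = 2 * y t \<omega> + 2 * c"
      using Yw[OF w] by (simp add: nn_integral_add nn_integral_cmult y_def c_def)
    finally show ?thesis .
  qed
  have A2: "(\<integral>\<^sup>+\<omega>. (A t \<omega>)\<^sup>2 \<partial>M) < \<infinity>" for t
  proof -
    have "(\<integral>\<^sup>+\<omega>. (A t \<omega>)\<^sup>2 \<partial>M) \<le> (\<integral>\<^sup>+\<omega>. 4 * (4 * (y t \<omega>)\<^sup>2 + 4 * c\<^sup>2) \<partial>M)"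
    proof (rule nn_integral_mono)
      fix \<omega> assume w: "\<omega> \<in> space M"
      have "(A t \<omega>)\<^sup>2 \<le> (2 * y t \<omega> + 2 * c)\<^sup>2" by (intro power_mono A_le w) simp
      also have "\<dots> \<le> 4 * ((2 * y t \<omega>)\<^sup>2 + (2 * c)\<^sup>2)" by (rule sq_sum)
      finally show "(A t \<omega>)\<^sup>2 \<le> 4 * (4 * (y t \<omega>)\<^sup>2 + 4 * c\<^sup>2)" by (simp add: power_mult_distrib)
    qed
    also have "\<dots> = 4 * (4 * (\<integral>\<^sup>+\<omega>. (y t \<omega>)\<^sup>2 \<partial>M) + 4 * c\<^sup>2)"
      by (simp add: nn_integral_cmult nn_integral_add emeasure_space_1)
    also have "\<dots> < \<infinity>"
      using C2[of t] cfin
      by (simp add: y_def nn_integral_restrict_space ennreal_mult_less_top power2_eq_square)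
    finally show ?thesis .
  qed
  have [measurable]: "(\<lambda>(\<omega>, u, v). Z s \<omega> u) \<in> borel_measurable (M \<Otimes>\<^sub>M (I \<Otimes>\<^sub>M I))"
    "(\<lambda>(\<omega>, u, v). Z t \<omega> v) \<in> borel_measurable (M \<Otimes>\<^sub>M (I \<Otimes>\<^sub>M I))"
  proof -
    have "(\<lambda>z. (fst z, fst (snd z))) \<in> measurable (M \<Otimes>\<^sub>M (I \<Otimes>\<^sub>M I)) (M \<Otimes>\<^sub>M I)" by measurable
    from measurable_compose[OF this Zm[of s]]
    show "(\<lambda>(\<omega>, u, v). Z s \<omega> u) \<in> borel_measurable (M \<Otimes>\<^sub>M (I \<Otimes>\<^sub>M I))" by (simp add: split_beta')
    have "(\<lambda>z. (fst z, snd (snd z))) \<in> measurable (M \<Otimes>\<^sub>M (I \<Otimes>\<^sub>M I)) (M \<Otimes>\<^sub>M I)" by measurable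
    from measurable_compose[OF this Zm[of t]]
    show "(\<lambda>(\<omega>, u, v). Z t \<omega> v) \<in> borel_measurable (M \<Otimes>\<^sub>M (I \<Otimes>\<^sub>M I))" by (simp add: split_beta')
  qed
  have ZZm[measurable]: "(\<lambda>(\<omega>, u, v). Z s \<omega> u * Z t \<omega> v) \<in> borel_measurable (M \<Otimes>\<^sub>M (I \<Otimes>\<^sub>M I))"
    using borel_measurable_times[OF \<open>(\<lambda>(\<omega>, u, v). Z s \<omega> u) \<in> _\<close> \<open>(\<lambda>(\<omega>, u, v). Z t \<omega> v) \<in> _\<close>]
    by (simp add: split_beta')
  have inner: "(\<integral>\<^sup>+x. ennreal ((case x of (u, v) \<Rightarrow> Z s \<omega> u * Z t \<omega> v)\<^sup>2) \<partial>(I \<Otimes>\<^sub>M I)) = A s \<omega> * A t \<omega>"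
    if w: "\<omega> \<in> space M" for \<omega>
  proof -
    note [measurable] = Zw[OF w]
    have "(\<integral>\<^sup>+x. ennreal ((case x of (u, v) \<Rightarrow> Z s \<omega> u * Z t \<omega> v)\<^sup>2) \<partial>(I \<Otimes>\<^sub>M I))
        = (\<integral>\<^sup>+u. (\<integral>\<^sup>+v. ennreal ((Z s \<omega> u * Z t \<omega> v)\<^sup>2) \<partial>I) \<partial>I)"
      using I.nn_integral_fst[of "\<lambda>x. ennreal ((case x of (u, v) \<Rightarrow> Z s \<omega> u * Z t \<omega> v)\<^sup>2)" I, symmetric] by simp
    also have "\<dots> = (\<integral>\<^sup>+u. ennreal ((Z s \<omega> u)\<^sup>2) * A t \<omega> \<partial>I)"
      unfolding A_def by (simp add: power_mult_distrib ennreal_mult nn_integral_cmult)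
    also have "\<dots> = A s \<omega> * A t \<omega>"
      unfolding A_def[of s] by (rule nn_integral_multc) simp
    finally show ?thesis .
  qed
  have "(\<integral>\<^sup>+z. ennreal ((case z of (\<omega>, u, v) \<Rightarrow> Z s \<omega> u * Z t \<omega> v)\<^sup>2) \<partial>(M \<Otimes>\<^sub>M (I \<Otimes>\<^sub>M I)))
      = (\<integral>\<^sup>+\<omega>. (\<integral>\<^sup>+x. ennreal ((case x of (u, v) \<Rightarrow> Z s \<omega> u * Z t \<omega> v)\<^sup>2) \<partial>(I \<Otimes>\<^sub>M I)) \<partial>M)"
    using sigma_finite_measure.nn_integral_fst[OF sfII, of "\<lambda>z. ennreal ((case z of (\<omega>, u, v) \<Rightarrow> Z s \<omega> u * Z t \<omega> v)\<^sup>2)" M, symmetric] by simp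
  also have "\<dots> = (\<integral>\<^sup>+\<omega>. A s \<omega> * A t \<omega> \<partial>M)"
    by (intro nn_integral_cong inner)
  also have "\<dots> \<le> (\<integral>\<^sup>+\<omega>. (A s \<omega>)\<^sup>2 + (A t \<omega>)\<^sup>2 \<partial>M)"
    by (intro nn_integral_mono prod_le)
  also have "\<dots> < \<infinity>" using A2 by (simp add: nn_integral_add)
  finally have "integrable (M \<Otimes>\<^sub>M (I \<Otimes>\<^sub>M I)) (\<lambda>z. (case z of (\<omega>, u, v) \<Rightarrow> Z s \<omega> u * Z t \<omega> v)\<^sup>2)"
    by (intro integrableI_bounded) simp_all
  with ZZm show ?thesis by (simp add: sqint_def)
qed

end

context functional_factor_model
begin

subsection \<open>Weak dependence\<close>

definition sd :: "real \<Rightarrow> real" where "sd u = nrm M (\<lambda>\<omega>. Z 0 \<omega> u)"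
definition rho :: "nat \<Rightarrow> real" where
  "rho l = (if l = 0 then 0 else real_of_ereal (psi_coef M a b Y l))"

lemma psi_fin: "l \<ge> 1 \<Longrightarrow> psi_coef M a b Y l \<noteq> \<infinity>"
  using mixing by (simp add: psi_mixing_C1_def)

lemma rho_nonneg: "0 \<le> rho l"
  using psi_coef_nonneg[OF Y_u psi_fin, of l] by (simp add: rho_def)

lemma summable_rho: "summable rho"
  unfolding rho_def[abs_def]
  by (rule summable_psi_coef[OF mixing]) (rule psi_coef_nonneg[OF Y_u psi_fin])

text \<open>Centring f removes the product of means from the mixing inequality, leaving a bound for
  the mixed moment itself.\<close>

lemma covariance_le:
  assumes l: "l \<ge> 1" and f: "f \<in> borel_measurable (Fsig M a b Y {..0})" "integrable M f" "(\<integral>\<omega>. f \<omega> \<partial>M) = 0"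
    and g: "g \<in> borel_measurable (Fsig M a b Y {int l..})" "integrable M g"
    and F: "(\<integral>\<omega>. \<bar>f \<omega>\<bar> \<partial>M) \<le> s" and G: "(\<integral>\<omega>. \<bar>g \<omega>\<bar> \<partial>M) \<le> s"
  shows "\<bar>\<integral>\<omega>. f \<omega> * g \<omega> \<partial>M\<bar> \<le> rho l * s\<^sup>2"
proof -
  have r: "rho l = real_of_ereal (psi_coef M a b Y l)" using l by (simp add: rho_def)
  have "\<bar>(\<integral>x. f x * g x \<partial>M) - (\<integral>x. f x \<partial>M) * (\<integral>x. g x \<partial>M)\<bar> \<le> rho l * ((\<integral>x. \<bar>f x\<bar> \<partial>M) * (\<integral>x. \<bar>g x\<bar> \<partial>M))"
    by (rule mixing_covariance[OF subalgebra_Fsig[OF Y_u] subalgebra_Fsig[OF Y_u] rho_nonneg _ f(1,2) g])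
      (unfold r, rule psi_coef_mixing[OF Y_u psi_fin[OF l]])
  also have "\<dots> \<le> rho l * (s * s)"
  proof -
    have "0 \<le> s" by (rule order_trans[OF integral_nonneg_AE F]) simp
    then show ?thesis using F G by (intro mult_left_mono mult_mono rho_nonneg) auto
  qed
  finally show ?thesis by (simp add: f(3) power2_eq_square)
qed

lemma expectation_abs_le:
  assumes "sqint M f" shows "(\<integral>\<omega>. \<bar>f \<omega>\<bar> \<partial>M) \<le> nrm M f"
proof -
  have "sqint M (\<lambda>\<omega>. \<bar>f \<omega>\<bar>)" using assms by (auto simp: sqint_def)
  moreover have "nrm M (\<lambda>\<omega>. \<bar>f \<omega>\<bar>) = nrm M f" by (simp add: nrm_def ip_def)
  moreover have "nrm M (\<lambda>\<omega>. 1) = 1" by (simp add: nrm_def ip_def prob_space)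
  ultimately show ?thesis
    using ip_Cauchy_Schwarz[OF _ sqint_const[of 1], of "\<lambda>\<omega>. \<bar>f \<omega>\<bar>"] by (simp add: ip_def)
qed

lemma nrm_Z:
  assumes "u \<in> {a..b}" shows "nrm M (\<lambda>\<omega>. Z t \<omega> u) = sd u"
  using stationary_lagged_products(1)[OF stationary assms assms Y_u, of 0 t m 0]
  by (simp add: sd_def nrm_def ip_def Z_def)

lemma measurable_Z_Fsig:
  "t \<in> S \<Longrightarrow> u \<in> {a..b} \<Longrightarrow> (\<lambda>\<omega>. Z t \<omega> u) \<in> borel_measurable (Fsig M a b Y S)"
  unfolding Z_def by (intro borel_measurable_diff measurable_Fsig borel_measurable_const)

lemma covariance_Z:
  assumes u: "u \<in> {a..b}" and h: "h \<ge> 1"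
  shows "\<bar>\<integral>\<omega>. Z i \<omega> u * Z (i + int h) \<omega> u \<partial>M\<bar> \<le> rho h * (sd u)\<^sup>2"
proof -
  \<comment> \<open>The coefficient \<open>psi_coef\<close> compares the past up to time 0 with the
    future from l, so the pair is first moved to time 0.\<close>
  have shift: "(\<integral>\<omega>. Z i \<omega> u * Z (i + int h) \<omega> u \<partial>M) = (\<integral>\<omega>. Z 0 \<omega> u * Z (int h) \<omega> u \<partial>M)"
    using stationary_lagged_products(1)[OF stationary u u Y_u, of 0 i m "int h"]
    by (simp add: Z_def add.commute)
  show ?thesis unfolding shift
    by (rule covariance_le[OF h])
      (use u expectation_abs_le[OF sqint_Z[OF u]] in
        \<open>auto intro!: measurable_Z_Fsig sqint_imp_integrable sqint_Z expectation_Z simp: nrm_Z\<close>)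
qed

definition W :: "nat \<Rightarrow> int \<Rightarrow> 'w \<times> real \<times> real \<Rightarrow> real" where
  "W k i = (\<lambda>(\<omega>, u, v). Z i \<omega> u * Z (i + int k) \<omega> v - Mk k u v)"

text \<open>The mean of the absolute value of \<open>W\<close> is at most that of the product of the
  two \<open>Z\<close> plus \<open>\<bar>Mk k u v\<bar>\<close>; each is at most
  \<open>sd u * sd v\<close>, whence the factor 2.\<close>

lemma covariance_W:
  assumes uv: "u \<in> {a..b}" "v \<in> {a..b}" and k: "k \<ge> 1" and h: "h \<ge> 1"
  shows "\<bar>\<integral>\<omega>. W k i (\<omega>, u, v) * W k (i + int (k + h)) (\<omega>, u, v) \<partial>M\<bar> \<le> rho h * (2 * (sd u * sd v))\<^sup>2"
proof -
  \<comment> \<open>\<open>W k i\<close> reaches forward to time i + k. Moving i to -k makes the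
    first factor end at time 0 and the second start at h, so the gap seen by mixing is h.\<close>
  have shift: "(\<integral>\<omega>. W k i (\<omega>, u, v) * W k (i + int (k + h)) (\<omega>, u, v) \<partial>M)
      = (\<integral>\<omega>. W k (- int k) (\<omega>, u, v) * W k (int h) (\<omega>, u, v) \<partial>M)"
    using stationary_lagged_products(2)[OF stationary uv Y_u, of "- int k" "i + int k" m "int k" "Mk k u v" "int h"]
    by (simp add: W_def Z_def add_ac)
  show ?thesis unfolding shift
  proof (rule covariance_le[OF h])
    have int: "integrable M (\<lambda>\<omega>. Z s \<omega> u * Z t \<omega> v)" for s t
      by (rule sqint_mult_integrable[OF sqint_Z[OF uv(1)] sqint_Z[OF uv(2)]])
    show "integrable M (\<lambda>\<omega>. W k (- int k) (\<omega>, u, v))" "integrable M (\<lambda>\<omega>. W k (int h) (\<omega>, u, v))"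
      using int by (simp_all add: W_def)
    have mean: "(\<integral>\<omega>. Z j \<omega> u * Z (j + int k) \<omega> v \<partial>M) = Mk k u v" for j
      using Mk_Z[OF uv k] by (simp add: ip_def)
    have "(\<integral>\<omega>. W k (- int k) (\<omega>, u, v) \<partial>M) = (\<integral>\<omega>. Z (- int k) \<omega> u * Z (- int k + int k) \<omega> v \<partial>M) - Mk k u v"
      unfolding W_def using int by (simp add: prob_space)
    then show "(\<integral>\<omega>. W k (- int k) (\<omega>, u, v) \<partial>M) = 0" unfolding mean by simp
    have WF: "(\<lambda>\<omega>. W k j (\<omega>, u, v)) \<in> borel_measurable (Fsig M a b Y S)" if "j \<in> S" "j + int k \<in> S" for j S
      unfolding W_def split using uv that
      by (intro borel_measurable_diff borel_measurable_times measurable_Z_Fsig borel_measurable_const)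
    show "(\<lambda>\<omega>. W k (- int k) (\<omega>, u, v)) \<in> borel_measurable (Fsig M a b Y {..0})"
      "(\<lambda>\<omega>. W k (int h) (\<omega>, u, v)) \<in> borel_measurable (Fsig M a b Y {int h..})"
      by (auto intro!: WF)
    have Mk_le: "\<bar>Mk k u v\<bar> \<le> sd u * sd v"
      using ip_Cauchy_Schwarz[OF sqint_Z[OF uv(1)] sqint_Z[OF uv(2)], of 0 "0 + int k"] Mk_Z[OF uv k, of 0]
      by (simp add: nrm_Z[OF uv(1)] nrm_Z[OF uv(2)])
    have abs_le: "(\<integral>\<omega>. \<bar>W k j (\<omega>, u, v)\<bar> \<partial>M) \<le> 2 * (sd u * sd v)" for j
    proof -
      have "(\<integral>\<omega>. \<bar>W k j (\<omega>, u, v)\<bar> \<partial>M) \<le> (\<integral>\<omega>. \<bar>Z j \<omega> u\<bar> * \<bar>Z (j + int k) \<omega> v\<bar> + \<bar>Mk k u v\<bar> \<partial>M)"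
        using int[of j "j + int k"]
        by (intro integral_mono) (auto simp: W_def abs_mult[symmetric] intro!: order_trans[OF abs_triangle_ineq4])
      also have "\<dots> = ip M (\<lambda>\<omega>. \<bar>Z j \<omega> u\<bar>) (\<lambda>\<omega>. \<bar>Z (j + int k) \<omega> v\<bar>) + \<bar>Mk k u v\<bar>"
        using int[of j "j + int k"] by (simp add: ip_def abs_mult[symmetric] prob_space)
      also have "ip M (\<lambda>\<omega>. \<bar>Z j \<omega> u\<bar>) (\<lambda>\<omega>. \<bar>Z (j + int k) \<omega> v\<bar>) \<le> sd u * sd v"
      proof -
        have "sqint M (\<lambda>\<omega>. \<bar>f \<omega>\<bar>)" "nrm M (\<lambda>\<omega>. \<bar>f \<omega>\<bar>) = nrm M f" if "sqint M f" for f
          using that by (auto simp: sqint_def nrm_def ip_def)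
        note ab = this[OF sqint_Z[OF uv(1), of j]] this[OF sqint_Z[OF uv(2), of "j + int k"]]
        show ?thesis using ip_Cauchy_Schwarz[OF ab(1,3)] unfolding ab(2,4) by (simp add: nrm_Z[OF uv(1)] nrm_Z[OF uv(2)])
      qed
      finally show ?thesis using Mk_le by linarith
    qed
    show "(\<integral>\<omega>. \<bar>W k (- int k) (\<omega>, u, v)\<bar> \<partial>M) \<le> 2 * (sd u * sd v)"
      "(\<integral>\<omega>. \<bar>W k (int h) (\<omega>, u, v)\<bar> \<partial>M) \<le> 2 * (sd u * sd v)"
      by (rule abs_le)+
  qed
qed

lemma sqint_sd: "sqint I sd"
  using sqint_row_nrm(1)[OF sfI sfM, of "\<lambda>u \<omega>. Z 0 \<omega> u"] sqint_transpose(1)[OF sfM sfI sqint_MI_Z[of 0]]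
  by (simp add: sd_def[abs_def])

lemma sqint_W: "sqint (M \<Otimes>\<^sub>M (I \<Otimes>\<^sub>M I)) (W k i)"
proof -
  have "sqint (M \<Otimes>\<^sub>M (I \<Otimes>\<^sub>M I)) (\<lambda>(\<omega>, u, v). Mk k u v)"
    using sqint_tensor(1)[OF sfM sfII sqint_const[of 1] sqint_Mk[of k]] by (simp add: split_beta')
  from sqint_diff[OF sqint_ZZ[of i "i + int k"] this] show ?thesis
    by (simp add: W_def split_beta')
qed

lemma bigOp_average_Z:
  "bigOp M (\<lambda>n \<omega>. nrm I (\<lambda>u. (\<Sum>j=1..n-p. Z (int j + s) \<omega> u) / (real n - real p))) (\<lambda>n. 1 / sqrt (real n))"
proof -
  define V where "V i = (\<lambda>(\<omega>, u). Z i \<omega> u)" for i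
  have V: "sqint (M \<Otimes>\<^sub>M I) (V i)" for i
    unfolding V_def by (rule sqint_MI_Z)
  obtain c where c: "\<And>m s. (nrm (M \<Otimes>\<^sub>M I) (\<lambda>z. \<Sum>j=1..m. V (int j + s) z))\<^sup>2 \<le> real m * c"
  proof (rule weakly_dependent_field_sum[OF sfI V, where k = 0 and \<rho> = rho and w = "\<lambda>u. (sd u)\<^sup>2"])
    fix i u assume "u \<in> space I"
    then have u: "u \<in> {a..b}" by (simp add: space_Iab)
    show "(\<integral>\<omega>. (V i (\<omega>, u))\<^sup>2 \<partial>M) = (\<integral>\<omega>. (V 0 (\<omega>, u))\<^sup>2 \<partial>M)"
      using nrm_Z[OF u, of i] nrm_Z[OF u, of 0] unfolding V_def split nrm_sq_integral[symmetric] by simp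
    fix h :: nat assume h: "h \<ge> 1"
    show "\<bar>\<integral>\<omega>. V i (\<omega>, u) * V (i + int (0 + h)) (\<omega>, u) \<partial>M\<bar> \<le> rho h * (sd u)\<^sup>2"
      using covariance_Z[OF u h, of i] by (simp add: V_def)
  qed (use summable_rho rho_nonneg sqint_sd in \<open>auto simp: sqint_def\<close>)
  from bigOp_average[OF sfI V c] show ?thesis by (simp add: V_def)
qed

lemma bigOp_average_W:
  assumes k: "k \<ge> 1"
  shows "bigOp M (\<lambda>n \<omega>. nrm (I \<Otimes>\<^sub>M I) (\<lambda>(u, v). (\<Sum>j=1..n-p. W k (int j) (\<omega>, u, v)) / (real n - real p))) (\<lambda>n. 1 / sqrt (real n))"
proof -
  have sdsd: "sqint (I \<Otimes>\<^sub>M I) (\<lambda>(u, v). sd u * sd v)" by (rule sqint_tensor(1)[OF sfI sfI sqint_sd sqint_sd])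
  obtain c where c: "\<And>m s. (nrm (M \<Otimes>\<^sub>M (I \<Otimes>\<^sub>M I)) (\<lambda>z. \<Sum>j=1..m. W k (int j + s) z))\<^sup>2 \<le> real m * c"
  proof (rule weakly_dependent_field_sum[OF sfII sqint_W[of k], where k = k and \<rho> = rho and w = "\<lambda>x. (2 * (sd (fst x) * sd (snd x)))\<^sup>2"])
    fix i and x :: "real \<times> real" assume "x \<in> space (I \<Otimes>\<^sub>M I)"
    then have x: "fst x \<in> {a..b}" "snd x \<in> {a..b}" by (auto simp: space_pair_measure space_Iab)
    show "(\<integral>\<omega>. (W k i (\<omega>, x))\<^sup>2 \<partial>M) = (\<integral>\<omega>. (W k 0 (\<omega>, x))\<^sup>2 \<partial>M)"
      using stationary_lagged_products(2)[OF stationary x Y_u, of 0 i m "int k" "Mk k (fst x) (snd x)" 0]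
      by (simp add: W_def Z_def split_beta power2_eq_square add.commute)
    fix h :: nat assume h: "h \<ge> 1"
    show "\<bar>\<integral>\<omega>. W k i (\<omega>, x) * W k (i + int (k + h)) (\<omega>, x) \<partial>M\<bar> \<le> rho h * (2 * (sd (fst x) * sd (snd x)))\<^sup>2"
      using covariance_W[OF x k h, of i] by simp
  next
    show "integrable (I \<Otimes>\<^sub>M I) (\<lambda>x. (2 * (sd (fst x) * sd (snd x)))\<^sup>2)"
      using sqint_cmult[OF sdsd, of 2] by (simp add: sqint_def split_beta')
  qed (use summable_rho rho_nonneg in auto)
  from bigOp_average[OF sfII sqint_W c, where p = p and s = 0] show ?thesis by (simp add: split_beta')
qed

subsection \<open>The lagged autocovariance estimators\<close>

text \<open>Times are countable, so a single null set serves all of them.\<close>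

lemma AE_sqint_Z: "AE \<omega> in M. \<forall>t. sqint I (Z t \<omega>)"
  unfolding AE_all_countable using sqint_section_AE[OF sfM sfI sqint_MI_Z] by simp

text \<open>\<open>avg 0 0 n\<close> is the centred sample mean for n > 0; \<open>avg p s n\<close>
  averages the n - p values in the window shifted by s.\<close>

definition avg :: "nat \<Rightarrow> int \<Rightarrow> nat \<Rightarrow> 'w \<Rightarrow> real \<Rightarrow> real" where
  "avg p s n \<omega> u = (\<Sum>j=1..n-p. Z (int j + s) \<omega> u) / (real n - real p)"

definition avgW :: "nat \<Rightarrow> nat \<Rightarrow> nat \<Rightarrow> 'w \<Rightarrow> real \<Rightarrow> real \<Rightarrow> real" where
  "avgW p k n \<omega> u v = (\<Sum>j=1..n-p. W k (int j) (\<omega>, u, v)) / (real n - real p)"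

text \<open>Expand the product of the two factors centred at the sample mean. The window averages
  differ from the full one, so the cross terms do not merge; each is a product of two averages and
  thus of second order, leaving \<open>avgW\<close> as the leading error.\<close>

lemma Mhat_decomposition:
  assumes n: "n > p"
  shows "Mhat Y p n k \<omega> u v - Mk k u v = avgW p k n \<omega> u v - avg 0 0 n \<omega> u * avg p (int k) n \<omega> v
    - avg p 0 n \<omega> u * avg 0 0 n \<omega> v + avg 0 0 n \<omega> u * avg 0 0 n \<omega> v"
proof -
  define z where "z = avg 0 0 n \<omega>"
  have Zz: "Y t \<omega> u - Ybar Y n \<omega> u = Z t \<omega> u - z u" for t u
    using n by (simp add: z_def avg_def Ybar_def Z_def sum_subtractf diff_divide_distrib)
  define r where "r = real n - real p"
  have r: "r > 0" "real (n - p) = r" using n by (auto simp: r_def)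
  define S1 where "S1 = (\<Sum>j=1..n-p. Z (int j) \<omega> u * Z (int j + int k) \<omega> v)"
  define S2 where "S2 = (\<Sum>j=1..n-p. Z (int j) \<omega> u)"
  define S3 where "S3 = (\<Sum>j=1..n-p. Z (int j + int k) \<omega> v)"
  have "(\<Sum>j=1..n-p. (Y (int j) \<omega> u - Ybar Y n \<omega> u) * (Y (int (j + k)) \<omega> v - Ybar Y n \<omega> v))
      = (\<Sum>j=1..n-p. Z (int j) \<omega> u * Z (int j + int k) \<omega> v - z u * Z (int j + int k) \<omega> v - Z (int j) \<omega> u * z v + z u * z v)"
    by (intro sum.cong) (auto simp: Zz algebra_simps)
  also have "\<dots> = S1 - z u * S3 - S2 * z v + r * (z u * z v)"
    by (simp add: sum.distrib sum_subtractf S1_def S2_def S3_def sum_distrib_left sum_distrib_right r)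
  finally have e1: "Mhat Y p n k \<omega> u v = (S1 - z u * S3 - S2 * z v + r * (z u * z v)) / r"
    by (simp add: Mhat_def r_def)
  have e2: "avgW p k n \<omega> u v = (S1 - r * Mk k u v) / r"
    by (simp add: avgW_def W_def sum_subtractf S1_def r flip: r_def)
  have e3: "avg p (int k) n \<omega> v = S3 / r" "avg p 0 n \<omega> u = S2 / r"
    by (simp_all add: avg_def S2_def S3_def r_def)
  show ?thesis unfolding e1 e2 e3 z_def[symmetric] using r by (simp add: field_simps)
qed

text \<open>The triangle inequality applied to \<open>Mhat_decomposition\<close>, with tensor norms
  factorised so that stochastic orders can be computed term by term.\<close>

definition qbound :: "nat \<Rightarrow> nat \<Rightarrow> nat \<Rightarrow> 'w \<Rightarrow> real" where
  "qbound p k n \<omega> = nrm (I \<Otimes>\<^sub>M I) (case_prod (avgW p k n \<omega>)) + nrm I (avg 0 0 n \<omega>) * nrm I (avg p (int k) n \<omega>)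
    + nrm I (avg p 0 n \<omega>) * nrm I (avg 0 0 n \<omega>) + nrm I (avg 0 0 n \<omega>) * nrm I (avg 0 0 n \<omega>)"

lemma bigOp_qbound:
  assumes k: "k \<ge> 1" shows "bigOp M (qbound p k) (\<lambda>n. 1 / sqrt (real n))"
proof -
  have Z: "bigOp M (\<lambda>n \<omega>. nrm I (avg p s n \<omega>)) (\<lambda>n. 1 / sqrt (real n))" for p s
    using bigOp_average_Z by (simp add: avg_def[abs_def])
  \<comment> \<open>These products have order 1/n, weakened here to the order of the leading
    term.\<close>
  have ZZ: "bigOp M (\<lambda>n \<omega>. nrm I (avg p s n \<omega>) * nrm I (avg p' s' n \<omega>)) (\<lambda>n. 1 / sqrt (real n))" for p s p' s'
  proof (rule bigOp_rate[OF bigOp_mult[OF Z Z]])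
    show "1 / sqrt (real n) * (1 / sqrt (real n)) \<le> 1 / sqrt (real n)" for n
    proof (cases "n = 0")
      case False
      then have "1 / sqrt (real n) \<le> 1" by simp
      then show ?thesis by (intro mult_left_le) auto
    qed simp
  qed auto
  have "bigOp M (\<lambda>n \<omega>. nrm (I \<Otimes>\<^sub>M I) (case_prod (avgW p k n \<omega>))) (\<lambda>n. 1 / sqrt (real n))"
    using bigOp_average_W[OF k, of p] by (simp add: avgW_def[abs_def])
  then show ?thesis
    unfolding qbound_def[abs_def] by (intro bigOp_add ZZ) auto
qed

lemma
  assumes Zs: "\<forall>t. sqint I (Z t \<omega>)" and n: "n > p"
  shows sqint_Mhat: "sqint (I \<Otimes>\<^sub>M I) (case_prod (\<lambda>u v. Mhat Y p n k \<omega> u v))"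
    and nrm_Mhat_diff: "nrm (I \<Otimes>\<^sub>M I) (\<lambda>(u, v). Mhat Y p n k \<omega> u v - Mk k u v) \<le> qbound p k n \<omega>"
proof -
  let ?P = "I \<Otimes>\<^sub>M I"
  have av: "sqint I (avg p s n \<omega>)" for p s
    using sqint_cmult[OF sqint_sum[of "{1..n-p}" I "\<lambda>j. Z (int j + s) \<omega>"], of "1 / (real n - real p)"] Zs
    by (simp add: avg_def[abs_def])
  have "sqint ?P (\<lambda>x. case x of (u, v) \<Rightarrow> W k (int j) (\<omega>, u, v))" for j
    using sqint_diff[OF sqint_tensor(1)[OF sfI sfI, of "Z (int j) \<omega>" "Z (int j + int k) \<omega>"] sqint_Mk[of k]] Zs
    by (simp add: W_def split_beta')
  then have aw: "sqint ?P (case_prod (avgW p k n \<omega>))"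
    using sqint_cmult[OF sqint_sum[of "{1..n-p}" ?P "\<lambda>j x. case x of (u, v) \<Rightarrow> W k (int j) (\<omega>, u, v)"], of "1 / (real n - real p)"]
    by (simp add: avgW_def[abs_def] split_beta')
  define z A B where "z = avg 0 0 n \<omega>" and "A = avg p 0 n \<omega>" and "B = avg p (int k) n \<omega>"
  note T = sqint_tensor[OF sfI sfI]
  have zAB: "sqint I z" "sqint I A" "sqint I B" by (simp_all add: z_def A_def B_def av)
  note zB = T[OF zAB(1,3)] and Az = T[OF zAB(2,1)] and zz = T[OF zAB(1,1)]
  have eq: "(\<lambda>(u, v). Mhat Y p n k \<omega> u v - Mk k u v)
      = (\<lambda>x. case_prod (avgW p k n \<omega>) x - (case x of (u, v) \<Rightarrow> z u * B v) - (case x of (u, v) \<Rightarrow> A u * z v) + (case x of (u, v) \<Rightarrow> z u * z v))"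
    by (auto simp: fun_eq_iff Mhat_decomposition[OF n] z_def A_def B_def)
  have d: "sqint ?P (\<lambda>(u, v). Mhat Y p n k \<omega> u v - Mk k u v)"
    unfolding eq by (intro sqint_add sqint_diff aw zB(1) Az(1) zz(1))
  from sqint_add[OF d sqint_Mk[of k]]
  show "sqint ?P (case_prod (\<lambda>u v. Mhat Y p n k \<omega> u v))" by (simp add: split_beta')
  have "nrm ?P (\<lambda>(u, v). Mhat Y p n k \<omega> u v - Mk k u v)
     \<le> nrm ?P (\<lambda>x. case_prod (avgW p k n \<omega>) x - (case x of (u, v) \<Rightarrow> z u * B v) - (case x of (u, v) \<Rightarrow> A u * z v))
       + nrm I z * nrm I z"
    unfolding eq zz(2)[symmetric] by (intro nrm_triangle sqint_diff aw zB(1) Az(1) zz(1))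
  also have "nrm ?P (\<lambda>x. case_prod (avgW p k n \<omega>) x - (case x of (u, v) \<Rightarrow> z u * B v) - (case x of (u, v) \<Rightarrow> A u * z v))
     \<le> nrm ?P (\<lambda>x. case_prod (avgW p k n \<omega>) x - (case x of (u, v) \<Rightarrow> z u * B v)) + nrm I A * nrm I z"
    unfolding Az(2)[symmetric] by (intro nrm_diff_le sqint_diff aw zB(1) Az(1))
  also have "nrm ?P (\<lambda>x. case_prod (avgW p k n \<omega>) x - (case x of (u, v) \<Rightarrow> z u * B v))
     \<le> nrm ?P (case_prod (avgW p k n \<omega>)) + nrm I z * nrm I B"
    unfolding zB(2)[symmetric] by (intro nrm_diff_le aw zB(1))
  finally show "nrm ?P (\<lambda>(u, v). Mhat Y p n k \<omega> u v - Mk k u v) \<le> qbound p k n \<omega>"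
    by (simp add: qbound_def z_def A_def B_def)
qed

lemma qbound_nonneg: "0 \<le> qbound p k n \<omega>"
  by (simp add: qbound_def nrm_nonneg)

end

section \<open>Eigenstructure of the estimated operator\<close>

lemma Kop_eq_ksq: "Kop a b p Mk = ksq (Iab a b) p Mk"
  by (simp add: Kop_def[abs_def] ksq_def[abs_def] Nk_eq_kcomp)

lemma Khat_eq_ksq: "Khat a b Y p n \<omega> = ksq (Iab a b) p (\<lambda>k u v. Mhat Y p n k \<omega> u v)"
  by (simp add: Khat_def[abs_def] ksq_def[abs_def] kcomp_def set_integral_eq_Iab)

lemma orthonormal_on_iff: "orthonormal_on a b J e \<longleftrightarrow> (\<forall>i\<in>J. sqint (Iab a b) (e i)) \<and>
    (\<forall>i\<in>J. \<forall>j\<in>J. ip (Iab a b) (e i) (e j) = (if i = j then 1 else 0))"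
  by (simp add: orthonormal_on_def inL2_iff_sqint L2ip_eq_ip)

locale functional_factor_estimation = functional_factor_model M a b X eps Y mu Mk
  for M :: "'w measure" and a b :: real and X eps Y :: "int \<Rightarrow> 'w \<Rightarrow> real \<Rightarrow> real"
    and mu :: "real \<Rightarrow> real" and Mk :: "nat \<Rightarrow> real \<Rightarrow> real \<Rightarrow> real" +
  fixes d p :: nat and theta :: "nat \<Rightarrow> real" and phi psi :: "nat \<Rightarrow> real \<Rightarrow> real"
    and thetahat :: "nat \<Rightarrow> nat \<Rightarrow> 'w \<Rightarrow> real" and psihat :: "nat \<Rightarrow> nat \<Rightarrow> 'w \<Rightarrow> real \<Rightarrow> real"
  assumes phi_on: "orthonormal_on a b {1..d} phi"
    and M0_rest: "\<And>g. inL2 a b g \<Longrightarrow> (\<forall>j\<in>{1..d}. L2ip a b g (phi j) = 0) \<Longrightarrow>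
                    ae_eq_on a b (kapply a b (Mk 0) g) (\<lambda>_. 0)"
    and psi_on: "orthonormal_on a b {1..d} psi"
    and psi_eig: "\<And>j. j \<in> {1..d} \<Longrightarrow>
                    ae_eq_on a b (kapply a b (Kop a b p Mk) (psi j)) (\<lambda>u. theta j * psi j u)"
    and C3_dec: "\<And>j. 1 \<le> j \<Longrightarrow> j < d \<Longrightarrow> theta (Suc j) < theta j"
    and C3_pos: "theta d > 0"
    and C3_zero: "\<And>g. inL2 a b g \<Longrightarrow> (\<forall>j\<in>{1..d}. L2ip a b g (psi j) = 0) \<Longrightarrow>
                    ae_eq_on a b (kapply a b (Kop a b p Mk) g) (\<lambda>_. 0)"
    and hat_eig: "AE \<omega> in M. \<forall>n>p.
        orthonormal_on a b {1..} (\<lambda>j. psihat n j \<omega>) \<and>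
        (\<forall>j\<ge>1. ae_eq_on a b (kapply a b (Khat a b Y p n \<omega>) (psihat n j \<omega>))
                               (\<lambda>u. thetahat n j \<omega> * psihat n j \<omega> u)) \<and>
        (\<forall>i j. 1 \<le> i \<longrightarrow> i \<le> j \<longrightarrow> thetahat n j \<omega> \<le> thetahat n i \<omega>) \<and>
        (\<forall>g. inL2 a b g \<and> (\<forall>j\<ge>1. L2ip a b g (psihat n j \<omega>) = 0) \<longrightarrow> ae_eq_on a b g (\<lambda>_. 0))"
begin

lemma phi: "i \<in> {1..d} \<Longrightarrow> sqint I (phi i)"
  and phi_ip: "i \<in> {1..d} \<Longrightarrow> j \<in> {1..d} \<Longrightarrow> ip I (phi i) (phi j) = (if i = j then 1 else 0)"
  using phi_on unfolding orthonormal_on_iff by blast+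

lemma psi: "i \<in> {1..d} \<Longrightarrow> sqint I (psi i)"
  and psi_ip: "i \<in> {1..d} \<Longrightarrow> j \<in> {1..d} \<Longrightarrow> ip I (psi i) (psi j) = (if i = j then 1 else 0)"
  using psi_on unfolding orthonormal_on_iff by blast+

abbreviation "Q \<equiv> kform I I (ksq I p Mk)"

lemma Q_psi: "i \<in> {1..d} \<Longrightarrow> sqint I g \<Longrightarrow> Q (psi i) g = theta i * ip I (psi i) g"
  using psi_eig[of i] by (intro kform_ksq_eigen[OF sfI sqint_Mk psi])
    (auto simp: ae_eq_on_iff kapply_eq_kap Kop_eq_ksq)

lemma Q_perp:
  assumes "sqint I r" "sqint I g" "\<And>i. i \<in> {1..d} \<Longrightarrow> ip I r (psi i) = 0"
  shows "Q r g = 0"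
proof -
  have "AE u in I. kap I (ksq I p Mk) r u = 0 * r u"
    using C3_zero[of r] assms by (simp add: inL2_iff_sqint L2ip_eq_ip ae_eq_on_iff kapply_eq_kap Kop_eq_ksq)
  from kform_ksq_eigen[OF sfI sqint_Mk assms(1,2) this] show ?thesis by simp
qed

lemma theta_dec: "i \<in> {1..d} \<Longrightarrow> k \<in> {1..d} \<Longrightarrow> i < k \<Longrightarrow> theta k < theta i"
proof (induction k)
  case (Suc k)
  then have "theta (Suc k) < theta k" using C3_dec[of k] by auto
  then show ?case using Suc by (cases "i = k") auto
qed simp

lemma theta_pos: "i \<in> {1..d} \<Longrightarrow> 0 < theta i"
  using theta_dec[of i d] C3_pos by (cases "i = d") auto

text \<open>The almost sure event on which the remaining argument is deterministic, for all n > p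
  simultaneously.\<close>

definition good :: "'w \<Rightarrow> bool" where
  "good \<omega> \<longleftrightarrow> (\<forall>t. sqint I (Z t \<omega>)) \<and> (\<forall>n>p.
        orthonormal_on a b {1..} (\<lambda>j. psihat n j \<omega>) \<and>
        (\<forall>j\<ge>1. ae_eq_on a b (kapply a b (Khat a b Y p n \<omega>) (psihat n j \<omega>))
                               (\<lambda>u. thetahat n j \<omega> * psihat n j \<omega> u)) \<and>
        (\<forall>i j. 1 \<le> i \<longrightarrow> i \<le> j \<longrightarrow> thetahat n j \<omega> \<le> thetahat n i \<omega>) \<and>
        (\<forall>g. inL2 a b g \<and> (\<forall>j\<ge>1. L2ip a b g (psihat n j \<omega>) = 0) \<longrightarrow> ae_eq_on a b g (\<lambda>_. 0)))"

lemma AE_good: "AE \<omega> in M. good \<omega>"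
  using AE_sqint_Z hat_eig by eventually_elim (auto simp: good_def)

definition \<delta> :: "nat \<Rightarrow> 'w \<Rightarrow> real" where
  "\<delta> n \<omega> = HSnorm a b (\<lambda>u v. Khat a b Y p n \<omega> u v - Kop a b p Mk u v)"

text \<open>The bound of \<open>nrm_ksq_diff\<close> multiplied out: the linear part determines its
  order, while the quadratic part alone is \<open>sbound\<close>.\<close>

definition dbound :: "nat \<Rightarrow> 'w \<Rightarrow> real" where
  "dbound n \<omega> = (\<Sum>k=1..p. qbound p k n \<omega> * qbound p k n \<omega> + 2 * nrm (I \<Otimes>\<^sub>M I) (case_prod (Mk k)) * qbound p k n \<omega>)"

definition sbound :: "nat \<Rightarrow> 'w \<Rightarrow> real" where
  "sbound n \<omega> = (\<Sum>k=1..p. qbound p k n \<omega> * qbound p k n \<omega>)"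

lemma bigOp_sbound: "bigOp M sbound (\<lambda>n. 1 / real n)"
proof -
  have "bigOp M (\<lambda>n \<omega>. qbound p k n \<omega> * qbound p k n \<omega>) (\<lambda>n. 1 / real n)" if "k \<in> {1..p}" for k
    using bigOp_mult[OF bigOp_qbound bigOp_qbound, of k k p p] that by simp
  then show ?thesis unfolding sbound_def[abs_def] by (intro bigOp_sum) auto
qed

lemma inverse_le_inverse_sqrt: "1 / real n \<le> 1 / sqrt (real n)"
proof (cases "n = 0")
  case False
  then have "sqrt (real n) * 1 \<le> sqrt (real n) * sqrt (real n)" by (intro mult_left_mono) auto
  then show ?thesis using False by (intro divide_left_mono) auto
qed simp

lemma bigOp_sbound': "bigOp M sbound (\<lambda>n. 1 / sqrt (real n))"
  by (rule bigOp_rate[OF bigOp_sbound _ inverse_le_inverse_sqrt]) simp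

lemma bigOp_dbound: "bigOp M dbound (\<lambda>n. 1 / sqrt (real n))"
proof -
  have "bigOp M (\<lambda>n \<omega>. qbound p k n \<omega> * qbound p k n \<omega>) (\<lambda>n. 1 / sqrt (real n))" if "k \<in> {1..p}" for k
    using bigOp_mult[OF bigOp_qbound bigOp_qbound, of k k p p] that
    by (intro bigOp_rate[OF _ _ inverse_le_inverse_sqrt]) auto
  moreover have "bigOp M (\<lambda>n \<omega>. 2 * nrm (I \<Otimes>\<^sub>M I) (case_prod (Mk k)) * qbound p k n \<omega>) (\<lambda>n. 1 / sqrt (real n))"
    if "k \<in> {1..p}" for k
    using that by (intro bigOp_cmult bigOp_qbound) auto
  ultimately show ?thesis
    unfolding dbound_def[abs_def] by (intro bigOp_sum bigOp_add) auto
qed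

section \<open>Pathwise bounds on the good event\<close>

context
  fixes \<omega> n assumes g: "good \<omega>" and n: "n > p"
begin

abbreviation "R \<equiv> kform I I (ksq I p (\<lambda>k u v. Mhat Y p n k \<omega> u v))"

lemma Mhat_sqint: "sqint (I \<Otimes>\<^sub>M I) (case_prod (\<lambda>u v. Mhat Y p n k \<omega> u v))"
  using g n by (intro sqint_Mhat) (auto simp: good_def)

lemma Mhat_le: "nrm (I \<Otimes>\<^sub>M I) (\<lambda>(u, v). Mhat Y p n k \<omega> u v - Mk k u v) \<le> qbound p k n \<omega>"
  using g n by (intro nrm_Mhat_diff) (auto simp: good_def)

lemma psihat: "j \<ge> 1 \<Longrightarrow> sqint I (psihat n j \<omega>)"
  and psihat_ip: "i \<ge> 1 \<Longrightarrow> j \<ge> 1 \<Longrightarrow> ip I (psihat n i \<omega>) (psihat n j \<omega>) = (if i = j then 1 else 0)"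
  using g n by (auto simp: good_def orthonormal_on_iff)

lemma delta_eq: "\<delta> n \<omega> = nrm (I \<Otimes>\<^sub>M I) (\<lambda>(u, v). ksq I p (\<lambda>k u v. Mhat Y p n k \<omega> u v) u v - ksq I p Mk u v)"
  by (simp add: \<delta>_def HSnorm_eq_nrm Khat_eq_ksq Kop_eq_ksq)

lemma delta_le: "\<delta> n \<omega> \<le> dbound n \<omega>"
proof -
  have "\<delta> n \<omega> \<le> (\<Sum>k=1..p. nrm (I \<Otimes>\<^sub>M I) (\<lambda>(u, v). Mhat Y p n k \<omega> u v - Mk k u v) *
       (nrm (I \<Otimes>\<^sub>M I) (\<lambda>(u, v). Mhat Y p n k \<omega> u v - Mk k u v) + 2 * nrm (I \<Otimes>\<^sub>M I) (case_prod (Mk k))))"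
    unfolding delta_eq by (rule nrm_ksq_diff[OF sfI Mhat_sqint sqint_Mk])
  also have "\<dots> \<le> (\<Sum>k=1..p. qbound p k n \<omega> * (qbound p k n \<omega> + 2 * nrm (I \<Otimes>\<^sub>M I) (case_prod (Mk k))))"
    by (intro sum_mono mult_mono add_right_mono Mhat_le qbound_nonneg add_nonneg_nonneg)
      (auto simp: nrm_nonneg)
  finally show ?thesis by (simp add: dbound_def algebra_simps)
qed

lemma delta_nonneg: "0 \<le> \<delta> n \<omega>"
  by (simp add: delta_eq nrm_nonneg)

text \<open>Closeness is \<open>kform_bound\<close> for the difference kernel. The norm of the
  estimated kernel enters as the bound B, which provides continuity of R in eigenfunction
  expansions.\<close>

lemma forms_perturbed:
  "form_perturbation I Q R d theta (\<lambda>j. thetahat n j \<omega>) psi (\<lambda>j. psihat n j \<omega>) (\<delta> n \<omega>)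
     (nrm (I \<Otimes>\<^sub>M I) (case_prod (ksq I p (\<lambda>k u v. Mhat Y p n k \<omega> u v))))"
proof (rule form_perturbation.intro)
  show "finite_measure I" by (rule finite_measure_Iab)
  show "Q r h = 0" if "sqint I r" "sqint I h" "\<And>i. i \<in> {1..d} \<Longrightarrow> ip I r (psi i) = 0" for r h
    by (rule Q_perp[OF that])
  show "symform I Q" by (rule symform_ksq[OF sfI sqint_Mk])
  show "symform I R" by (rule symform_ksq[OF sfI Mhat_sqint])
  show "nrm I h = 0" if "sqint I h" "\<And>i. i \<ge> 1 \<Longrightarrow> ip I h (psihat n i \<omega>) = 0" for h
  proof (rule nrm_eq_0_AE)
    show "h \<in> borel_measurable I" using that(1) by (rule sqint_measurable)
    show "AE u in I. h u = 0"
      using g n that unfolding good_def by (simp add: inL2_iff_sqint L2ip_eq_ip ae_eq_on_iff)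
  qed
  show "R (psihat n i \<omega>) h = thetahat n i \<omega> * ip I (psihat n i \<omega>) h" if "i \<ge> 1" "sqint I h" for i h
    using g n that unfolding good_def
    by (intro kform_ksq_eigen[OF sfI Mhat_sqint psihat]) (auto simp: ae_eq_on_iff kapply_eq_kap Khat_eq_ksq)
  show "thetahat n k \<omega> \<le> thetahat n i \<omega>" if "1 \<le> i" "i \<le> k" for i k
    using g n that by (simp add: good_def)
  show "0 \<le> R h h" if "sqint I h" for h by (rule kform_ksq_nonneg[OF sfI Mhat_sqint that])
  show "\<bar>R h h'\<bar> \<le> nrm (I \<Otimes>\<^sub>M I) (case_prod (ksq I p (\<lambda>k u v. Mhat Y p n k \<omega> u v))) * (nrm I h * nrm I h')"
    if "sqint I h" "sqint I h'" for h h'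
    by (rule kform_bound[OF sfI sfI sqint_ksq[OF sfI Mhat_sqint] that])
  show "\<bar>R h h' - Q h h'\<bar> \<le> \<delta> n \<omega> * (nrm I h * nrm I h')" if "sqint I h" "sqint I h'" for h h'
  proof -
    have "sqint (I \<Otimes>\<^sub>M I) (\<lambda>(u, v). ksq I p (\<lambda>k u v. Mhat Y p n k \<omega> u v) u v - ksq I p Mk u v)"
      using sqint_diff[OF sqint_ksq[OF sfI Mhat_sqint] sqint_ksq[OF sfI sqint_Mk]] by (simp add: split_beta')
    from kform_bound[OF sfI sfI _ that, of "\<lambda>u v. ksq I p (\<lambda>k u v. Mhat Y p n k \<omega> u v) u v - ksq I p Mk u v"] this
    show ?thesis
      by (simp add: delta_eq kform_diff_kernel[OF sfI sfI sqint_ksq[OF sfI Mhat_sqint] sqint_ksq[OF sfI sqint_Mk] that])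
  qed
qed (auto simp: psi psi_ip Q_psi theta_dec theta_pos psihat psihat_ip)

interpretation E: form_perturbation I Q R d theta "\<lambda>j. thetahat n j \<omega>" psi "\<lambda>j. psihat n j \<omega>" "\<delta> n \<omega>"
  "nrm (I \<Otimes>\<^sub>M I) (case_prod (ksq I p (\<lambda>k u v. Mhat Y p n k \<omega> u v)))"
  by (rule forms_perturbed)

lemma thetahat_close: "j \<in> {1..d} \<Longrightarrow> \<bar>thetahat n j \<omega> - theta j\<bar> \<le> dbound n \<omega>"
  using E.eigenvalue_close[of j] delta_le by linarith

lemma psihat_close:
  assumes "j \<in> {1..d}" "0 < \<gamma>" "\<gamma> \<le> theta j" "\<And>i. i \<in> {1..d} \<Longrightarrow> i \<noteq> j \<Longrightarrow> \<gamma> \<le> \<bar>theta i - theta j\<bar>"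
  shows "min (nrm I (\<lambda>u. psihat n j \<omega> u - psi j u)) (nrm I (\<lambda>u. psihat n j \<omega> u + psi j u))
    \<le> (4 * (real d + 1) / \<gamma>) * dbound n \<omega>"
  using assms by (intro order_trans[OF E.eigenfunction_close[OF assms]] mult_left_mono delta_le) auto

lemma thetahat_nonneg: "j \<ge> 1 \<Longrightarrow> 0 \<le> thetahat n j \<omega>"
  by (rule E.t_nonneg)

text \<open>A function orthogonal to all \<open>psi\<close> has Q h h = 0, so the second-order bound
  \<open>kform_ksq_on_kernel\<close> supplies the constant for
  \<open>eigenvalue_tail_le\<close>.\<close>

lemma thetahat_tail:
  assumes "j \<ge> d + 1" shows "thetahat n j \<omega> \<le> sbound n \<omega>"
proof (rule E.eigenvalue_tail_le[OF _ assms])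
  fix h assume h: "sqint I h" and perp: "\<And>k. k \<in> {1..d} \<Longrightarrow> ip I h (psi k) = 0"
  have "R h h \<le> (\<Sum>k=1..p. (nrm (I \<Otimes>\<^sub>M I) (\<lambda>(u, v). Mhat Y p n k \<omega> u v - Mk k u v))\<^sup>2) * (nrm I h)\<^sup>2"
    by (rule kform_ksq_on_kernel[OF sfI Mhat_sqint sqint_Mk h Q_perp[OF h h perp]])
  also have "\<dots> \<le> sbound n \<omega> * (nrm I h)\<^sup>2"
    unfolding sbound_def power2_eq_square
    by (intro mult_right_mono sum_mono mult_mono Mhat_le qbound_nonneg) (auto simp: nrm_nonneg)
  finally show "R h h \<le> sbound n \<omega> * (nrm I h)\<^sup>2" .
qed

lemma psihat_tail:
  assumes "j \<ge> d + 1"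
  shows "nrm I (\<lambda>u. \<Sum>i=1..d. ip I (psi i) (psihat n j \<omega>) * psi i u)
    \<le> (\<Sum>i=1..d. 1 / theta i) * (dbound n \<omega> + sbound n \<omega>)"
proof -
  have "0 \<le> (\<Sum>i=1..d. 1 / theta i)" using theta_pos by (intro sum_nonneg) (auto simp: less_imp_le)
  then have "(\<delta> n \<omega> + thetahat n j \<omega>) * (\<Sum>i=1..d. 1 / theta i) \<le> (dbound n \<omega> + sbound n \<omega>) * (\<Sum>i=1..d. 1 / theta i)"
    using assms by (intro mult_right_mono add_mono delta_le thetahat_tail)
  with E.tail_projection_bound[of j] assms show ?thesis by (simp add: mult.commute)
qed

end

text \<open>Here \<open>M0_rest\<close> provides the vanishing variance: it makes the lag-0 form
  zero at r, and hence all lagged forms with r as first argument.\<close>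

lemma Q_phi_perp:
  assumes r: "sqint I r" and h: "sqint I h" and perp: "\<And>i. i \<in> {1..d} \<Longrightarrow> ip I r (phi i) = 0"
  shows "Q r h = 0"
proof -
  have ae: "AE u in I. kap I (Mk 0) r u = 0"
    using M0_rest[of r] r perp by (simp add: inL2_iff_sqint L2ip_eq_ip ae_eq_on_iff kapply_eq_kap)
  have "kform I I (Mk 0) r r = ip I (kap I (Mk 0) r) r"
    unfolding kform_kap(1)[OF sfI sfI sqint_Mk r r] by (rule ip_commute)
  also have "\<dots> = ip I (\<lambda>u. 0) r"
    by (rule ip_cong_AE[OF ae sqint_kap[OF sfI sfI sqint_Mk r] sqint_zero r])
  finally have ker: "kform I I (Mk 0) r r = 0" by (simp add: ip_zero_left)
  have T: "sqint I (kap I (\<lambda>z u. Mk k u z) h)" for k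
    using sqint_kap[OF sfI sfI _ h, of "\<lambda>z u. Mk k u z"] sqint_transpose(1)[OF sfI sfI sqint_Mk[of k]] by simp
  \<comment> \<open>Reading this as the form of \<open>Mk k\<close> at r and the square-integrable
    function T makes \<open>kform_Mk_eq_0\<close> applicable.\<close>
  have "ip I (kap I (\<lambda>z u. Mk k u z) r) (kap I (\<lambda>z u. Mk k u z) h) = 0" for k
    using kform_kap(2)[OF sfI sfI sqint_Mk r T, of k] kform_Mk_eq_0[OF r T ker, of k] by simp
  then show ?thesis unfolding kform_ksq[OF sfI sqint_Mk r h] by simp
qed

text \<open>Q annihilates the residual of \<open>psi i\<close> off the \<open>phi\<close>, and
  \<open>theta i\<close> is positive, so \<open>psi i\<close> is orthogonal to its own residual.
  That inner product is 1 minus the coefficient mass.\<close>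

lemma psi_in_span_phi:
  assumes i: "i \<in> {1..d}" shows "(\<Sum>k=1..d. (ip I (psi i) (phi k))\<^sup>2) = 1"
proof -
  define r where "r u = psi i u - (\<Sum>k=1..d. ip I (psi i) (phi k) * phi k u)" for u
  have r: "sqint I r" unfolding r_def[abs_def] by (intro sqint_diff sqint_sum sqint_cmult phi psi i)
  have "ip I r (phi k) = 0" if "k \<in> {1..d}" for k
    unfolding r_def[abs_def] by (rule ip_residual) (use phi phi_ip psi[OF i] that in auto)
  then have "Q r (psi i) = 0" by (rule Q_phi_perp[OF r psi[OF i]])
  then have "theta i * ip I (psi i) r = 0"
    using Q_psi[OF i r] symform_sym[OF symform_ksq[OF sfI sqint_Mk] r psi[OF i]] by simp
  then have "ip I (psi i) r = 0" using theta_pos[OF i] by simp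
  moreover have "ip I (psi i) r = ip I (psi i) (psi i) - (\<Sum>k=1..d. (ip I (psi i) (phi k))\<^sup>2)"
  proof -
    have "ip I (psi i) r = ip I (psi i) (psi i) - ip I (psi i) (\<lambda>u. \<Sum>k=1..d. ip I (psi i) (phi k) * phi k u)"
      unfolding r_def[abs_def] by (intro ip_diff_right psi i sqint_sum sqint_cmult phi)
    also have "ip I (psi i) (\<lambda>u. \<Sum>k=1..d. ip I (psi i) (phi k) * phi k u) = (\<Sum>k=1..d. (ip I (psi i) (phi k))\<^sup>2)"
      using phi psi[OF i] by (subst ip_sum_right) (auto simp: sqint_cmult ip_cmult_right power2_eq_square)
    finally show ?thesis .
  qed
  ultimately show ?thesis using psi_ip[OF i i] by simp
qed

text \<open>Both systems have \<open>d\<close> members, so the inclusion of the spans is an equality: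
  the matrix of inner products has total mass \<open>d\<close> and, by Bessel, column masses at most \<open>1\<close>.\<close>

lemma phi_in_span_psi:
  assumes k: "k \<in> {1..d}" shows "(\<Sum>i=1..d. (ip I (phi k) (psi i))\<^sup>2) = 1"
proof -
  have le: "(\<Sum>i=1..d. (ip I (phi k) (psi i))\<^sup>2) \<le> 1" if "k \<in> {1..d}" for k
    using Bessel[of "{1..d}" I psi "phi k"] psi psi_ip phi[OF that] phi_ip[OF that that] by (simp add: nrm_sq)
  have "(\<Sum>k=1..d. 1 - (\<Sum>i=1..d. (ip I (phi k) (psi i))\<^sup>2)) = real d - (\<Sum>k=1..d. \<Sum>i=1..d. (ip I (phi k) (psi i))\<^sup>2)"
    by (simp add: sum_subtractf)
  also have "(\<Sum>k=1..d. \<Sum>i=1..d. (ip I (phi k) (psi i))\<^sup>2) = (\<Sum>i=1..d. \<Sum>k=1..d. (ip I (psi i) (phi k))\<^sup>2)"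
    by (subst sum.swap) (intro sum.cong refl, subst ip_commute, rule refl)
  also have "\<dots> = (\<Sum>i=1..d. 1)" by (intro sum.cong refl psi_in_span_phi)
  finally have "(\<Sum>k=1..d. 1 - (\<Sum>i=1..d. (ip I (phi k) (psi i))\<^sup>2)) = 0" by simp
  then have "1 - (\<Sum>i=1..d. (ip I (phi k) (psi i))\<^sup>2) = 0"
    using k le by (subst (asm) sum_nonneg_eq_0_iff) auto
  then show ?thesis by simp
qed

lemma sum_coefficients_eq:
  assumes x: "sqint I x"
  shows "(\<Sum>i=1..d. (ip I x (psi i))\<^sup>2) = (\<Sum>k=1..d. (ip I x (phi k))\<^sup>2)"
proof (rule antisym)
  show "(\<Sum>i=1..d. (ip I x (psi i))\<^sup>2) \<le> (\<Sum>k=1..d. (ip I x (phi k))\<^sup>2)"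
    by (rule sum_coefficients_le_of_span) (use psi psi_ip phi phi_ip psi_in_span_phi x in auto)
  show "(\<Sum>k=1..d. (ip I x (phi k))\<^sup>2) \<le> (\<Sum>i=1..d. (ip I x (psi i))\<^sup>2)"
    by (rule sum_coefficients_le_of_span) (use psi psi_ip phi phi_ip phi_in_span_psi x in auto)
qed

text \<open>The series over e converges in L2 to some h, and x - h is the projection of x onto the
  span of \<open>phi\<close>, whose norm can be computed with \<open>psi\<close> by
  \<open>sum_coefficients_eq\<close>. The limit is taken of norms because the series need not
  converge pointwise; the proof also shows that this limit exists.\<close>

lemma projection_norm_eq_limit:
  assumes e: "\<And>i. i \<ge> d + 1 \<Longrightarrow> sqint I (e i)"
    and e_ip: "\<And>i j. i \<ge> d + 1 \<Longrightarrow> j \<ge> d + 1 \<Longrightarrow> ip I (e i) (e j) = (if i = j then 1 else 0)"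
    and e_phi: "\<And>i k. i \<ge> d + 1 \<Longrightarrow> k \<in> {1..d} \<Longrightarrow> ip I (e i) (phi k) = 0"
    and compl: "\<And>g. sqint I g \<Longrightarrow> (\<And>k. k \<in> {1..d} \<Longrightarrow> ip I g (phi k) = 0) \<Longrightarrow>
      (\<And>i. i \<ge> d + 1 \<Longrightarrow> ip I g (e i) = 0) \<Longrightarrow> nrm I g = 0"
    and x: "sqint I x"
  shows "nrm I (\<lambda>u. \<Sum>i=1..d. ip I (psi i) x * psi i u)
    = lim (\<lambda>N. nrm I (\<lambda>u. x u - (\<Sum>i=d+1..N. ip I (e i) x * e i u)))"
proof -
  obtain h where h: "sqint I h" "(\<lambda>n. nrm I (\<lambda>u. (\<Sum>i=d+1..n. ip I x (e i) * e i u) - h u)) \<longlonglongrightarrow> 0"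
    "\<And>i. i \<ge> d + 1 \<Longrightarrow> ip I h (e i) = ip I x (e i)"
    using orthonormal_projection[OF finite_measure_Iab e e_ip x] by blast
  define S where "S n u = (\<Sum>i=d+1..n. ip I x (e i) * e i u)" for n u
  have S: "sqint I (S n)" for n
    unfolding S_def[abs_def] by (intro sqint_sum sqint_cmult e) auto
  have Sh: "(\<lambda>n. nrm I (\<lambda>u. S n u - h u)) \<longlonglongrightarrow> 0" using h(2) by (simp add: S_def)
  define w where "w u = x u - h u" for u
  have w: "sqint I w" unfolding w_def[abs_def] by (intro sqint_diff x h(1))
  have h_phi: "ip I h (phi k) = 0" if k: "k \<in> {1..d}" for k
  proof -
    have "ip I (S n) (phi k) = 0" for n
    proof -
      have "ip I (S n) (phi k) = (\<Sum>i=d+1..n. ip I x (e i) * ip I (e i) (phi k))"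
        unfolding S_def[abs_def] using phi[OF k] e by (subst ip_sum_left) (auto simp: sqint_cmult ip_cmult_left)
      also have "\<dots> = 0" using e_phi k by (intro sum.neutral) auto
      finally show ?thesis .
    qed
    then show ?thesis using LIMSEQ_unique[OF tendsto_ip[OF S h(1) phi[OF k] Sh]] by simp
  qed
  have w_phi: "ip I w (phi k) = ip I x (phi k)" if "k \<in> {1..d}" for k
    unfolding w_def[abs_def] using h_phi[OF that] by (simp add: ip_diff_left x h(1) phi[OF that])
  have w_e: "ip I w (e i) = 0" if "i \<ge> d + 1" for i
    unfolding w_def[abs_def] using h(3)[OF that] by (simp add: ip_diff_left x h(1) e[OF that])
  \<comment> \<open>What remains of w after removing its \<open>phi\<close> part is orthogonal to
    both systems, so \<open>compl\<close> makes it null.\<close>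
  define w' where "w' u = w u - (\<Sum>k=1..d. ip I w (phi k) * phi k u)" for u
  have ws: "sqint I (\<lambda>u. \<Sum>k=1..d. ip I w (phi k) * phi k u)" by (intro sqint_sum sqint_cmult phi)
  have "nrm I w' = 0"
  proof (rule compl)
    show "sqint I w'" unfolding w'_def[abs_def] by (rule sqint_diff[OF w ws])
    show "ip I w' (phi k) = 0" if "k \<in> {1..d}" for k
      unfolding w'_def[abs_def] by (rule ip_residual) (use phi phi_ip w that in auto)
    show "ip I w' (e i) = 0" if i: "i \<ge> d + 1" for i
    proof -
      have "ip I (\<lambda>u. \<Sum>k=1..d. ip I w (phi k) * phi k u) (e i) = (\<Sum>k=1..d. ip I w (phi k) * ip I (e i) (phi k))"
        using phi e[OF i] by (subst ip_sum_left) (auto simp: sqint_cmult ip_cmult_left ip_commute[of I "e i"])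
      also have "\<dots> = 0" using e_phi[OF i] by simp
      finally show ?thesis
        unfolding w'_def[abs_def] ip_diff_left[OF w ws e[OF i]] using w_e[OF i] by simp
    qed
  qed
  then have "(nrm I w)\<^sup>2 = (\<Sum>k=1..d. (ip I w (phi k))\<^sup>2)"
    using nrm_sq_residual[of "{1..d}" I phi w] phi phi_ip w by (simp add: w'_def[abs_def])
  also have "\<dots> = (\<Sum>k=1..d. (ip I x (phi k))\<^sup>2)" using w_phi by simp
  also have "\<dots> = (\<Sum>i=1..d. (ip I x (psi i))\<^sup>2)" by (rule sum_coefficients_eq[OF x, symmetric])
  also have "\<dots> = (nrm I (\<lambda>u. \<Sum>i=1..d. ip I x (psi i) * psi i u))\<^sup>2"
    by (rule nrm_sum_orthonormal[symmetric]) (use psi psi_ip in auto)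
  finally have nw: "nrm I w = nrm I (\<lambda>u. \<Sum>i=1..d. ip I x (psi i) * psi i u)"
    by (rule power2_eq_imp_eq) (simp_all add: nrm_nonneg)
  have "(\<lambda>N. nrm I (\<lambda>u. x u - S N u)) \<longlonglongrightarrow> nrm I w"
  proof (rule tendsto_nrm)
    have "nrm I (\<lambda>u. (x u - S N u) - w u) = nrm I (\<lambda>u. S N u - h u)" for N
      using nrm_cmult[of I "-1" "\<lambda>u. S N u - h u"] by (simp add: w_def)
    then show "(\<lambda>N. nrm I (\<lambda>u. (x u - S N u) - w u)) \<longlonglongrightarrow> 0" using Sh by simp
  qed (auto intro: sqint_diff x S w)
  from limI[OF this] show ?thesis
    unfolding nw S_def by (simp add: ip_commute[of I x])
qed

section \<open>From pathwise bounds to stochastic orders\<close>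

lemma bigOp_HSnorm:
  "bigOp M (\<lambda>n \<omega>. HSnorm a b (\<lambda>u v. Khat a b Y p n \<omega> u v - Kop a b p Mk u v)) (\<lambda>n. 1 / sqrt (real n))"
proof (rule bigOp_mono[OF bigOp_dbound, of p])
  show "AE \<omega> in M. \<forall>n>p. \<bar>HSnorm a b (\<lambda>u v. Khat a b Y p n \<omega> u v - Kop a b p Mk u v)\<bar> \<le> \<bar>dbound n \<omega>\<bar>"
    using AE_good
  proof eventually_elim
    case (elim \<omega>)
    show ?case
      using delta_le[OF elim] delta_nonneg[OF elim] unfolding \<delta>_def by (auto intro: order_trans[OF _ abs_ge_self])
  qed
qed

lemma bigOp_thetahat:
  assumes "j \<in> {1..d}"
  shows "bigOp M (\<lambda>n \<omega>. \<bar>thetahat n j \<omega> - theta j\<bar>) (\<lambda>n. 1 / sqrt (real n))"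
proof (rule bigOp_mono[OF bigOp_dbound, of p])
  show "AE \<omega> in M. \<forall>n>p. \<bar>\<bar>thetahat n j \<omega> - theta j\<bar>\<bar> \<le> \<bar>dbound n \<omega>\<bar>"
    using AE_good
  proof eventually_elim
    case (elim \<omega>)
    show ?case
      using thetahat_close[OF elim _ assms] by (auto intro: order_trans[OF _ abs_ge_self])
  qed
qed

lemma bigOp_psihat:
  assumes j: "j \<in> {1..d}"
  shows "bigOp M (\<lambda>n \<omega>. min (nrm I (\<lambda>u. psihat n j \<omega> u - psi j u)) (nrm I (\<lambda>u. psihat n j \<omega> u + psi j u)))
    (\<lambda>n. 1 / sqrt (real n))"
proof -
  \<comment> \<open>The smallest distance from \<open>theta j\<close> to the rest of the spectrum of
    K; the entry \<open>theta j\<close> is its distance to 0 and keeps the set nonempty when d =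
    1.\<close>
  define \<gamma> where "\<gamma> = Min (insert (theta j) ((\<lambda>i. \<bar>theta i - theta j\<bar>) ` ({1..d} - {j})))"
  have pos: "0 < \<gamma>"
    unfolding \<gamma>_def
  proof (subst Min_gr_iff)
    show "\<forall>y\<in>insert (theta j) ((\<lambda>i. \<bar>theta i - theta j\<bar>) ` ({1..d} - {j})). 0 < y"
    proof
      fix y assume y: "y \<in> insert (theta j) ((\<lambda>i. \<bar>theta i - theta j\<bar>) ` ({1..d} - {j}))"
      have "theta i \<noteq> theta j" if "i \<in> {1..d}" "i \<noteq> j" for i
        using theta_dec[of i j] theta_dec[of j i] that j by (cases "i < j") auto
      then have "0 < \<bar>theta i - theta j\<bar>" if "i \<in> {1..d} - {j}" for i using that by simp
      then show "0 < y" using y theta_pos[OF j] by blast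
    qed
  qed auto
  have \<gamma>: "\<gamma> \<le> theta j" "\<And>i. i \<in> {1..d} \<Longrightarrow> i \<noteq> j \<Longrightarrow> \<gamma> \<le> \<bar>theta i - theta j\<bar>"
    unfolding \<gamma>_def by (auto intro!: Min_le)
  show ?thesis
  proof (rule bigOp_mono[OF bigOp_cmult[OF bigOp_dbound, where c = "4 * (real d + 1) / \<gamma>"], of p])
    show "AE \<omega> in M. \<forall>n>p. \<bar>min (nrm I (\<lambda>u. psihat n j \<omega> u - psi j u)) (nrm I (\<lambda>u. psihat n j \<omega> u + psi j u))\<bar>
        \<le> \<bar>4 * (real d + 1) / \<gamma> * dbound n \<omega>\<bar>"
      using AE_good
    proof eventually_elim
      case (elim \<omega>)
      show ?case
      proof (intro allI impI)
        fix n assume n: "n > p"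
        have "0 \<le> min (nrm I (\<lambda>u. psihat n j \<omega> u - psi j u)) (nrm I (\<lambda>u. psihat n j \<omega> u + psi j u))"
          by (simp add: nrm_nonneg)
        then show "\<bar>min (nrm I (\<lambda>u. psihat n j \<omega> u - psi j u)) (nrm I (\<lambda>u. psihat n j \<omega> u + psi j u))\<bar>
            \<le> \<bar>4 * (real d + 1) / \<gamma> * dbound n \<omega>\<bar>"
          using psihat_close[OF elim n j pos \<gamma>] by linarith
      qed
    qed
  qed simp
qed

lemma bigOp_thetahat_tail:
  assumes j: "j \<ge> d + 1" shows "bigOp M (\<lambda>n \<omega>. thetahat n j \<omega>) (\<lambda>n. 1 / real n)"
proof (rule bigOp_mono[OF bigOp_sbound, of p])
  show "AE \<omega> in M. \<forall>n>p. \<bar>thetahat n j \<omega>\<bar> \<le> \<bar>sbound n \<omega>\<bar>"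
    using AE_good
  proof eventually_elim
    case (elim \<omega>)
    show ?case
    proof (intro allI impI)
      fix n assume n: "n > p"
      \<comment> \<open>Positivity of the estimated operator turns the one-sided tail bound into a
        bound on the absolute value.\<close>
      have "0 \<le> thetahat n j \<omega>" by (rule thetahat_nonneg[OF elim n]) (use j in simp)
      then show "\<bar>thetahat n j \<omega>\<bar> \<le> \<bar>sbound n \<omega>\<bar>" using thetahat_tail[OF elim n j] by linarith
    qed
  qed
qed

lemma bigOp_psihat_tail:
  assumes j: "j \<ge> d + 1"
  shows "bigOp M (\<lambda>n \<omega>. nrm I (\<lambda>u. \<Sum>i=1..d. ip I (psi i) (psihat n j \<omega>) * psi i u)) (\<lambda>n. 1 / sqrt (real n))"
proof (rule bigOp_mono[OF bigOp_cmult[OF bigOp_add[OF bigOp_dbound bigOp_sbound'], where c = "\<Sum>i=1..d. 1 / theta i"], of p])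
  show "AE \<omega> in M. \<forall>n>p. \<bar>nrm I (\<lambda>u. \<Sum>i=1..d. ip I (psi i) (psihat n j \<omega>) * psi i u)\<bar>
      \<le> \<bar>(\<Sum>i=1..d. 1 / theta i) * (dbound n \<omega> + sbound n \<omega>)\<bar>"
    using AE_good
  proof eventually_elim
    case (elim \<omega>)
    show ?case
    proof (intro allI impI)
      fix n assume n: "n > p"
      show "\<bar>nrm I (\<lambda>u. \<Sum>i=1..d. ip I (psi i) (psihat n j \<omega>) * psi i u)\<bar>
          \<le> \<bar>(\<Sum>i=1..d. 1 / theta i) * (dbound n \<omega> + sbound n \<omega>)\<bar>"
        using psihat_tail[OF elim n j] nrm_nonneg[of I "\<lambda>u. \<Sum>i=1..d. ip I (psi i) (psihat n j \<omega>) * psi i u"]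
        by linarith
    qed
  qed
qed auto

lemma tail_projection_identity:
  assumes e: "orthonormal_on a b {d+1..} e" "\<forall>i\<ge>d+1. \<forall>k\<in>{1..d}. L2ip a b (e i) (phi k) = 0"
    "\<forall>g. inL2 a b g \<and> (\<forall>k\<in>{1..d}. L2ip a b g (phi k) = 0) \<and> (\<forall>i\<ge>d+1. L2ip a b g (e i) = 0)
       \<longrightarrow> ae_eq_on a b g (\<lambda>_. 0)"
    and j: "j \<ge> d + 1"
  shows "AE \<omega> in M. \<forall>n>p. nrm I (\<lambda>u. \<Sum>i=1..d. ip I (psi i) (psihat n j \<omega>) * psi i u) =
     lim (\<lambda>N. nrm I (\<lambda>u. psihat n j \<omega> u - (\<Sum>i=d+1..N. ip I (e i) (psihat n j \<omega>) * e i u)))"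
  using AE_good
proof eventually_elim
  case (elim \<omega>)
  show ?case
  proof (intro allI impI projection_norm_eq_limit)
    fix g assume g: "sqint I g" "\<And>k. k \<in> {1..d} \<Longrightarrow> ip I g (phi k) = 0" "\<And>i. i \<ge> d + 1 \<Longrightarrow> ip I g (e i) = 0"
    have "AE u in I. g u = 0"
      using e(3) g by (simp add: inL2_iff_sqint L2ip_eq_ip ae_eq_on_iff)
    then show "nrm I g = 0" by (rule nrm_eq_0_AE[OF sqint_measurable[OF g(1)]])
  next
    fix n assume "n > p"
    then show "sqint I (psihat n j \<omega>)" using psihat[OF elim] j by auto
  qed (use e(1,2) in \<open>auto simp: orthonormal_on_iff L2ip_eq_ip\<close>)
qed

end

theorem theorem1:
  fixes M :: "'w measure" and a b :: real
    and X eps Y :: "int \<Rightarrow> 'w \<Rightarrow> real \<Rightarrow> real"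
    and mu :: "real \<Rightarrow> real" and Mk :: "nat \<Rightarrow> real \<Rightarrow> real \<Rightarrow> real"
    and d p :: nat and lam theta :: "nat \<Rightarrow> real" and phi psi :: "nat \<Rightarrow> real \<Rightarrow> real"
    and thetahat :: "nat \<Rightarrow> nat \<Rightarrow> 'w \<Rightarrow> real"
    and psihat :: "nat \<Rightarrow> nat \<Rightarrow> 'w \<Rightarrow> real \<Rightarrow> real"
  assumes M: "prob_space M"
    and ab: "a < b" and d: "d \<ge> 1" and p: "p \<ge> 1"
    and Y_def: "\<And>t \<omega> u. Y t \<omega> u = X t \<omega> u + eps t \<omega> u"
    and X_meas: "\<And>t. (\<lambda>(\<omega>, u). X t \<omega> u) \<in> borel_measurable (M \<Otimes>\<^sub>M lborel)"
    and eps_meas: "\<And>t. (\<lambda>(\<omega>, u). eps t \<omega> u) \<in> borel_measurable (M \<Otimes>\<^sub>M lborel)"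
    and X_sq: "\<And>t u. u \<in> {a..b} \<Longrightarrow> integrable M (\<lambda>\<omega>. (X t \<omega> u)^2)"
    and eps_sq: "\<And>t u. u \<in> {a..b} \<Longrightarrow> integrable M (\<lambda>\<omega>. (eps t \<omega> u)^2)"
    and moment: "\<And>t. (\<integral>\<^sup>+u\<in>{a..b}. (\<integral>\<^sup>+\<omega>. ennreal ((X t \<omega> u)^2 + (eps t \<omega> u)^2) \<partial>M) \<partial>lborel) < \<infinity>"
    and eps_mean: "\<And>t u. u \<in> {a..b} \<Longrightarrow> (\<integral>\<omega>. eps t \<omega> u \<partial>M) = 0"
    and eps_uncorr: "\<And>t s u v. t \<noteq> s \<Longrightarrow> u \<in> {a..b} \<Longrightarrow> v \<in> {a..b} \<Longrightarrow>
                       (\<integral>\<omega>. eps t \<omega> u * eps s \<omega> v \<partial>M) = 0"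
    and mu_def: "\<And>t u. u \<in> {a..b} \<Longrightarrow> (\<integral>\<omega>. X t \<omega> u \<partial>M) = mu u"
    and Mk_def: "\<And>t k u v. u \<in> {a..b} \<Longrightarrow> v \<in> {a..b} \<Longrightarrow>
                   (\<integral>\<omega>. (X t \<omega> u - mu u) * (X (t + int k) \<omega> v - mu v) \<partial>M) = Mk k u v"
    and phi_on: "orthonormal_on a b {1..d} phi"
    and phi_eig: "\<And>j. j \<in> {1..d} \<Longrightarrow> ae_eq_on a b (kapply a b (Mk 0) (phi j)) (\<lambda>u. lam j * phi j u)"
    and lam_desc: "\<And>i j. 1 \<le> i \<Longrightarrow> i \<le> j \<Longrightarrow> j \<le> d \<Longrightarrow> lam j \<le> lam i"
    and lam_d: "lam d \<noteq> 0"
    and M0_rest: "\<And>g. inL2 a b g \<Longrightarrow> (\<forall>j\<in>{1..d}. L2ip a b g (phi j) = 0) \<Longrightarrow>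
                    ae_eq_on a b (kapply a b (Mk 0) g) (\<lambda>_. 0)"
    and C1: "strictly_stationary M a b Y \<and> psi_mixing_C1 M a b Y"
    and C2: "\<And>t. (\<integral>\<^sup>+\<omega>. ((\<integral>\<^sup>+u\<in>{a..b}. ennreal ((Y t \<omega> u)^2) \<partial>lborel))^2 \<partial>M) < \<infinity>"
    and psi_on: "orthonormal_on a b {1..d} psi"
    and psi_eig: "\<And>j. j \<in> {1..d} \<Longrightarrow>
                    ae_eq_on a b (kapply a b (Kop a b p Mk) (psi j)) (\<lambda>u. theta j * psi j u)"
    and C3_dec: "\<And>j. 1 \<le> j \<Longrightarrow> j < d \<Longrightarrow> theta (Suc j) < theta j"
    and C3_pos: "theta d > 0"
    and C3_zero: "\<And>g. inL2 a b g \<Longrightarrow> (\<forall>j\<in>{1..d}. L2ip a b g (psi j) = 0) \<Longrightarrow>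
                    ae_eq_on a b (kapply a b (Kop a b p Mk) g) (\<lambda>_. 0)"
    and C4: "\<And>s t u v. u \<in> {a..b} \<Longrightarrow> v \<in> {a..b} \<Longrightarrow>
               (\<integral>\<omega>. (X s \<omega> u - mu u) * eps t \<omega> v \<partial>M) = 0"
    and hat_eig: "AE \<omega> in M. \<forall>n>p.
        orthonormal_on a b {1..} (\<lambda>j. psihat n j \<omega>) \<and>
        (\<forall>j\<ge>1. ae_eq_on a b (kapply a b (Khat a b Y p n \<omega>) (psihat n j \<omega>))
                               (\<lambda>u. thetahat n j \<omega> * psihat n j \<omega> u)) \<and>
        (\<forall>i j. 1 \<le> i \<longrightarrow> i \<le> j \<longrightarrow> thetahat n j \<omega> \<le> thetahat n i \<omega>) \<and>
        (\<forall>g. inL2 a b g \<and> (\<forall>j\<ge>1. L2ip a b g (psihat n j \<omega>) = 0) \<longrightarrow> ae_eq_on a b g (\<lambda>_. 0))"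
  shows
    "bigOp M (\<lambda>n \<omega>. HSnorm a b (\<lambda>u v. Khat a b Y p n \<omega> u v - Kop a b p Mk u v)) (\<lambda>n. 1 / sqrt (real n))
     \<and> (\<forall>j\<in>{1..d}.
          bigOp M (\<lambda>n \<omega>. \<bar>thetahat n j \<omega> - theta j\<bar>) (\<lambda>n. 1 / sqrt (real n)) \<and>
          bigOp M (\<lambda>n \<omega>. min (L2norm a b (\<lambda>u. psihat n j \<omega> u - psi j u))
                              (L2norm a b (\<lambda>u. psihat n j \<omega> u + psi j u))) (\<lambda>n. 1 / sqrt (real n)))
     \<and> (\<forall>j\<ge>d+1. bigOp M (\<lambda>n \<omega>. thetahat n j \<omega>) (\<lambda>n. 1 / real n))
     \<and> (\<forall>e. orthonormal_on a b {d+1..} e \<and>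
            (\<forall>i\<ge>d+1. \<forall>k\<in>{1..d}. L2ip a b (e i) (phi k) = 0) \<and>
            (\<forall>g. inL2 a b g \<and> (\<forall>k\<in>{1..d}. L2ip a b g (phi k) = 0) \<and> (\<forall>i\<ge>d+1. L2ip a b g (e i) = 0)
                 \<longrightarrow> ae_eq_on a b g (\<lambda>_. 0))
          \<longrightarrow> (\<forall>j\<ge>d+1.
                (AE \<omega> in M. \<forall>n>p.
                   L2norm a b (\<lambda>u. \<Sum>i=1..d. L2ip a b (psi i) (psihat n j \<omega>) * psi i u) =
                   lim (\<lambda>N. L2norm a b (\<lambda>u. psihat n j \<omega> u -
                            (\<Sum>i=d+1..N. L2ip a b (e i) (psihat n j \<omega>) * e i u)))) \<and>
                bigOp M (\<lambda>n \<omega>. L2norm a b (\<lambda>u. \<Sum>i=1..d. L2ip a b (psi i) (psihat n j \<omega>) * psi i u))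
                      (\<lambda>n. 1 / sqrt (real n))))"
proof -
  interpret functional_factor_model M a b X eps Y mu Mk
    by (rule functional_factor_model.intro[OF M], rule functional_factor_model_axioms.intro)
      (fact Y_def X_meas eps_meas X_sq eps_sq moment eps_mean eps_uncorr mu_def Mk_def
        C1[THEN conjunct1] C1[THEN conjunct2] C2 C4)+
  interpret functional_factor_estimation M a b X eps Y mu Mk d p theta phi psi thetahat psihat
    by (rule functional_factor_estimation.intro[OF functional_factor_model_axioms],
        rule functional_factor_estimation_axioms.intro)
      (fact phi_on M0_rest psi_on psi_eig C3_dec C3_pos C3_zero hat_eig)+
  show ?thesis
  proof (intro conjI ballI allI impI; (elim conjE)?)
    show "bigOp M (\<lambda>n \<omega>. HSnorm a b (\<lambda>u v. Khat a b Y p n \<omega> u v - Kop a b p Mk u v)) (\<lambda>n. 1 / sqrt (real n))"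
      by (rule bigOp_HSnorm)
  next
    fix j assume j: "j \<in> {1..d}"
    show "bigOp M (\<lambda>n \<omega>. \<bar>thetahat n j \<omega> - theta j\<bar>) (\<lambda>n. 1 / sqrt (real n))"
      by (rule bigOp_thetahat[OF j])
    show "bigOp M (\<lambda>n \<omega>. min (L2norm a b (\<lambda>u. psihat n j \<omega> u - psi j u))
        (L2norm a b (\<lambda>u. psihat n j \<omega> u + psi j u))) (\<lambda>n. 1 / sqrt (real n))"
      unfolding L2norm_eq_nrm by (rule bigOp_psihat[OF j])
  next
    fix j assume j: "d + 1 \<le> j"
    show "bigOp M (\<lambda>n \<omega>. thetahat n j \<omega>) (\<lambda>n. 1 / real n)"
      by (rule bigOp_thetahat_tail[OF j])
  next
    fix e j
    assume e: "orthonormal_on a b {d+1..} e" "\<forall>i\<ge>d+1. \<forall>k\<in>{1..d}. L2ip a b (e i) (phi k) = 0"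
      "\<forall>g. inL2 a b g \<and> (\<forall>k\<in>{1..d}. L2ip a b g (phi k) = 0) \<and> (\<forall>i\<ge>d+1. L2ip a b g (e i) = 0)
         \<longrightarrow> ae_eq_on a b g (\<lambda>_. 0)"
      and j: "d + 1 \<le> j"
    show "AE \<omega> in M. \<forall>n>p. L2norm a b (\<lambda>u. \<Sum>i=1..d. L2ip a b (psi i) (psihat n j \<omega>) * psi i u) =
        lim (\<lambda>N. L2norm a b (\<lambda>u. psihat n j \<omega> u - (\<Sum>i=d+1..N. L2ip a b (e i) (psihat n j \<omega>) * e i u)))"
      unfolding L2norm_eq_nrm L2ip_eq_ip by (rule tail_projection_identity[OF e j])
    show "bigOp M (\<lambda>n \<omega>. L2norm a b (\<lambda>u. \<Sum>i=1..d. L2ip a b (psi i) (psihat n j \<omega>) * psi i u))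
        (\<lambda>n. 1 / sqrt (real n))"
      unfolding L2norm_eq_nrm L2ip_eq_ip by (rule bigOp_psihat_tail[OF j])
  qed
qed

end
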